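(* Let $V_1=[\alpha_1,\beta_1]$ and $V_2=[\alpha_2,\beta_2]$ be evaluation modules, and let $V$ be a non-trivial extension of $V_1$ by $V_2$ (i.e. $V_2$ is a submodule of $V$ with $V/V_2\cong V_1$, and $V\not\cong V_1\oplus V_2$). Then one of the following holds: (1) $\alpha_2=\alpha_1$, $\beta_2=\beta_1-4$, and $V\cong[\alpha_1,\beta_1-2]\otimes\beta_1$; (2) $\alpha_2=\alpha_1$, $\beta_2=\beta_1+4$, and $V\cong(\beta_1+4)\otimes[\alpha_1,\beta_1+2]$; (3) $\alpha_2=\alpha_1+4$, $\beta_2=\beta_1$, and $V\cong\alpha_1\otimes[\alpha_1+2,\beta_1]$; (4) $\alpha_2=\alpha_1-4$, $\beta_2=\beta_1$, and $V\cong[\alpha_1-2,\beta_1]\otimes(\alpha_1-4)$; (5) $\alpha_1=\alpha_2$, $\beta_1=\beta_2$, $V_1=V_2\ne\mathbb C$, and $V\cong \mathrm{SE}(\alpha_1,\beta_1)$, the self-extension defined in the context.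
   Context: Fix $q\in\mathbb C^\times$ not a root of unity and a value of $\log q$. $U=U_q\widehat{\mathfrak{sl}}_2$ (level zero) is the unital associative $\mathbb C$-algebra with generators $e_0,e_1,f_0,f_1,K^{\pm1}$ and relations $KK^{-1}=K^{-1}K=1$, $Ke_1K^{-1}=q^2e_1$, $Kf_1K^{-1}=q^{-2}f_1$, $Ke_0K^{-1}=q^{-2}e_0$, $Kf_0K^{-1}=q^{2}f_0$, $[e_1,f_1]=-[e_0,f_0]=\frac{K-K^{-1}}{q-q^{-1}}$, $[e_1,f_0]=[e_0,f_1]=0$, and for $i\neq j$ in $\{0,1\}$: $e_i^3e_j-(q^2+1+q^{-2})e_i^2e_je_i+(q^2+1+q^{-2})e_ie_je_i^2-e_je_i^3=0$ and the same relation with $e$ replaced by $f$. All modules are finite-dimensional and of type 1 (eigenvalues of $K$ are integer powers of $q$). Tensor products of $U$-modules are formed with the coproduct $\Delta(K^{\pm1})=K^{\pm1}\otimes K^{\pm1}$, $\Delta(e_0)=e_0\otimes K^{-1}+1\otimes e_0$, $\Delta(f_0)=f_0\otimes 1+K\otimes f_0$, $\Delta(e_1)=e_1\otimes K+1\otimes e_1$, $\Delta(f_1)=f_1\otimes 1+K^{-1}\otimes f_1$. The trivial module $\mathbb C$ has $e_i,f_i$ acting by $0$ and $K$ by $1$. Evaluation modules. For even integers $\alpha\le\beta$ put $m=\frac{\beta-\alpha}2+1$, $a=\frac{\alpha+\beta}{2}$, $[i]_q=\frac{q^i-q^{-i}}{q-q^{-1}}$. The evaluation module $[\alpha,\beta]$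 has basis $v_0,\dots,v_m$ with $Kv_i=q^{m-2i}v_i$, $f_1v_i=[i+1]_qv_{i+1}$, $e_1v_i=[m-i+1]_qv_{i-1}$ ($v_{-1}=v_{m+1}=0$), and $e_0=q^{a}f_1$, $f_0=q^{-a}e_1$. For a single even integer $a$, $a$ denotes the module $[a,a]$. The trivial module $\mathbb C$ is also regarded as an evaluation module, written $[\alpha,\alpha-2]$ for any even $\alpha$; when $V_1$ or $V_2$ is trivial, the conditions of the theorem are understood for a suitable choice of this $\alpha$, and every string $[\alpha,\beta]$ occurring satisfies $\beta\ge\alpha-2$. The self-extension $\mathrm{SE}(\alpha,\beta)$ for even integers $\alpha\le\beta$: put $a=\frac{\alpha+\beta}{2}$ and let $E,F,\kappa$ be the matrices of $e_1,f_1,K$ on $[\alpha,\beta]$ (of size $m+1$, where $m=\frac{\beta-\alpha}{2}+1$). The module $\mathrm{SE}(\alpha,\beta)$ has underlying space $[\alpha,\beta]\oplus[\alpha,\beta]$ with $$K\mapsto\begin{pmatrix}\kappa&0\\0&\kappa\end{pmatrix},\ e_1\mapsto\begin{pmatrix}E&0\\0&E\end{pmatrix},\ f_1\mapsto\begin{pmatrix}F&0\\0&F\end{pmatrix},\ e_0\mapsto q^a\begin{pmatrix}F&F\\0&F\end{pmatrix},\ f_0\mapsto q^{-a}\begin{pmatrix}E&-E\\0&E\end{pmatrix}.$$ *)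

theory Defs
  imports Complex_Main "HOL-Library.Function_Algebras" "HOL-Library.Product_Plus"
begin

section \<open>Complex vector spaces\<close>

class complex_vector = ab_group_add +
  fixes scaleC :: "complex \<Rightarrow> 'a \<Rightarrow> 'a"  (infixr \<open>*\<^sub>C\<close> 75)
  assumes scaleC_add_right: "a *\<^sub>C (x + y) = a *\<^sub>C x + a *\<^sub>C y"
    and scaleC_add_left: "(a + b) *\<^sub>C x = a *\<^sub>C x + b *\<^sub>C x"
    and scaleC_scaleC: "a *\<^sub>C (b *\<^sub>C x) = (a * b) *\<^sub>C x"
    and scaleC_one: "1 *\<^sub>C x = x"

global_interpretation complex_vector: vector_space "scaleC :: complex \<Rightarrow> 'a \<Rightarrow> 'a::complex_vector"
  by unfold_locales (simp_all add: scaleC_add_right scaleC_add_left scaleC_scaleC scaleC_one)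

instantiation complex :: complex_vector
begin
definition scaleC_complex :: "complex \<Rightarrow> complex \<Rightarrow> complex" where
  "scaleC_complex c x = c * x"
instance by standard (simp_all add: scaleC_complex_def algebra_simps)
end

instantiation "fun" :: (type, complex_vector) complex_vector
begin
definition scaleC_fun :: "complex \<Rightarrow> ('a \<Rightarrow> 'b) \<Rightarrow> 'a \<Rightarrow> 'b" where
  "scaleC_fun c f = (\<lambda>i. c *\<^sub>C f i)"
instance
  by standard
    (simp_all add: scaleC_fun_def fun_eq_iff scaleC_add_right scaleC_add_left scaleC_scaleC scaleC_one)
end

instantiation prod :: (complex_vector, complex_vector) complex_vector
begin
definition scaleC_prod :: "complex \<Rightarrow> 'a \<times> 'b \<Rightarrow> 'a \<times> 'b" where
  "scaleC_prod c p = (c *\<^sub>C fst p, c *\<^sub>C snd p)"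
instance
  by standard
    (simp_all add: scaleC_prod_def prod_eq_iff scaleC_add_right scaleC_add_left scaleC_scaleC scaleC_one)
end

section \<open>Modules over level-zero quantum affine sl2\<close>

datatype generator = E0 | E1 | F0 | F1 | K | Kinv

text \<open>
  The algebra is given by generators and relations, so a module is a vector space together with
  operators for the generators that satisfy the relations. The space is a subspace of an ambient
  complex vector space, and the operators matter only on that subspace.
\<close>

record 'v umodule =
  uspace :: "'v set"
  act :: "generator \<Rightarrow> 'v \<Rightarrow> 'v"

definition serre :: "complex \<Rightarrow> 'v::complex_vector set \<Rightarrow> ('v \<Rightarrow> 'v) \<Rightarrow> ('v \<Rightarrow> 'v) \<Rightarrow> bool" where
  "serre q S x y \<longleftrightarrow> (\<forall>v\<in>S.
     x (x (x (y v))) - (q\<^sup>2 + 1 + inverse (q\<^sup>2)) *\<^sub>C x (x (y (x v)))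
     + (q\<^sup>2 + 1 + inverse (q\<^sup>2)) *\<^sub>C x (y (x (x v))) - y (x (x (x v))) = 0)"

locale uq_module =
  fixes q :: complex and M :: "'v::complex_vector umodule"
  assumes subspace: "complex_vector.subspace (uspace M)"
    and finite_dimensional: "\<exists>B. finite B \<and> uspace M = complex_vector.span B"
    and act_closed: "v \<in> uspace M \<Longrightarrow> act M g v \<in> uspace M"
    and act_add: "v \<in> uspace M \<Longrightarrow> w \<in> uspace M \<Longrightarrow> act M g (v + w) = act M g v + act M g w"
    and act_scaleC: "v \<in> uspace M \<Longrightarrow> act M g (c *\<^sub>C v) = c *\<^sub>C act M g v"
    and K_Kinv: "v \<in> uspace M \<Longrightarrow> act M K (act M Kinv v) = v"
    and Kinv_K: "v \<in> uspace M \<Longrightarrow> act M Kinv (act M K v) = v"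
    and K_E1: "v \<in> uspace M \<Longrightarrow> act M K (act M E1 (act M Kinv v)) = q\<^sup>2 *\<^sub>C act M E1 v"
    and K_F1: "v \<in> uspace M \<Longrightarrow> act M K (act M F1 (act M Kinv v)) = inverse (q\<^sup>2) *\<^sub>C act M F1 v"
    and K_E0: "v \<in> uspace M \<Longrightarrow> act M K (act M E0 (act M Kinv v)) = inverse (q\<^sup>2) *\<^sub>C act M E0 v"
    and K_F0: "v \<in> uspace M \<Longrightarrow> act M K (act M F0 (act M Kinv v)) = q\<^sup>2 *\<^sub>C act M F0 v"
    and E1_F1: "v \<in> uspace M \<Longrightarrow> act M E1 (act M F1 v) - act M F1 (act M E1 v)
          = inverse (q - inverse q) *\<^sub>C (act M K v - act M Kinv v)"
    and E0_F0: "v \<in> uspace M \<Longrightarrow> - (act M E0 (act M F0 v) - act M F0 (act M E0 v))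
          = inverse (q - inverse q) *\<^sub>C (act M K v - act M Kinv v)"
    and E1_F0: "v \<in> uspace M \<Longrightarrow> act M E1 (act M F0 v) - act M F0 (act M E1 v) = 0"
    and E0_F1: "v \<in> uspace M \<Longrightarrow> act M E0 (act M F1 v) - act M F1 (act M E0 v) = 0"
    and serre_E01: "serre q (uspace M) (act M E0) (act M E1)"
    and serre_E10: "serre q (uspace M) (act M E1) (act M E0)"
    and serre_F01: "serre q (uspace M) (act M F0) (act M F1)"
    and serre_F10: "serre q (uspace M) (act M F1) (act M F0)"
    and type_1: "v \<in> uspace M \<Longrightarrow> v \<noteq> 0 \<Longrightarrow> act M K v = c *\<^sub>C v \<Longrightarrow> \<exists>n::int. c = q powi n"

definition isomorphic :: "'v::complex_vector umodule \<Rightarrow> 'w::complex_vector umodule \<Rightarrow> bool"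
    (infix \<open>\<cong>\<^sub>U\<close> 50) where
  "M \<cong>\<^sub>U N \<longleftrightarrow> (\<exists>\<phi>. bij_betw \<phi> (uspace M) (uspace N)
     \<and> (\<forall>v\<in>uspace M. \<forall>w\<in>uspace M. \<phi> (v + w) = \<phi> v + \<phi> w)
     \<and> (\<forall>c. \<forall>v\<in>uspace M. \<phi> (c *\<^sub>C v) = c *\<^sub>C \<phi> v)
     \<and> (\<forall>g. \<forall>v\<in>uspace M. \<phi> (act M g v) = act N g (\<phi> v)))"

definition submodule :: "'v::complex_vector set \<Rightarrow> 'v umodule \<Rightarrow> bool" where
  "submodule W M \<longleftrightarrow> complex_vector.subspace W \<and> W \<subseteq> uspace M \<and> (\<forall>g. \<forall>w\<in>W. act M g w \<in> W)"

definition coset :: "'v::complex_vector \<Rightarrow> 'v set \<Rightarrow> 'v set" where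
  "coset v W = (\<lambda>w. v + w) ` W"

text \<open>
  \<open>quotient_isomorphic M W N\<close> says that \<open>M / W\<close> is isomorphic to \<open>N\<close>. The elements of
  \<open>M / W\<close> are the cosets of \<open>W\<close>, with the operations induced from representatives; cosets do
  not live in a type of class \<open>complex_vector\<close>, so the isomorphism is spelled out.
\<close>

definition quotient_isomorphic ::
    "'v::complex_vector umodule \<Rightarrow> 'v set \<Rightarrow> 'w::complex_vector umodule \<Rightarrow> bool" where
  "quotient_isomorphic M W N \<longleftrightarrow> (\<exists>\<phi>. bij_betw \<phi> ((\<lambda>v. coset v W) ` uspace M) (uspace N)
     \<and> (\<forall>v\<in>uspace M. \<forall>w\<in>uspace M. \<phi> (coset (v + w) W) = \<phi> (coset v W) + \<phi> (coset w W))
     \<and> (\<forall>c. \<forall>v\<in>uspace M. \<phi> (coset (c *\<^sub>C v) W) = c *\<^sub>C \<phi> (coset v W))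
     \<and> (\<forall>g. \<forall>v\<in>uspace M. \<phi> (coset (act M g v) W) = act N g (\<phi> (coset v W))))"

definition direct_sum ::
    "'v::complex_vector umodule \<Rightarrow> 'w::complex_vector umodule \<Rightarrow> ('v \<times> 'w) umodule"
    (infixr \<open>\<oplus>\<^sub>U\<close> 65) where
  "M \<oplus>\<^sub>U N = \<lparr>uspace = uspace M \<times> uspace N, act = (\<lambda>g (v, w). (act M g v, act N g w))\<rparr>"

text \<open>\<open>V\<close> is an extension of \<open>V1\<close> (the quotient) by \<open>V2\<close> (the submodule).\<close>

definition extension :: "'v::complex_vector umodule \<Rightarrow> 'a::complex_vector umodule \<Rightarrow>
    'b::complex_vector umodule \<Rightarrow> bool" where
  "extension V V1 V2 \<longleftrightarrow>
     (\<exists>W. submodule W V \<and> V\<lparr>uspace := W\<rparr> \<cong>\<^sub>U V2 \<and> quotient_isomorphic V W V1)"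

definition nontrivial_extension :: "'v::complex_vector umodule \<Rightarrow> 'a::complex_vector umodule \<Rightarrow>
    'b::complex_vector umodule \<Rightarrow> bool" where
  "nontrivial_extension V V1 V2 \<longleftrightarrow> extension V V1 V2 \<and> \<not> V \<cong>\<^sub>U V1 \<oplus>\<^sub>U V2"

definition trivial_module :: "complex umodule" where
  "trivial_module = \<lparr>uspace = UNIV,
     act = (\<lambda>g z. case g of K \<Rightarrow> z | Kinv \<Rightarrow> z | _ \<Rightarrow> 0)\<rparr>"

section \<open>Tensor products\<close>

text \<open>
  For spaces of functions \<open>A\<close> on \<open>'i\<close> and \<open>B\<close> on \<open>'j\<close>, the tensor product is the span of the
  functions \<open>(i, j) \<mapsto> a i * b j\<close> on \<open>'i \<times> 'j\<close>. All slices of an element lie in \<open>A\<close>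
  resp. \<open>B\<close>, and \<open>X \<otimes> 1\<close> resp. \<open>1 \<otimes> X\<close> act on the slices.
\<close>

definition tensor :: "('i \<Rightarrow> complex) \<Rightarrow> ('j \<Rightarrow> complex) \<Rightarrow> 'i \<times> 'j \<Rightarrow> complex" where
  "tensor a b = (\<lambda>(i, j). a i * b j)"

definition on_left :: "(('i \<Rightarrow> complex) \<Rightarrow> 'i \<Rightarrow> complex) \<Rightarrow>
    ('i \<times> 'j \<Rightarrow> complex) \<Rightarrow> 'i \<times> 'j \<Rightarrow> complex" where
  "on_left X h = (\<lambda>(i, j). X (\<lambda>k. h (k, j)) i)"

definition on_right :: "(('j \<Rightarrow> complex) \<Rightarrow> 'j \<Rightarrow> complex) \<Rightarrow>
    ('i \<times> 'j \<Rightarrow> complex) \<Rightarrow> 'i \<times> 'j \<Rightarrow> complex" where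
  "on_right X h = (\<lambda>(i, j). X (\<lambda>k. h (i, k)) j)"

definition tensor_product ::
    "('i \<Rightarrow> complex) umodule \<Rightarrow> ('j \<Rightarrow> complex) umodule \<Rightarrow> ('i \<times> 'j \<Rightarrow> complex) umodule"
    (infixr \<open>\<otimes>\<^sub>U\<close> 70) where
  "M \<otimes>\<^sub>U N = \<lparr>
     uspace = complex_vector.span {tensor a b | a b. a \<in> uspace M \<and> b \<in> uspace N},
     act = (\<lambda>g h. let l = (\<lambda>g. on_left (act M g)); r = (\<lambda>g. on_right (act N g)) in
       case g of
         K \<Rightarrow> l K (r K h)
       | Kinv \<Rightarrow> l Kinv (r Kinv h)
       | E0 \<Rightarrow> l E0 (r Kinv h) + r E0 h
       | F0 \<Rightarrow> l F0 h + l K (r F0 h)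
       | E1 \<Rightarrow> l E1 (r K h) + r E1 h
       | F1 \<Rightarrow> l F1 h + l Kinv (r F1 h))\<rparr>"

section \<open>Evaluation modules and self-extensions\<close>

definition qint :: "complex \<Rightarrow> int \<Rightarrow> complex" where
  "qint q i = (q powi i - q powi (- i)) / (q - inverse q)"

text \<open>The basis vector \<open>v\<^sub>i\<close>, which is \<open>0\<close> for \<open>i = -1\<close> and for \<open>i = m + 1\<close>.\<close>

definition bvec :: "nat \<Rightarrow> int \<Rightarrow> nat \<Rightarrow> complex" where
  "bvec m i = (\<lambda>j. if int j = i \<and> j \<le> m then 1 else 0)"

text \<open>The linear map with \<open>v\<^sub>i \<mapsto> w i\<close>.\<close>

definition linear_ext :: "nat \<Rightarrow> (int \<Rightarrow> nat \<Rightarrow> complex) \<Rightarrow> (nat \<Rightarrow> complex) \<Rightarrow> nat \<Rightarrow> complex" where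
  "linear_ext m w x = (\<Sum>i\<le>m. x i *\<^sub>C w (int i))"

text \<open>
  Strings \<open>[\<alpha>, \<beta>]\<close>; \<open>\<beta> = \<alpha> - 2\<close> gives \<open>m = 0\<close> and the trivial module. For even \<open>\<alpha>\<close> and
  \<open>\<beta>\<close> the number \<open>a = (\<alpha> + \<beta>) / 2\<close> is an integer, so \<open>q\<^sup>a\<close> does not depend on a choice
  of \<open>log q\<close>.
\<close>

definition is_string :: "int \<Rightarrow> int \<Rightarrow> bool" where
  "is_string \<alpha> \<beta> \<longleftrightarrow> even \<alpha> \<and> even \<beta> \<and> \<beta> \<ge> \<alpha> - 2"

definition eval_module :: "complex \<Rightarrow> int \<Rightarrow> int \<Rightarrow> (nat \<Rightarrow> complex) umodule" where
  "eval_module q \<alpha> \<beta> =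
    (let m = nat ((\<beta> - \<alpha>) div 2 + 1); a = (\<alpha> + \<beta>) div 2;
         f = linear_ext m (\<lambda>i. qint q (i + 1) *\<^sub>C bvec m (i + 1));
         e = linear_ext m (\<lambda>i. qint q (int m - i + 1) *\<^sub>C bvec m (i - 1))
     in \<lparr>uspace = complex_vector.span {bvec m (int i) | i. i \<le> m},
         act = (\<lambda>g. case g of
             K \<Rightarrow> linear_ext m (\<lambda>i. q powi (int m - 2 * i) *\<^sub>C bvec m i)
           | Kinv \<Rightarrow> linear_ext m (\<lambda>i. q powi (- (int m - 2 * i)) *\<^sub>C bvec m i)
           | F1 \<Rightarrow> f
           | E1 \<Rightarrow> e
           | E0 \<Rightarrow> (\<lambda>x. q powi a *\<^sub>C f x)
           | F0 \<Rightarrow> (\<lambda>x. q powi (- a) *\<^sub>C e x))\<rparr>)"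

definition self_extension ::
    "complex \<Rightarrow> int \<Rightarrow> int \<Rightarrow> ((nat \<Rightarrow> complex) \<times> (nat \<Rightarrow> complex)) umodule" where
  "self_extension q \<alpha> \<beta> =
    (let M = eval_module q \<alpha> \<beta>; a = (\<alpha> + \<beta>) div 2; E = act M E1; F = act M F1
     in \<lparr>uspace = uspace M \<times> uspace M,
         act = (\<lambda>g (x, y). case g of
             E0 \<Rightarrow> (q powi a *\<^sub>C (F x + F y), q powi a *\<^sub>C F y)
           | F0 \<Rightarrow> (q powi (- a) *\<^sub>C (E x - E y), q powi (- a) *\<^sub>C E y)
           | _ \<Rightarrow> (act M g x, act M g y))\<rparr>)"

text \<open>
  \<open>same_string \<alpha> \<beta> \<alpha>' \<beta>'\<close>: both strings are notations for the same evaluation module. They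
  coincide, unless the module is trivial, when they are \<open>[\<alpha>, \<alpha> - 2]\<close> and \<open>[\<alpha>', \<alpha>' - 2]\<close>
  for arbitrary even \<open>\<alpha>\<close> and \<open>\<alpha>'\<close>.
\<close>

definition same_string :: "int \<Rightarrow> int \<Rightarrow> int \<Rightarrow> int \<Rightarrow> bool" where
  "same_string \<alpha> \<beta> \<alpha>' \<beta>' \<longleftrightarrow> is_string \<alpha> \<beta> \<and> is_string \<alpha>' \<beta>' \<and>
     ((\<alpha>' = \<alpha> \<and> \<beta>' = \<beta>) \<or> (\<beta> = \<alpha> - 2 \<and> \<beta>' = \<alpha>' - 2))"

end

theory Submission
  imports Defs
begin

text \<open>
  The elements \<open>e\<^sub>1, f\<^sub>1, K\<close> generate a copy of \<open>U\<^sub>q(sl\<^sub>2)\<close>, over which the extension splits: if the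
  two highest weights differ, an affine function of the Casimir operator projects onto a complement,
  and if they agree, the Casimir operator shows that \<open>K\<close> acts diagonally on a highest weight
  lift. So \<open>V\<close> is \<open>V\<^sub>1 \<oplus> V\<^sub>2\<close> with \<open>e\<^sub>0\<close> and \<open>f\<^sub>0\<close> changed by off-diagonal maps
  \<open>X, Y : V\<^sub>1 \<rightarrow> V\<^sub>2\<close>. As \<open>e\<^sub>0\<close> commutes with \<open>f\<^sub>1\<close> and has weight \<open>-2\<close>, \<open>X\<close> is
  determined up to a scalar, and it vanishes unless the highest weights \<open>m\<^sub>1, m\<^sub>2\<close> differ by \<open>0\<close>
  or \<open>\<plusminus>2\<close>; the same holds for \<open>Y\<close>. The relation for \<open>[e\<^sub>0, f\<^sub>0]\<close> then fixes the ratio of the two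
  scalars and forces the evaluation parameters to differ by \<open>\<plusminus>2\<close> (for \<open>m\<^sub>1 \<noteq> m\<^sub>2\<close>) or to be equal
  (for \<open>m\<^sub>1 = m\<^sub>2\<close>). Up to rescaling, one module is left in each case, and decomposing the tensor
  products explicitly over \<open>U\<^sub>q(sl\<^sub>2)\<close> identifies it. The Serre relations are never needed.
\<close>

section \<open>Quantum integers\<close>

text \<open>Up to a power of \<open>K\<close>, the commutation and weight conditions make
  \<open>X\<close> a lowest weight vector of weight -2 for the adjoint action of U_q(sl_2) on
  Hom(V_1, V_2). By Clebsch-Gordan the three-dimensional module occurs there at most once, and only
  if the highest weights differ by 0 or 2; hence one scalar per map and three cases. An off-diagonal
  block maps quotient to submodule, so products of two such blocks vanish and the relation for
  [e_0, f_0] is linear in the scalars. The delicate splitting is the one for equal highest weights: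
  the Casimir operator has a single eigenvalue, and \<open>K\<close> is only known to have powers of
  \<open>q\<close> as eigenvalues, not to be diagonalizable. Moreover the section is then not
  unique, and for different evaluation parameters changing it removes the off-diagonal block. A
  trivial module has no parameter of its own, so its string must be chosen. If the other module is
  three-dimensional, the two tensor products available for it as submodule (or as quotient)
  coincide, so one choice suffices.\<close>

locale generic_q =
  fixes q :: complex
  assumes q_nonzero [simp]: "q \<noteq> 0"
    and q_power_neq_1: "n > 0 \<Longrightarrow> q ^ n \<noteq> 1"
begin

lemma powi_eq_1_iff [simp]: "q powi n = 1 \<longleftrightarrow> n = 0"
proof
  assume h: "q powi n = 1"
  show "n = 0"
  proof (rule ccontr)
    assume "n \<noteq> 0"
    then have pos: "nat \<bar>n\<bar> > 0" by simp
    have "q powi \<bar>n\<bar> = 1"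
      using h by (cases "n \<ge> 0") (simp_all add: power_int_minus)
    then have "q ^ nat \<bar>n\<bar> = 1"
      by (simp add: power_int_def)
    with q_power_neq_1[OF pos] show False ..
  qed
qed simp

lemma powi_inject [simp]: "q powi m = q powi n \<longleftrightarrow> m = n"
proof
  assume "q powi m = q powi n"
  then have "q powi (m - n) = 1" by (simp add: power_int_diff)
  then show "m = n" by simp
qed simp

lemma q_neq_inverse [simp]: "q \<noteq> inverse q"
proof
  assume "q = inverse q"
  then have "q powi 1 = q powi (- 1)" by (simp add: power_int_minus)
  then show False unfolding powi_inject by simp
qed

lemma qint_eq_0_iff [simp]: "qint q n = 0 \<longleftrightarrow> n = 0"
  by (simp add: qint_def)

end

lemma qint_0 [simp]: "qint q 0 = 0"
  by (simp add: qint_def)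

context generic_q begin

lemma qint_1 [simp]: "qint q 1 = 1"
  by (simp add: qint_def power_int_minus)

definition qden :: complex where "qden = inverse (q - inverse q)"

lemma qden_nonzero [simp]: "qden \<noteq> 0"
  by (simp add: qden_def)

lemma qden_mult [simp]: "qden * (q - inverse q) = 1"
  by (simp add: qden_def)

lemma qint_qden: "qint q n = qden * (q powi n - inverse (q powi n))"
  by (simp add: qint_def qden_def divide_inverse power_int_minus mult.commute)

lemmas qint_expand = qint_qden power_int_add power_int_diff power_int_minus power_int_mult power2_eq_square

end

section \<open>Evaluation modules in coordinates\<close>

definition supported :: "nat \<Rightarrow> (nat \<Rightarrow> complex) set" where
  "supported m = {x. \<forall>j>m. x j = 0}"

definition unit_vec :: "nat \<Rightarrow> nat \<Rightarrow> complex" where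
  "unit_vec i = (\<lambda>j. if j = i then 1 else 0)"

text \<open>The coefficient vanishes where the shifted index would leave the string:
  \<open>qint q 0 = 0\<close> disarms the truncated \<open>j - 1\<close> at \<open>j = 0\<close>,
  and in \<open>Eop\<close> the factor at \<open>j = m\<close> does the same for the entry
  \<open>m + 1\<close>.\<close>

definition Fop :: "complex \<Rightarrow> nat \<Rightarrow> (nat \<Rightarrow> complex) \<Rightarrow> nat \<Rightarrow> complex" where
  "Fop q m x = (\<lambda>j. if j \<le> m then qint q (int j) * x (j - 1) else 0)"

definition Eop :: "complex \<Rightarrow> nat \<Rightarrow> (nat \<Rightarrow> complex) \<Rightarrow> nat \<Rightarrow> complex" where
  "Eop q m x = (\<lambda>j. if j \<le> m then qint q (int m - int j) * x (j + 1) else 0)"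

definition Kop :: "complex \<Rightarrow> nat \<Rightarrow> (nat \<Rightarrow> complex) \<Rightarrow> nat \<Rightarrow> complex" where
  "Kop q m x = (\<lambda>j. if j \<le> m then q powi (int m - 2 * int j) * x j else 0)"

definition Kinvop :: "complex \<Rightarrow> nat \<Rightarrow> (nat \<Rightarrow> complex) \<Rightarrow> nat \<Rightarrow> complex" where
  "Kinvop q m x = (\<lambda>j. if j \<le> m then q powi (2 * int j - int m) * x j else 0)"

definition ev_act :: "complex \<Rightarrow> nat \<Rightarrow> int \<Rightarrow> generator \<Rightarrow> (nat \<Rightarrow> complex) \<Rightarrow> nat \<Rightarrow> complex" where
  "ev_act q m a g x = (case g of
       K \<Rightarrow> Kop q m x
     | Kinv \<Rightarrow> Kinvop q m x
     | F1 \<Rightarrow> Fop q m x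
     | E1 \<Rightarrow> Eop q m x
     | E0 \<Rightarrow> q powi a *\<^sub>C Fop q m x
     | F0 \<Rightarrow> q powi (- a) *\<^sub>C Eop q m x)"

lemma ev_act_simps [simp]:
  "ev_act q m a K = Kop q m" "ev_act q m a Kinv = Kinvop q m"
  "ev_act q m a F1 = Fop q m" "ev_act q m a E1 = Eop q m"
  "ev_act q m a E0 = (\<lambda>x. q powi a *\<^sub>C Fop q m x)" "ev_act q m a F0 = (\<lambda>x. q powi (- a) *\<^sub>C Eop q m x)"
  by (auto simp: ev_act_def)

text \<open>With \<open>m\<close> and \<open>a\<close> as in the context, \<open>ev q m a\<close> is the string \<open>[a - m + 1, a + m - 1]\<close>.\<close>

definition ev :: "complex \<Rightarrow> nat \<Rightarrow> int \<Rightarrow> (nat \<Rightarrow> complex) umodule" where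
  "ev q m a = \<lparr>uspace = supported m, act = ev_act q m a\<rparr>"

lemma ev_simps [simp]: "uspace (ev q m a) = supported m" "act (ev q m a) = ev_act q m a"
  by (simp_all add: ev_def)

lemma sum_apply: "(\<Sum>i\<in>I. f i) x = (\<Sum>i\<in>I. f i x)"
  for f :: "'i \<Rightarrow> 'a \<Rightarrow> 'b::comm_monoid_add"
  by (induction I rule: infinite_finite_induct) auto

lemma scaleC_apply [simp]: "(c *\<^sub>C f) x = c *\<^sub>C f x"
  by (simp add: scaleC_fun_def)

lemma scaleC_complex [simp]: "c *\<^sub>C (z::complex) = c * z"
  by (simp add: scaleC_complex_def)

lemma subspace_supported: "complex_vector.subspace (supported m)"
  by (auto simp: complex_vector.subspace_def supported_def)

lemma supported_expand: "x \<in> supported m \<Longrightarrow> x = (\<Sum>i\<le>m. x i *\<^sub>C unit_vec i)"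
  by (rule ext) (auto simp: sum_apply unit_vec_def supported_def if_distrib cong: if_cong)

lemma unit_vec_sp [simp]: "i \<le> m \<Longrightarrow> unit_vec i \<in> supported m"
  by (auto simp: unit_vec_def supported_def)

lemma span_bvec: "complex_vector.span {bvec m (int i) | i. i \<le> m} = supported m"
proof
  show "complex_vector.span {bvec m (int i) | i. i \<le> m} \<subseteq> supported m"
    by (rule complex_vector.span_minimal[OF _ subspace_supported]) (auto simp: bvec_def supported_def)
next
  have b: "bvec m (int i) = unit_vec i" if "i \<le> m" for i
    using that by (auto simp: bvec_def unit_vec_def)
  show "supported m \<subseteq> complex_vector.span {bvec m (int i) | i. i \<le> m}"
  proof
    fix x assume "x \<in> supported m"
    then have "x = (\<Sum>i\<le>m. x i *\<^sub>C unit_vec i)" by (rule supported_expand)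
    also have "\<dots> \<in> complex_vector.span {bvec m (int i) | i. i \<le> m}"
      by (intro complex_vector.span_sum complex_vector.span_scale complex_vector.span_base)
        (auto simp flip: b)
    finally show "x \<in> complex_vector.span {bvec m (int i) | i. i \<le> m}" .
  qed
qed

lemma linear_ext_apply: "linear_ext m w x j = (\<Sum>i\<le>m. x i * w (int i) j)"
  by (simp add: linear_ext_def sum_apply)

lemma linear_ext_Fop: "linear_ext m (\<lambda>i. qint q (i + 1) *\<^sub>C bvec m (i + 1)) = Fop q m"
proof (intro ext)
  fix x j
  have "linear_ext m (\<lambda>i. qint q (i + 1) *\<^sub>C bvec m (i + 1)) x j
      = (\<Sum>i\<le>m. if Suc i = j then (if j \<le> m then qint q (int j) * x i else 0) else 0)"
    unfolding linear_ext_apply by (rule sum.cong[OF refl]) (auto simp: bvec_def add.commute)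
  also have "\<dots> = Fop q m x j"
    by (cases j) (auto simp: Fop_def)
  finally show "linear_ext m (\<lambda>i. qint q (i + 1) *\<^sub>C bvec m (i + 1)) x j = Fop q m x j" .
qed

lemma linear_ext_Eop: "linear_ext m (\<lambda>i. qint q (int m - i + 1) *\<^sub>C bvec m (i - 1)) = Eop q m"
proof (intro ext)
  fix x j
  have "linear_ext m (\<lambda>i. qint q (int m - i + 1) *\<^sub>C bvec m (i - 1)) x j
      = (\<Sum>i\<le>m. if i = Suc j then (if j \<le> m then qint q (int m - int j) * x i else 0) else 0)"
    unfolding linear_ext_apply by (rule sum.cong[OF refl]) (auto simp: bvec_def add.commute)
  also have "\<dots> = Eop q m x j"
    by (cases "j = m") (auto simp: Eop_def)
  finally show "linear_ext m (\<lambda>i. qint q (int m - i + 1) *\<^sub>C bvec m (i - 1)) x j = Eop q m x j" .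
qed

lemma linear_ext_diagonal: "linear_ext m (\<lambda>i. c i *\<^sub>C bvec m i) = (\<lambda>x j. if j \<le> m then c (int j) * x j else 0)"
proof (intro ext)
  fix x j
  have "linear_ext m (\<lambda>i. c i *\<^sub>C bvec m i) x j
      = (\<Sum>i\<le>m. if i = j then (if j \<le> m then c (int j) * x j else 0) else 0)"
    unfolding linear_ext_apply by (rule sum.cong[OF refl]) (auto simp: bvec_def add.commute)
  then show "linear_ext m (\<lambda>i. c i *\<^sub>C bvec m i) x j = (if j \<le> m then c (int j) * x j else 0)"
    by simp
qed

lemma eval_module_eq_ev:
  assumes "\<alpha> = a - int m + 1" "\<beta> = a + int m - 1"
  shows "eval_module q \<alpha> \<beta> = ev q m a"
proof -
  have m: "nat ((\<beta> - \<alpha>) div 2 + 1) = m" and a: "(\<alpha> + \<beta>) div 2 = a"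
    using assms by auto
  show ?thesis
    unfolding eval_module_def Let_def m a span_bvec linear_ext_Fop linear_ext_Eop linear_ext_diagonal ev_def
    by (auto simp: fun_eq_iff Kop_def Kinvop_def ev_act_def split: generator.split)
qed

lemma is_string_params:
  assumes "is_string \<alpha> \<beta>"
  obtains m a where "\<alpha> = a - int m + 1" "\<beta> = a + int m - 1"
proof -
  from assms obtain k l where kl: "\<alpha> = 2 * k" "\<beta> = 2 * l" "l - k + 1 \<ge> 0"
    by (auto simp: is_string_def elim!: evenE)
  then have "\<alpha> = (k + l) - int (nat (l - k + 1)) + 1" "\<beta> = (k + l) + int (nat (l - k + 1)) - 1"
    by simp_all
  then show ?thesis by (rule that)
qed

text \<open>Both \<open>E0\<close> and \<open>F0\<close> act by zero here, so the parameter leaves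
  no trace. The final proof uses this to give a trivial module the string that a case
  requires.\<close>

lemma ev_0: "ev q 0 a = ev q 0 b"
  by (auto simp: ev_def ev_act_def fun_eq_iff Fop_def Eop_def split: generator.split)

section \<open>Tensor products with a two-dimensional module\<close>

definition supported2 :: "nat \<Rightarrow> nat \<Rightarrow> (nat \<times> nat \<Rightarrow> complex) set" where
  "supported2 m n = {h. \<forall>i j. m < i \<or> n < j \<longrightarrow> h (i, j) = 0}"

text \<open>Up to scalars, these four maps are the off-diagonal parts possible when the highest
  weights differ by 2. Those with suffix \<open>_e\<close> have weight -2 and commute with
  \<open>F1\<close>, those with \<open>_f\<close> have weight 2 and commute with \<open>E1\<close>.
  In \<open>up_e\<close> the quantum integers vanish at \<open>j = 0\<close> and
  \<open>j = 1\<close>, where \<open>j - 2\<close> is truncated.\<close>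

definition down_e :: "nat \<Rightarrow> (nat \<Rightarrow> complex) \<Rightarrow> nat \<Rightarrow> complex" where
  "down_e m2 x = (\<lambda>j. if j \<le> m2 then x j else 0)"

definition down_f :: "(nat \<Rightarrow> complex) \<Rightarrow> nat \<Rightarrow> complex" where
  "down_f x = (\<lambda>j. x (j + 2))"

definition up_e :: "complex \<Rightarrow> (nat \<Rightarrow> complex) \<Rightarrow> nat \<Rightarrow> complex" where
  "up_e q x = (\<lambda>j. qint q (int j) * qint q (int j - 1) * x (j - 2))"

definition up_f :: "complex \<Rightarrow> nat \<Rightarrow> (nat \<Rightarrow> complex) \<Rightarrow> nat \<Rightarrow> complex" where
  "up_f q m2 x = (\<lambda>j. qint q (int m2 - int j) * qint q (int m2 - int j - 1) * x j)"

lemma uspace_tensor: "uspace (ev q m a \<otimes>\<^sub>U ev q n b) = supported2 m n"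
proof -
  let ?T = "{tensor x y | x y. x \<in> supported m \<and> y \<in> supported n}"
  have "complex_vector.span ?T \<subseteq> supported2 m n"
    by (rule complex_vector.span_minimal)
      (auto simp: supported2_def supported_def tensor_def complex_vector.subspace_def)
  moreover have "h \<in> complex_vector.span ?T" if h: "h \<in> supported2 m n" for h
  proof -
    have T: "tensor (unit_vec i) (unit_vec j) \<in> ?T" if "i \<le> m" "j \<le> n" for i j
      using that unit_vec_sp by blast
    have "h = (\<Sum>i\<le>m. \<Sum>j\<le>n. h (i, j) *\<^sub>C tensor (unit_vec i) (unit_vec j))"
    proof (rule ext, clarify)
      fix k l
      have "(\<Sum>i\<le>m. \<Sum>j\<le>n. h (i, j) *\<^sub>C tensor (unit_vec i) (unit_vec j)) (k, l)
          = (\<Sum>i\<le>m. \<Sum>j\<le>n. if l = j then (if k = i then h (i, j) else 0) else 0)"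
        unfolding sum_apply by (intro sum.cong refl) (simp add: tensor_def unit_vec_def)
      also have "\<dots> = h (k, l)"
        using h by (cases "l \<le> n"; cases "k \<le> m") (auto simp: supported2_def)
      finally show "h (k, l) = (\<Sum>i\<le>m. \<Sum>j\<le>n. h (i, j) *\<^sub>C tensor (unit_vec i) (unit_vec j)) (k, l)" ..
    qed
    also have "\<dots> \<in> complex_vector.span ?T"
      by (intro complex_vector.span_sum complex_vector.span_scale complex_vector.span_base T) auto
    finally show ?thesis .
  qed
  ultimately show ?thesis by (auto simp: tensor_product_def)
qed

lemma act_tensor:
  "act (ev q m a \<otimes>\<^sub>U ev q n b) K h (i, j) = Kop q m (\<lambda>k. Kop q n (\<lambda>l. h (k, l)) j) i"
  "act (ev q m a \<otimes>\<^sub>U ev q n b) Kinv h (i, j) = Kinvop q m (\<lambda>k. Kinvop q n (\<lambda>l. h (k, l)) j) i"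
  "act (ev q m a \<otimes>\<^sub>U ev q n b) E0 h (i, j) = q powi a * Fop q m (\<lambda>k. Kinvop q n (\<lambda>l. h (k, l)) j) i
     + q powi b * Fop q n (\<lambda>l. h (i, l)) j"
  "act (ev q m a \<otimes>\<^sub>U ev q n b) F0 h (i, j) = q powi (- a) * Eop q m (\<lambda>k. h (k, j)) i
     + Kop q m (\<lambda>k. q powi (- b) * Eop q n (\<lambda>l. h (k, l)) j) i"
  "act (ev q m a \<otimes>\<^sub>U ev q n b) E1 h (i, j) = Eop q m (\<lambda>k. Kop q n (\<lambda>l. h (k, l)) j) i
     + Eop q n (\<lambda>l. h (i, l)) j"
  "act (ev q m a \<otimes>\<^sub>U ev q n b) F1 h (i, j) = Fop q m (\<lambda>k. h (k, j)) i
     + Kinvop q m (\<lambda>k. Fop q n (\<lambda>l. h (k, l)) j) i"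
  by (simp_all add: tensor_product_def on_left_def on_right_def)

lemmas op_defs = Fop_def Eop_def Kop_def Kinvop_def

text \<open>
  The decomposition of \<open>V\<^sub>m \<otimes> V\<^sub>1\<close>, \<open>m = n + 1\<close>, over \<open>U\<^sub>q(sl\<^sub>2)\<close>: the images of the basis vectors of
  \<open>V\<^bsub>m+1\<^esub>\<close> and \<open>V\<^bsub>m-1\<^esub>\<close> are the divided powers of \<open>f\<^sub>1\<close> applied to the highest weight vectors
  \<open>v\<^sub>0 \<otimes> u\<^sub>0\<close> and \<open>v\<^sub>1 \<otimes> u\<^sub>0 - q [m] v\<^sub>0 \<otimes> u\<^sub>1\<close>. In \<open>V\<^sub>1 \<otimes> V\<^sub>m\<close> they are \<open>u\<^sub>0 \<otimes> v\<^sub>0\<close> and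
  \<open>q\<^sup>m u\<^sub>0 \<otimes> v\<^sub>1 - [m] u\<^sub>1 \<otimes> v\<^sub>0\<close>.
\<close>

definition right_map :: "complex \<Rightarrow> nat \<Rightarrow> (nat \<Rightarrow> complex) \<Rightarrow> (nat \<Rightarrow> complex) \<Rightarrow> nat \<times> nat \<Rightarrow> complex" where
  "right_map q n x y = (\<lambda>(i, j). if i \<le> n + 1 \<and> j \<le> 1 then
     (if j = 0 then x i + qint q (int i) * y (i - 1)
      else q powi (int i - int n - 1) * x (i + 1) - q powi (int i + 1) * qint q (int n + 1 - int i) * y i) else 0)"

lemma right_map_in: "right_map q n x y \<in> supported2 (n + 1) 1"
  by (auto simp: right_map_def supported2_def)

lemma right_map_eqI:
  assumes "h \<in> supported2 (n + 1) 1"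
    and "\<And>i. i \<le> n + 1 \<Longrightarrow> h (i, 0) = right_map q n x y (i, 0)"
    and "\<And>i. i \<le> n + 1 \<Longrightarrow> h (i, 1) = right_map q n x y (i, 1)"
  shows "h = right_map q n x y"
proof (rule ext, clarify)
  fix i j :: nat
  consider "i \<le> n + 1" "j = 0" | "i \<le> n + 1" "j = 1" | "n + 1 < i \<or> 1 < j" by linarith
  then show "h (i, j) = right_map q n x y (i, j)"
    by cases (use assms in \<open>auto simp: right_map_def supported2_def\<close>)
qed

definition left_map :: "complex \<Rightarrow> nat \<Rightarrow> (nat \<Rightarrow> complex) \<Rightarrow> (nat \<Rightarrow> complex) \<Rightarrow> nat \<times> nat \<Rightarrow> complex" where
  "left_map q n x y = (\<lambda>(i, j). if i \<le> 1 \<and> j \<le> n + 1 then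
     (if i = 0 then q powi (- int j) * x j + q powi (int n + 2 - int j) * qint q (int j) * y (j - 1)
      else x (j + 1) - qint q (int n + 1 - int j) * y j) else 0)"

lemma left_map_in: "left_map q n x y \<in> supported2 1 (n + 1)"
  by (auto simp: left_map_def supported2_def)

lemma left_map_eqI:
  assumes "h \<in> supported2 1 (n + 1)"
    and "\<And>j. j \<le> n + 1 \<Longrightarrow> h (0, j) = left_map q n x y (0, j)"
    and "\<And>j. j \<le> n + 1 \<Longrightarrow> h (1, j) = left_map q n x y (1, j)"
  shows "h = left_map q n x y"
proof (rule ext, clarify)
  fix i j :: nat
  consider "j \<le> n + 1" "i = 0" | "j \<le> n + 1" "i = 1" | "1 < i \<or> n + 1 < j" by linarith
  then show "h (i, j) = left_map q n x y (i, j)"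
    by cases (use assms in \<open>auto simp: left_map_def supported2_def\<close>)
qed

lemma act_tensor_in: "h \<in> supported2 m n \<Longrightarrow> act (ev q m a \<otimes>\<^sub>U ev q n b) g h \<in> supported2 m n"
  unfolding supported2_def by (cases g) (auto simp: act_tensor op_defs)

lemmas coordinate_defs = act_tensor right_map_def left_map_def op_defs down_e_def down_f_def up_e_def up_f_def

context generic_q begin

lemma powi_mult:
  "q powi a * q powi b = q powi (a + b)"
  "q powi a * (q powi b * z) = q powi (a + b) * z"
  "q powi a * (z * q powi b) = q powi (a + b) * z"
  by (simp_all add: power_int_add)

lemma qint_powi: "qint q n = qden * q powi n - qden * q powi (- n)"
  by (simp add: qint_qden power_int_minus algebra_simps)

end

text \<open>In each inner weight space, \<open>right_map\<close> is a two-by-two system for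
  \<open>h (i, 0)\<close> and \<open>h (i - 1, 1)\<close> in the unknowns \<open>x i\<close> and
  \<open>y (i - 1)\<close>. Its determinant is \<open>- qint q (int n + 2)\<close>, nonzero for
  generic \<open>q\<close>, and the formulas are Cramer's rule.\<close>

definition right_inv :: "complex \<Rightarrow> nat \<Rightarrow> (nat \<times> nat \<Rightarrow> complex) \<Rightarrow> (nat \<Rightarrow> complex) \<times> (nat \<Rightarrow> complex)" where
  "right_inv q n h =
     (\<lambda>i. if i \<le> n + 2 then (q powi int i * qint q (int n + 2 - int i) * h (i, 0) + qint q (int i) * h (i - 1, 1)) / qint q (int n + 2) else 0,
      \<lambda>i. if i \<le> n then (q powi (int i - int n - 1) * h (i + 1, 0) - h (i, 1)) / qint q (int n + 2) else 0)"

definition left_inv :: "complex \<Rightarrow> nat \<Rightarrow> (nat \<times> nat \<Rightarrow> complex) \<Rightarrow> (nat \<Rightarrow> complex) \<times> (nat \<Rightarrow> complex)" where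
  "left_inv q n h =
     (\<lambda>j. if j \<le> n + 2 then (qint q (int n + 2 - int j) * h (0, j)
        + q powi (int n + 2 - int j) * qint q (int j) * h (1, j - 1)) / qint q (int n + 2) else 0,
      \<lambda>j. if j \<le> n then (h (0, j + 1) - q powi (- int j - 1) * h (1, j)) / qint q (int n + 2) else 0)"

context generic_q begin

text \<open>Up to sign, this is the determinant of the system that \<open>right_inv\<close> solves;
  it depends on \<open>n\<close> alone.\<close>

lemma right_map_identity:
  "q powi int i * qint q (int n + 2 - int i) + qint q (int i) * q powi (int i - int n - 2) = qint q (int n + 2)"
  by (simp add: qint_expand field_simps)

lemma right_inv_right_map:
  assumes x: "x \<in> supported (n + 2)" and y: "y \<in> supported n"
  shows "right_inv q n (right_map q n x y) = (x, y)"
proof -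
  have N: "qint q (int n + 2) \<noteq> 0" by simp
  have 1: "q powi int i * qint q (int n + 2 - int i) * right_map q n x y (i, 0) + qint q (int i) * right_map q n x y (i - 1, 1)
      = qint q (int n + 2) * x i" if "i \<le> n + 2" for i
  proof -
    have "q powi int i * qint q (int n + 2 - int i) * right_map q n x y (i, 0) + qint q (int i) * right_map q n x y (i - 1, 1)
      = (q powi int i * qint q (int n + 2 - int i) + qint q (int i) * q powi (int i - int n - 2)) * x i"
      using that by (cases i; cases "i = n + 2") (auto simp: right_map_def algebra_simps)
    then show ?thesis unfolding right_map_identity .
  qed
  have 2: "q powi (int i - int n - 1) * right_map q n x y (i + 1, 0) - right_map q n x y (i, 1) = qint q (int n + 2) * y i" if "i \<le> n" for i
  proof -
    have "q powi (int i - int n - 1) * right_map q n x y (i + 1, 0) - right_map q n x y (i, 1)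
      = (q powi int (i + 1) * qint q (int n + 2 - int (i + 1)) + qint q (int (i + 1)) * q powi (int (i + 1) - int n - 2)) * y i"
      using that by (auto simp: right_map_def algebra_simps)
    then show ?thesis unfolding right_map_identity .
  qed
  show ?thesis
  proof (rule prod_eqI; rule ext)
    fix i
    show "fst (right_inv q n (right_map q n x y)) i = fst (x, y) i"
      unfolding right_inv_def fst_conv using x N 1[of i] by (cases "i \<le> n + 2") (simp_all only: if_True if_False, auto simp: supported_def)
    show "snd (right_inv q n (right_map q n x y)) i = snd (x, y) i"
      unfolding right_inv_def snd_conv using y N 2[of i] by (cases "i \<le> n") (simp_all only: if_True if_False, auto simp: supported_def)
  qed
qed

lemma right_map_right_inv:
  assumes h: "h \<in> supported2 (n + 1) 1"
  shows "right_map q n (fst (right_inv q n h)) (snd (right_inv q n h)) = h"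
proof (rule ext, clarify)
  fix i j :: nat
  have N: "qint q (int n + 2) \<noteq> 0" by simp
  consider "i > n + 1 \<or> j > 1" | "i \<le> n + 1" "j = 0" | "i \<le> n + 1" "j = 1" by linarith
  then show "right_map q n (fst (right_inv q n h)) (snd (right_inv q n h)) (i, j) = h (i, j)"
  proof cases
    case 1
    then show ?thesis using h by (auto simp: right_map_def supported2_def)
  next
    case 2
    have "right_map q n (fst (right_inv q n h)) (snd (right_inv q n h)) (i, 0) =
      (q powi int i * qint q (int n + 2 - int i) + qint q (int i) * q powi (int i - int n - 2)) * h (i, 0) / qint q (int n + 2)"
      using 2 by (cases i) (auto simp: right_map_def right_inv_def diff_divide_distrib add_divide_distrib algebra_simps)
    then show ?thesis unfolding right_map_identity using N 2 by simp
  next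
    case 3
    have "right_map q n (fst (right_inv q n h)) (snd (right_inv q n h)) (i, 1) =
      (q powi int (i + 1) * qint q (int n + 2 - int (i + 1)) + qint q (int (i + 1)) * q powi (int (i + 1) - int n - 2)) * h (i, 1) / qint q (int n + 2)"
      using 3 by (cases "i = n + 1") (auto simp: right_map_def right_inv_def diff_divide_distrib add_divide_distrib algebra_simps)
    then show ?thesis unfolding right_map_identity using N 3 by simp
  qed
qed

text \<open>The analogous determinant for \<open>h (0, j)\<close> and \<open>h (1, j - 1)\<close> in
  the unknowns \<open>x j\<close> and \<open>y (j - 1)\<close>.\<close>

lemma left_map_identity:
  "q powi (- int j) * qint q (int n + 2 - int j) + q powi (int n + 2 - int j) * qint q (int j) = qint q (int n + 2)"
  by (simp add: qint_expand field_simps)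

lemma left_inv_left_map:
  assumes x: "x \<in> supported (n + 2)" and y: "y \<in> supported n"
  shows "left_inv q n (left_map q n x y) = (x, y)"
proof -
  have N: "qint q (int n + 2) \<noteq> 0" by simp
  have 1: "qint q (int n + 2 - int j) * left_map q n x y (0, j) + q powi (int n + 2 - int j) * qint q (int j) * left_map q n x y (1, j - 1)
      = qint q (int n + 2) * x j" if "j \<le> n + 2" for j
  proof -
    have "qint q (int n + 2 - int j) * left_map q n x y (0, j) + q powi (int n + 2 - int j) * qint q (int j) * left_map q n x y (1, j - 1)
      = (q powi (- int j) * qint q (int n + 2 - int j) + q powi (int n + 2 - int j) * qint q (int j)) * x j"
      using that by (cases j; cases "j = n + 2") (auto simp: left_map_def algebra_simps)
    then show ?thesis unfolding left_map_identity .
  qed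
  have 2: "left_map q n x y (0, j + 1) - q powi (- int j - 1) * left_map q n x y (1, j) = qint q (int n + 2) * y j" if "j \<le> n" for j
  proof -
    have "left_map q n x y (0, j + 1) - q powi (- int j - 1) * left_map q n x y (1, j)
      = (q powi (- int (j + 1)) * qint q (int n + 2 - int (j + 1)) + q powi (int n + 2 - int (j + 1)) * qint q (int (j + 1))) * y j"
      using that by (auto simp: left_map_def power_int_diff power_int_minus field_simps)
    then show ?thesis unfolding left_map_identity .
  qed
  show ?thesis
  proof (rule prod_eqI; rule ext)
    fix j
    show "fst (left_inv q n (left_map q n x y)) j = fst (x, y) j"
      unfolding left_inv_def fst_conv using x N 1[of j] by (cases "j \<le> n + 2") (simp_all only: if_True if_False, auto simp: supported_def)
    show "snd (left_inv q n (left_map q n x y)) j = snd (x, y) j"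
      unfolding left_inv_def snd_conv using y N 2[of j] by (cases "j \<le> n") (simp_all only: if_True if_False, auto simp: supported_def)
  qed
qed

lemma left_map_left_inv:
  assumes h: "h \<in> supported2 1 (n + 1)"
  shows "left_map q n (fst (left_inv q n h)) (snd (left_inv q n h)) = h"
proof (rule ext, clarify)
  fix i j :: nat
  have N: "qint q (int n + 2) \<noteq> 0" by simp
  consider "i > 1 \<or> j > n + 1" | "j \<le> n + 1" "i = 0" | "j \<le> n + 1" "i = 1" by linarith
  then show "left_map q n (fst (left_inv q n h)) (snd (left_inv q n h)) (i, j) = h (i, j)"
  proof cases
    case 1
    then show ?thesis using h by (auto simp: left_map_def supported2_def)
  next
    case 2
    have "left_map q n (fst (left_inv q n h)) (snd (left_inv q n h)) (0, j) =
      (q powi (- int j) * qint q (int n + 2 - int j) + q powi (int n + 2 - int j) * qint q (int j)) * h (0, j) / qint q (int n + 2)"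
    proof (cases j)
      case (Suc k)
      have "q powi (int n + 2 - int j) * q powi (- int k - 1) = q powi (- int j) * q powi (int n + 2 - int j)"
        unfolding Suc by (simp add: mult.commute)
      then show ?thesis
        using 2 Suc by (auto simp: left_map_def left_inv_def diff_divide_distrib add_divide_distrib algebra_simps)
    qed (use 2 in \<open>simp add: left_map_def left_inv_def\<close>)
    then show ?thesis unfolding left_map_identity using N 2 by simp
  next
    case 3
    have "left_map q n (fst (left_inv q n h)) (snd (left_inv q n h)) (1, j) =
      (q powi (- int (j + 1)) * qint q (int n + 2 - int (j + 1)) + q powi (int n + 2 - int (j + 1)) * qint q (int (j + 1))) * h (1, j) / qint q (int n + 2)"
      using 3 by (cases "j = n + 1") (auto simp: left_map_def left_inv_def diff_divide_distrib add_divide_distrib algebra_simps)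
    then show ?thesis unfolding left_map_identity using N 3 by simp
  qed
qed

end

section \<open>Isomorphisms\<close>

lemmas scaleC_distribs = complex_vector.scale_left_distrib complex_vector.scale_right_distrib
  complex_vector.scale_left_diff_distrib complex_vector.scale_right_diff_distrib

lemma isomorphicI:
  assumes "\<And>v. v \<in> uspace M \<Longrightarrow> f v \<in> uspace N" "\<And>w. w \<in> uspace N \<Longrightarrow> g w \<in> uspace M"
    and "\<And>v. v \<in> uspace M \<Longrightarrow> g (f v) = v" "\<And>w. w \<in> uspace N \<Longrightarrow> f (g w) = w"
    and "\<And>v w. v \<in> uspace M \<Longrightarrow> w \<in> uspace M \<Longrightarrow> f (v + w) = f v + f w"
    and "\<And>c v. v \<in> uspace M \<Longrightarrow> f (c *\<^sub>C v) = c *\<^sub>C f v"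
    and "\<And>x v. v \<in> uspace M \<Longrightarrow> f (act M x v) = act N x (f v)"
  shows "M \<cong>\<^sub>U N"
  unfolding isomorphic_def
proof (intro exI[of _ f] conjI)
  show "bij_betw f (uspace M) (uspace N)"
    by (rule bij_betw_byWitness[where f' = g]) (use assms in auto)
qed (use assms in auto)

lemma isomorphic_trans [trans]:
  assumes "M \<cong>\<^sub>U N" "N \<cong>\<^sub>U P"
  shows "M \<cong>\<^sub>U P"
proof -
  from assms obtain f g where
    f: "bij_betw f (uspace M) (uspace N)"
      "\<forall>v\<in>uspace M. \<forall>w\<in>uspace M. f (v + w) = f v + f w"
      "\<forall>c. \<forall>v\<in>uspace M. f (c *\<^sub>C v) = c *\<^sub>C f v"
      "\<forall>x. \<forall>v\<in>uspace M. f (act M x v) = act N x (f v)"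
    and g: "bij_betw g (uspace N) (uspace P)"
      "\<forall>v\<in>uspace N. \<forall>w\<in>uspace N. g (v + w) = g v + g w"
      "\<forall>c. \<forall>v\<in>uspace N. g (c *\<^sub>C v) = c *\<^sub>C g v"
      "\<forall>x. \<forall>v\<in>uspace N. g (act N x v) = act P x (g v)"
    unfolding isomorphic_def by blast
  have fN: "f v \<in> uspace N" if "v \<in> uspace M" for v
    using f(1) that by (auto simp: bij_betw_def)
  show ?thesis
    unfolding isomorphic_def
    by (intro exI[of _ "g \<circ> f"] conjI bij_betw_trans[OF f(1) g(1)])
      (use f(2-) g(2-) fN in auto)
qed

text \<open>\<open>isomorphic\<close> speaks of records that need not be modules, and its laws hold
  on the domain only. Closure of the domain under sums, multiples and the action lets them be
  transported to the inverse.\<close>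

lemma isomorphic_sym:
  assumes "M \<cong>\<^sub>U N" "complex_vector.subspace (uspace M)"
    and "\<And>x v. v \<in> uspace M \<Longrightarrow> act M x v \<in> uspace M"
  shows "N \<cong>\<^sub>U M"
proof -
  from assms(1) obtain f where f: "bij_betw f (uspace M) (uspace N)"
      "\<And>v w. v \<in> uspace M \<Longrightarrow> w \<in> uspace M \<Longrightarrow> f (v + w) = f v + f w"
      "\<And>c v. v \<in> uspace M \<Longrightarrow> f (c *\<^sub>C v) = c *\<^sub>C f v"
      "\<And>x v. v \<in> uspace M \<Longrightarrow> f (act M x v) = act N x (f v)"
    unfolding isomorphic_def by blast
  define g where "g = inv_into (uspace M) f"
  have gM: "g w \<in> uspace M" and fg: "f (g w) = w" if "w \<in> uspace N" for w
    using f(1) that by (auto simp: g_def bij_betw_def inv_into_into f_inv_into_f)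
  have gf: "g (f v) = v" if "v \<in> uspace M" for v
    using f(1) that by (auto simp: g_def bij_betw_def inv_into_f_f)
  have fM: "f v \<in> uspace N" if "v \<in> uspace M" for v
    using f(1) that by (auto simp: bij_betw_def)
  have add: "v + w \<in> uspace M" if "v \<in> uspace M" "w \<in> uspace M" for v w
    using assms(2) that by (rule complex_vector.subspace_add)
  have scale: "c *\<^sub>C v \<in> uspace M" if "v \<in> uspace M" for c v
    using assms(2) that by (rule complex_vector.subspace_scale)
  show ?thesis
  proof (rule isomorphicI[of N g M f])
    show "g (v + w) = g v + g w" if "v \<in> uspace N" "w \<in> uspace N" for v w
      using gf[OF add[OF gM gM]] that by (simp add: f gM fg)
    show "g (c *\<^sub>C v) = c *\<^sub>C g v" if "v \<in> uspace N" for c v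
      using gf[OF scale[OF gM]] that by (simp add: f gM fg)
    show "g (act N x v) = act M x (g v)" if "v \<in> uspace N" for x v
      using gf[OF assms(3)[OF gM]] that by (simp add: f gM fg)
  qed (use fM gM gf fg in auto)
qed

section \<open>The Casimir operator\<close>

definition casimir :: "complex \<Rightarrow> 'v::complex_vector umodule \<Rightarrow> 'v \<Rightarrow> 'v" where
  "casimir q M v = act M F1 (act M E1 v)
     + (inverse (q - inverse q))\<^sup>2 *\<^sub>C (q *\<^sub>C act M K v + inverse q *\<^sub>C act M Kinv v)"

locale generic_uq_module = generic_q q + uq_module q V for q and V :: "'v::complex_vector umodule"
begin

lemma V_add [simp]: "v \<in> uspace V \<Longrightarrow> w \<in> uspace V \<Longrightarrow> v + w \<in> uspace V"
  using subspace by (rule complex_vector.subspace_add)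

lemma V_scale [simp]: "v \<in> uspace V \<Longrightarrow> c *\<^sub>C v \<in> uspace V"
  using subspace by (rule complex_vector.subspace_scale)

lemma V_0 [simp]: "0 \<in> uspace V"
  using subspace by (rule complex_vector.subspace_0)

lemma V_diff [simp]: "v \<in> uspace V \<Longrightarrow> w \<in> uspace V \<Longrightarrow> v - w \<in> uspace V"
  using subspace by (rule complex_vector.subspace_diff)

declare act_closed [simp] act_add [simp] act_scaleC [simp]

lemma act_0 [simp]: "act V g 0 = 0"
  using act_scaleC[of 0 g 0] by simp

lemma act_diff [simp]: "v \<in> uspace V \<Longrightarrow> w \<in> uspace V \<Longrightarrow> act V g (v - w) = act V g v - act V g w"
  using act_add[of v "(-1) *\<^sub>C w" g] act_scaleC[of w g "-1"] V_scale[of w "-1"] by simp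

lemma act_sum: "(\<And>i. i \<in> I \<Longrightarrow> u i \<in> uspace V) \<Longrightarrow>
    (\<Sum>i\<in>I. u i) \<in> uspace V \<and> act V g (\<Sum>i\<in>I. u i) = (\<Sum>i\<in>I. act V g (u i))"
  by (induction I rule: infinite_finite_induct) auto

lemma K_E: "v \<in> uspace V \<Longrightarrow> act V K (act V E1 v) = q\<^sup>2 *\<^sub>C act V E1 (act V K v)"
  using K_E1[of "act V K v"] by (simp add: Kinv_K)

lemma K_F: "v \<in> uspace V \<Longrightarrow> act V K (act V F1 v) = inverse (q\<^sup>2) *\<^sub>C act V F1 (act V K v)"
  using K_F1[of "act V K v"] by (simp add: Kinv_K)

lemma Kinv_E: "v \<in> uspace V \<Longrightarrow> act V Kinv (act V E1 v) = inverse (q\<^sup>2) *\<^sub>C act V E1 (act V Kinv v)"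
  using arg_cong[OF K_E1[of v], of "act V Kinv"] by (simp add: Kinv_K scaleC_scaleC scaleC_one)

lemma Kinv_F: "v \<in> uspace V \<Longrightarrow> act V Kinv (act V F1 v) = q\<^sup>2 *\<^sub>C act V F1 (act V Kinv v)"
  using arg_cong[OF K_F1[of v], of "act V Kinv"] by (simp add: Kinv_K scaleC_scaleC scaleC_one)

lemma E_F: "v \<in> uspace V \<Longrightarrow>
    act V E1 (act V F1 v) = act V F1 (act V E1 v) + qden *\<^sub>C (act V K v - act V Kinv v)"
  using E1_F1[of v] by (simp add: qden_def algebra_simps)

lemma q_cancel: "inverse q * (q * q) = q" "q * (inverse q * inverse q) = inverse q"
  by simp_all

lemma casimir_in [simp]: "v \<in> uspace V \<Longrightarrow> casimir q V v \<in> uspace V"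
  by (simp add: casimir_def)

lemma casimir_coefficients:
  "qden + qden\<^sup>2 * inverse q = qden\<^sup>2 * q" "qden\<^sup>2 * q - qden = qden\<^sup>2 * inverse q"
proof -
  have "qden\<^sup>2 * q - qden\<^sup>2 * inverse q = qden * (qden * (q - inverse q))"
    by (simp only: power2_eq_square algebra_simps)
  then have "qden\<^sup>2 * q - qden\<^sup>2 * inverse q = qden" by (simp only: qden_mult mult_1_right)
  then show "qden + qden\<^sup>2 * inverse q = qden\<^sup>2 * q" "qden\<^sup>2 * q - qden = qden\<^sup>2 * inverse q"
    by (simp_all add: algebra_simps)
qed

lemma casimir_identity:
  "qden *\<^sub>C (x - y) + qden\<^sup>2 *\<^sub>C (inverse q *\<^sub>C x + q *\<^sub>C y) = qden\<^sup>2 *\<^sub>C (q *\<^sub>C x + inverse q *\<^sub>C y)"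
proof -
  have "qden *\<^sub>C (x - y) + qden\<^sup>2 *\<^sub>C (inverse q *\<^sub>C x + q *\<^sub>C y)
      = (qden + qden\<^sup>2 * inverse q) *\<^sub>C x + (qden\<^sup>2 * q - qden) *\<^sub>C y"
    by (simp add: scaleC_distribs scaleC_scaleC)
  then show ?thesis
    unfolding casimir_coefficients by (simp add: scaleC_distribs scaleC_scaleC)
qed

text \<open>Moving \<open>E1\<close> past \<open>F1\<close> interchanges \<open>q\<close> and
  \<open>inverse q\<close> in the Cartan part, and so does moving \<open>E1\<close> or
  \<open>F1\<close> past that part. The two effects cancel, which is why the operator commutes with
  \<open>E1\<close> and \<open>F1\<close>. This form also evaluates it on vectors killed by
  \<open>F1\<close>.\<close>

lemma casimir_alt:
  "v \<in> uspace V \<Longrightarrow> casimir q V v = act V E1 (act V F1 v)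
     + qden\<^sup>2 *\<^sub>C (inverse q *\<^sub>C act V K v + q *\<^sub>C act V Kinv v)"
  unfolding casimir_def E_F qden_def[symmetric]
  by (simp add: casimir_identity add.assoc)

lemma casimir_E:
  assumes v: "v \<in> uspace V"
  shows "casimir q V (act V E1 v) = act V E1 (casimir q V v)"
proof -
  have "act V E1 (casimir q V v) = act V E1 (act V F1 (act V E1 v))
      + qden\<^sup>2 *\<^sub>C (inverse q *\<^sub>C act V K (act V E1 v) + q *\<^sub>C act V Kinv (act V E1 v))"
    using v by (simp add: casimir_def qden_def K_E Kinv_E scaleC_scaleC power2_eq_square q_cancel)
  then show ?thesis
    using v by (simp add: casimir_alt)
qed

lemma casimir_F:
  assumes v: "v \<in> uspace V"
  shows "casimir q V (act V F1 v) = act V F1 (casimir q V v)"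
proof -
  have "act V F1 (casimir q V v) = act V F1 (act V E1 (act V F1 v))
      + qden\<^sup>2 *\<^sub>C (q *\<^sub>C act V K (act V F1 v) + inverse q *\<^sub>C act V Kinv (act V F1 v))"
    using v by (simp add: casimir_alt K_F Kinv_F scaleC_scaleC power2_eq_square q_cancel)
  then show ?thesis
    using v by (simp add: casimir_def qden_def)
qed

lemma casimir_K:
  assumes v: "v \<in> uspace V"
  shows "casimir q V (act V K v) = act V K (casimir q V v)"
  using v by (simp add: casimir_def K_E K_F K_Kinv Kinv_K scaleC_scaleC)

lemma casimir_Kinv:
  assumes v: "v \<in> uspace V"
  shows "casimir q V (act V Kinv v) = act V Kinv (casimir q V v)"
  using v by (simp add: casimir_def Kinv_E Kinv_F K_Kinv Kinv_K scaleC_scaleC)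

end

definition casimir_value :: "complex \<Rightarrow> nat \<Rightarrow> complex" where
  "casimir_value q m = (inverse (q - inverse q))\<^sup>2 * (q powi (int m + 1) + q powi (- (int m + 1)))"

context generic_q begin

lemma casimir_ev: "x \<in> supported m \<Longrightarrow> casimir q (ev q m a) x = casimir_value q m *\<^sub>C x"
proof (rule ext)
  fix j assume x: "x \<in> supported m"
  \<comment> \<open>This is \<open>[a] [b] = qden^2 (q^(a+b) + q^(-a-b) - q^(a-b) - q^(b-a))\<close>
    for \<open>a = j\<close> and \<open>b = m - j + 1\<close>: the Cartan part cancels the terms
    that depend on \<open>j\<close>.\<close>
  have id: "qint q (int j) * qint q (int m - int j + 1) + qden\<^sup>2 * (q * q powi (int m - 2 * int j)
      + inverse q * q powi (2 * int j - int m)) = casimir_value q m"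
    unfolding casimir_value_def qden_def[symmetric] by (simp add: qint_expand power_mult field_simps)
  show "casimir q (ev q m a) x j = (casimir_value q m *\<^sub>C x) j"
  proof (cases "j \<le> m")
    case True
    have "casimir q (ev q m a) x j = (qint q (int j) * qint q (int m - int j + 1) + qden\<^sup>2 * (q * q powi (int m - 2 * int j)
      + inverse q * q powi (2 * int j - int m))) * x j"
      using True by (cases j) (auto simp: casimir_def Fop_def Eop_def Kop_def Kinvop_def qden_def algebra_simps)
    then show ?thesis unfolding id by simp
  qed (use x in \<open>auto simp: casimir_def Fop_def Eop_def Kop_def Kinvop_def supported_def\<close>)
qed

text \<open>The numbers \<open>t + 1/t\<close> and \<open>s + 1/s\<close> agree only if
  \<open>t = s\<close> or \<open>t * s = 1\<close>. The second would make the positive power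
  \<open>m + n + 2\<close> of \<open>q\<close> equal to 1.\<close>

lemma casimir_value_inject: "casimir_value q m = casimir_value q n \<longleftrightarrow> m = n"
proof
  assume "casimir_value q m = casimir_value q n"
  then have "q powi (int m + 1) + q powi (- (int m + 1)) = q powi (int n + 1) + q powi (- (int n + 1))"
    unfolding casimir_value_def by simp
  moreover have "(q powi (int m + 1) + q powi (- (int m + 1))) - (q powi (int n + 1) + q powi (- (int n + 1)))
      = (q powi (int m + 1) - q powi (int n + 1)) * (1 - q powi (- (int m + int n + 2)))"
    by (simp add: qint_expand field_simps)
  ultimately have "q powi (int m + 1) = q powi (int n + 1) \<or> q powi (- (int m + int n + 2)) = 1"
    by (metis diff_self divisors_zero right_minus_eq)
  then show "m = n" unfolding powi_inject powi_eq_1_iff by linarith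
qed simp

end

lemma supported_add [simp]: "x \<in> supported m \<Longrightarrow> y \<in> supported m \<Longrightarrow> x + y \<in> supported m"
  by (simp add: supported_def)

lemma supported_scale [simp]: "x \<in> supported m \<Longrightarrow> c *\<^sub>C x \<in> supported m"
  by (simp add: supported_def)

lemma supported_0 [simp]: "0 \<in> supported m"
  by (simp add: supported_def)

lemma supported_diff [simp]: "x \<in> supported m \<Longrightarrow> y \<in> supported m \<Longrightarrow> x - y \<in> supported m"
  by (simp add: supported_def)

lemma ops_in_supported [simp]: "Fop q m x \<in> supported m" "Eop q m x \<in> supported m" "Kop q m x \<in> supported m" "Kinvop q m x \<in> supported m"
  by (auto simp: supported_def Fop_def Eop_def Kop_def Kinvop_def)

lemma ev_act_in_supported [simp]: "ev_act q m a g x \<in> supported m"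
  by (cases g) auto

lemma ev_act_add: "ev_act q m a g (x + y) = ev_act q m a g x + ev_act q m a g y"
  by (cases g) (auto simp: Fop_def Eop_def Kop_def Kinvop_def fun_eq_iff algebra_simps)

lemma ev_act_scale: "ev_act q m a g (c *\<^sub>C x) = c *\<^sub>C ev_act q m a g x"
  by (cases g) (auto simp: Fop_def Eop_def Kop_def Kinvop_def fun_eq_iff algebra_simps)

lemma ops_linear:
  "Fop q m (x + y) = Fop q m x + Fop q m y" "Fop q m (c *\<^sub>C x) = c *\<^sub>C Fop q m x"
  "Eop q m (x + y) = Eop q m x + Eop q m y" "Eop q m (c *\<^sub>C x) = c *\<^sub>C Eop q m x"
  "Kop q m (x + y) = Kop q m x + Kop q m y" "Kop q m (c *\<^sub>C x) = c *\<^sub>C Kop q m x"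
  "Kinvop q m (x + y) = Kinvop q m x + Kinvop q m y" "Kinvop q m (c *\<^sub>C x) = c *\<^sub>C Kinvop q m x"
  using ev_act_add[of q m 0 F1] ev_act_add[of q m 0 E1] ev_act_add[of q m 0 K] ev_act_add[of q m 0 Kinv]
    ev_act_scale[of q m 0 F1] ev_act_scale[of q m 0 E1] ev_act_scale[of q m 0 K] ev_act_scale[of q m 0 Kinv]
  by simp_all

section \<open>Splitting over the horizontal subalgebra\<close>

text \<open>The second component is the submodule; \<open>X\<close> and \<open>Y\<close> are the off-diagonal parts of \<open>E0\<close> and \<open>F0\<close>.\<close>

definition ext_act :: "complex \<Rightarrow> nat \<Rightarrow> int \<Rightarrow> nat \<Rightarrow> int \<Rightarrow>
    ((nat \<Rightarrow> complex) \<Rightarrow> nat \<Rightarrow> complex) \<Rightarrow> ((nat \<Rightarrow> complex) \<Rightarrow> nat \<Rightarrow> complex) \<Rightarrow>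
    generator \<Rightarrow> (nat \<Rightarrow> complex) \<times> (nat \<Rightarrow> complex) \<Rightarrow> (nat \<Rightarrow> complex) \<times> (nat \<Rightarrow> complex)" where
  "ext_act q m1 a1 m2 a2 X Y g p = (ev_act q m1 a1 g (fst p),
     ev_act q m2 a2 g (snd p) + (case g of E0 \<Rightarrow> X (fst p) | F0 \<Rightarrow> Y (fst p) | _ \<Rightarrow> 0))"

definition ext_model :: "complex \<Rightarrow> nat \<Rightarrow> int \<Rightarrow> nat \<Rightarrow> int \<Rightarrow>
    ((nat \<Rightarrow> complex) \<Rightarrow> nat \<Rightarrow> complex) \<Rightarrow> ((nat \<Rightarrow> complex) \<Rightarrow> nat \<Rightarrow> complex) \<Rightarrow>
    ((nat \<Rightarrow> complex) \<times> (nat \<Rightarrow> complex)) umodule" where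
  "ext_model q m1 a1 m2 a2 X Y = \<lparr>uspace = supported m1 \<times> supported m2, act = ext_act q m1 a1 m2 a2 X Y\<rparr>"

lemma ext_model_simps [simp]:
  "uspace (ext_model q m1 a1 m2 a2 X Y) = supported m1 \<times> supported m2"
  "act (ext_model q m1 a1 m2 a2 X Y) = ext_act q m1 a1 m2 a2 X Y"
  by (simp_all add: ext_model_def)

text \<open>Cosets are replaced by an exact sequence with both ends in coordinates. The laws are
  restricted to the carrier sets because \<open>\<iota>\<close> and \<open>\<pi>\<close> come from
  bijections between such sets.\<close>

locale ext_sequence = generic_uq_module q V for q and V :: "'v::complex_vector umodule" +
  fixes \<iota> :: "(nat \<Rightarrow> complex) \<Rightarrow> 'v" and \<pi> :: "'v \<Rightarrow> nat \<Rightarrow> complex"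
    and m1 :: nat and a1 :: int and m2 :: nat and a2 :: int
  assumes \<iota>_in [simp]: "y \<in> supported m2 \<Longrightarrow> \<iota> y \<in> uspace V"
    and \<iota>_add: "y \<in> supported m2 \<Longrightarrow> z \<in> supported m2 \<Longrightarrow> \<iota> (y + z) = \<iota> y + \<iota> z"
    and \<iota>_scale: "y \<in> supported m2 \<Longrightarrow> \<iota> (c *\<^sub>C y) = c *\<^sub>C \<iota> y"
    and \<iota>_act: "y \<in> supported m2 \<Longrightarrow> \<iota> (ev_act q m2 a2 g y) = act V g (\<iota> y)"
    and \<iota>_inj: "y \<in> supported m2 \<Longrightarrow> \<iota> y = 0 \<Longrightarrow> y = 0"
    and \<pi>_in [simp]: "v \<in> uspace V \<Longrightarrow> \<pi> v \<in> supported m1"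
    and \<pi>_add [simp]: "v \<in> uspace V \<Longrightarrow> w \<in> uspace V \<Longrightarrow> \<pi> (v + w) = \<pi> v + \<pi> w"
    and \<pi>_scale [simp]: "v \<in> uspace V \<Longrightarrow> \<pi> (c *\<^sub>C v) = c *\<^sub>C \<pi> v"
    and \<pi>_act: "v \<in> uspace V \<Longrightarrow> \<pi> (act V g v) = ev_act q m1 a1 g (\<pi> v)"
    and \<pi>_surj: "x \<in> supported m1 \<Longrightarrow> \<exists>v\<in>uspace V. \<pi> v = x"
    and exact: "v \<in> uspace V \<Longrightarrow> \<pi> v = 0 \<longleftrightarrow> v \<in> \<iota> ` supported m2"

lemma extension_sequence:
  assumes "generic_uq_module q V" "extension V (ev q m1 a1) (ev q m2 a2)"
  obtains \<iota> \<pi> where "ext_sequence q V \<iota> \<pi> m1 a1 m2 a2"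
proof -
  interpret generic_uq_module q V by fact
  from assms(2) obtain W where W: "submodule W V" and
    iso: "V\<lparr>uspace := W\<rparr> \<cong>\<^sub>U ev q m2 a2" and quot: "quotient_isomorphic V W (ev q m1 a1)"
    unfolding extension_def by blast
  have WV: "W \<subseteq> uspace V" and sW: "complex_vector.subspace W"
    using W by (auto simp: submodule_def)
  have "ev q m2 a2 \<cong>\<^sub>U V\<lparr>uspace := W\<rparr>"
    using iso by (rule isomorphic_sym) (use W in \<open>auto simp: submodule_def\<close>)
  then obtain \<iota> where \<iota>: "bij_betw \<iota> (supported m2) W"
    "\<And>y z. y \<in> supported m2 \<Longrightarrow> z \<in> supported m2 \<Longrightarrow> \<iota> (y + z) = \<iota> y + \<iota> z"
    "\<And>c y. y \<in> supported m2 \<Longrightarrow> \<iota> (c *\<^sub>C y) = c *\<^sub>C \<iota> y"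
    "\<And>g y. y \<in> supported m2 \<Longrightarrow> \<iota> (ev_act q m2 a2 g y) = act V g (\<iota> y)"
    unfolding isomorphic_def by auto
  from quot obtain \<phi> where \<phi>: "bij_betw \<phi> ((\<lambda>v. coset v W) ` uspace V) (supported m1)"
     "\<And>v w. v \<in> uspace V \<Longrightarrow> w \<in> uspace V \<Longrightarrow> \<phi> (coset (v + w) W) = \<phi> (coset v W) + \<phi> (coset w W)"
     "\<And>c v. v \<in> uspace V \<Longrightarrow> \<phi> (coset (c *\<^sub>C v) W) = c *\<^sub>C \<phi> (coset v W)"
     "\<And>g v. v \<in> uspace V \<Longrightarrow> \<phi> (coset (act V g v) W) = ev_act q m1 a1 g (\<phi> (coset v W))"
    unfolding quotient_isomorphic_def by auto
  have \<iota>0: "\<iota> 0 = 0" using \<iota>(3)[of 0 0] by simp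
  have \<phi>0: "\<phi> (coset 0 W) = 0" using \<phi>(3)[of 0 0] by simp
  have coset0: "coset 0 W = W" by (simp add: coset_def)
  have ex: "\<phi> (coset v W) = 0 \<longleftrightarrow> v \<in> W" if v: "v \<in> uspace V" for v
  proof
    assume "\<phi> (coset v W) = 0"
    then have "coset v W = coset 0 W"
      using \<phi>(1) v \<phi>0 by (auto simp: bij_betw_def inj_on_def)
    moreover have "v \<in> coset v W"
      using complex_vector.subspace_0[OF sW] by (auto simp: coset_def image_iff)
    ultimately show "v \<in> W" by (simp add: coset0)
  next
    assume vW: "v \<in> W"
    have "coset v W = W"
    proof
      show "coset v W \<subseteq> W"
        using complex_vector.subspace_add[OF sW vW] by (auto simp: coset_def)
      show "W \<subseteq> coset v W"
      proof
        fix w assume "w \<in> W"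
        then have "w - v \<in> W" by (rule complex_vector.subspace_diff[OF sW _ vW])
        then show "w \<in> coset v W" by (auto simp: coset_def image_iff intro!: bexI[of _ "w - v"])
      qed
    qed
    then show "\<phi> (coset v W) = 0" using \<phi>0 coset0 by simp
  qed
  have "ext_sequence q V \<iota> (\<lambda>v. \<phi> (coset v W)) m1 a1 m2 a2"
  proof
    show "\<iota> y \<in> uspace V" if "y \<in> supported m2" for y
      using \<iota>(1) WV that by (auto simp: bij_betw_def)
    show "y = 0" if "y \<in> supported m2" "\<iota> y = 0" for y
      using \<iota>(1) that \<iota>0 supported_0 unfolding bij_betw_def inj_on_def by metis
    show "\<phi> (coset v W) \<in> supported m1" if "v \<in> uspace V" for v
      using \<phi>(1) that by (auto simp: bij_betw_def)
    show "\<exists>v\<in>uspace V. \<phi> (coset v W) = x" if "x \<in> supported m1" for x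
      using \<phi>(1) that by (force simp: bij_betw_def)
    show "(\<phi> (coset v W) = 0) = (v \<in> \<iota> ` supported m2)" if "v \<in> uspace V" for v
      using ex[OF that] \<iota>(1) by (auto simp: bij_betw_def)
  qed (use \<iota> \<phi> in auto)
  then show ?thesis by (rule that)
qed

context ext_sequence begin

lemma \<iota>_0 [simp]: "\<iota> 0 = 0"
  using \<iota>_scale[of 0 0] by simp

lemma \<pi>_0 [simp]: "\<pi> 0 = 0"
  using \<pi>_scale[of 0 0] by simp

lemma \<iota>_diff: "y \<in> supported m2 \<Longrightarrow> z \<in> supported m2 \<Longrightarrow> \<iota> (y - z) = \<iota> y - \<iota> z"
  using \<iota>_add[of y "(-1) *\<^sub>C z"] \<iota>_scale[of z "-1"] supported_scale[of z m2 "-1"] by simp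

lemma \<pi>_diff [simp]: "v \<in> uspace V \<Longrightarrow> w \<in> uspace V \<Longrightarrow> \<pi> (v - w) = \<pi> v - \<pi> w"
  using \<pi>_add[of v "(-1) *\<^sub>C w"] \<pi>_scale[of w "-1"] V_scale[of w "-1"] by simp

lemma \<pi>_\<iota> [simp]: "y \<in> supported m2 \<Longrightarrow> \<pi> (\<iota> y) = 0"
  using exact[of "\<iota> y"] by auto

lemma kernel: "v \<in> uspace V \<Longrightarrow> \<pi> v = 0 \<Longrightarrow> \<exists>y\<in>supported m2. v = \<iota> y"
  using exact[of v] by auto

lemma \<iota>_eq_iff: "y \<in> supported m2 \<Longrightarrow> z \<in> supported m2 \<Longrightarrow> \<iota> y = \<iota> z \<longleftrightarrow> y = z"
  using \<iota>_inj[of "y - z"] by (auto simp: \<iota>_diff)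

definition splitting :: "((nat \<Rightarrow> complex) \<Rightarrow> 'v) \<Rightarrow> bool" where
  "splitting s \<longleftrightarrow> (\<forall>x\<in>supported m1. s x \<in> uspace V \<and> \<pi> (s x) = x
     \<and> (\<forall>c. s (c *\<^sub>C x) = c *\<^sub>C s x) \<and> (\<forall>y\<in>supported m1. s (x + y) = s x + s y)
     \<and> (\<forall>g\<in>{E1, F1, K, Kinv}. act V g (s x) = s (ev_act q m1 a1 g x)))"

text \<open>The operator \<open>(C - c\<^sub>2) / (c\<^sub>1 - c\<^sub>2)\<close>, with \<open>C\<close> the Casimir operator and \<open>c\<^sub>i\<close> its value on \<open>V\<^sub>i\<close>,
  kills the submodule and induces the identity on the quotient.\<close>

lemma splitting_if_ne:
  assumes "m1 \<noteq> m2"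
  shows "\<exists>s. splitting s"
proof -
  define d where "d = casimir_value q m1 - casimir_value q m2"
  have d: "d \<noteq> 0" using assms by (simp add: d_def casimir_value_inject)
  define P where "P v = inverse d *\<^sub>C (casimir q V v - casimir_value q m2 *\<^sub>C v)" for v
  define s where "s x = P (SOME v. v \<in> uspace V \<and> \<pi> v = x)" for x
  have P_in: "P v \<in> uspace V" if "v \<in> uspace V" for v
    using that by (simp add: P_def)
  have cas_add: "casimir q V (v + w) = casimir q V v + casimir q V w"
    if "v \<in> uspace V" "w \<in> uspace V" for v w
    using that by (simp add: casimir_def scaleC_distribs)
  have cas_scale: "casimir q V (c *\<^sub>C v) = c *\<^sub>C casimir q V v" if "v \<in> uspace V" for c v
    using that by (simp add: casimir_def scaleC_distribs scaleC_scaleC mult_ac)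
  have P_add: "P (v + w) = P v + P w" if "v \<in> uspace V" "w \<in> uspace V" for v w
    using that by (simp add: P_def cas_add scaleC_distribs)
  have P_scale: "P (c *\<^sub>C v) = c *\<^sub>C P v" if "v \<in> uspace V" for c v
    using that by (simp add: P_def cas_scale scaleC_distribs scaleC_scaleC mult_ac)
  have P_\<iota>: "P (\<iota> y) = 0" if y: "y \<in> supported m2" for y
  proof -
    have "casimir q V (\<iota> y) = \<iota> (casimir q (ev q m2 a2) y)"
      unfolding casimir_def using y by (simp add: \<iota>_add \<iota>_scale flip: \<iota>_act)
    then show ?thesis using y by (simp add: P_def casimir_ev \<iota>_scale)
  qed
  have \<pi>_P: "\<pi> (P v) = \<pi> v" if v: "v \<in> uspace V" for v
  proof -
    have "\<pi> (casimir q V v) = casimir q (ev q m1 a1) (\<pi> v)"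
      unfolding casimir_def using v by (simp add: \<pi>_act)
    then have "\<pi> (P v) = (inverse d * d) *\<^sub>C \<pi> v"
      using v by (simp add: P_def casimir_ev d_def scaleC_distribs scaleC_scaleC algebra_simps)
    then show ?thesis using d by (simp add: scaleC_one)
  qed
  have P_act: "act V g (P v) = P (act V g v)" if "v \<in> uspace V" "g \<in> {E1, F1, K, Kinv}" for g v
    using that casimir_E casimir_F casimir_K casimir_Kinv by (auto simp: P_def)
  \<comment> \<open>Two lifts differ by an element of the submodule, which \<open>P\<close> kills.
    So the choice in \<open>s\<close> is harmless, and every law for \<open>s\<close> follows from
    the one for \<open>P\<close>.\<close>
  have s_\<pi>: "s (\<pi> v) = P v" if v: "v \<in> uspace V" for v
  proof -
    define w where "w = (SOME w. w \<in> uspace V \<and> \<pi> w = \<pi> v)"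
    have w: "w \<in> uspace V \<and> \<pi> w = \<pi> v"
      unfolding w_def by (rule someI[of _ v]) (use v in simp)
    then obtain y where y: "y \<in> supported m2" "w - v = \<iota> y"
      using kernel[of "w - v"] v by auto
    have "P w = P (v + \<iota> y)" using y(2) by (simp add: algebra_simps)
    also have "\<dots> = P v" using v y(1) by (simp add: P_add P_\<iota>)
    finally show ?thesis by (simp add: s_def w_def)
  qed
  have "splitting s"
    unfolding splitting_def
  proof (intro ballI)
    fix x assume "x \<in> supported m1"
    then obtain v where v: "v \<in> uspace V" and x: "x = \<pi> v" using \<pi>_surj by blast
    have add: "\<forall>y\<in>supported m1. s (x + y) = s x + s y"
    proof
      fix y assume "y \<in> supported m1"
      then obtain w where w: "w \<in> uspace V" and y: "y = \<pi> w" using \<pi>_surj by blast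
      show "s (x + y) = s x + s y"
        using s_\<pi>[of "v + w"] v w by (simp add: x y s_\<pi> P_add)
    qed
    have scale: "\<forall>c. s (c *\<^sub>C x) = c *\<^sub>C s x"
      using s_\<pi>[of "_ *\<^sub>C v"] v by (simp add: x s_\<pi> P_scale)
    have act: "\<forall>g\<in>{E1, F1, K, Kinv}. act V g (s x) = s (ev_act q m1 a1 g x)"
      using v by (simp add: x s_\<pi> P_act flip: \<pi>_act)
    show "s x \<in> uspace V \<and> \<pi> (s x) = x \<and> (\<forall>c. s (c *\<^sub>C x) = c *\<^sub>C s x) \<and>
      (\<forall>y\<in>supported m1. s (x + y) = s x + s y) \<and> (\<forall>g\<in>{E1, F1, K, Kinv}. act V g (s x) = s (ev_act q m1 a1 g x))"
      using add scale act v by (simp add: x s_\<pi> P_in \<pi>_P)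
  qed
  then show ?thesis by blast
qed

text \<open>The failure of \<open>s\<close> to commute with a generator is killed by
  \<open>\<pi>\<close>, hence lies in the submodule. It is zero for the horizontal generators; for
  \<open>E0\<close> and \<open>F0\<close> it is \<open>X\<close> and \<open>Y\<close>.\<close>

lemma ext_model_of_splitting:
  assumes "splitting s"
  obtains X Y where "V \<cong>\<^sub>U ext_model q m1 a1 m2 a2 X Y"
    and "\<And>x. x \<in> supported m1 \<Longrightarrow> X x \<in> supported m2" "\<And>x. x \<in> supported m1 \<Longrightarrow> Y x \<in> supported m2"
    and "\<And>x y. x \<in> supported m1 \<Longrightarrow> y \<in> supported m1 \<Longrightarrow> X (x + y) = X x + X y"
    and "\<And>x y. x \<in> supported m1 \<Longrightarrow> y \<in> supported m1 \<Longrightarrow> Y (x + y) = Y x + Y y"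
    and "\<And>c x. x \<in> supported m1 \<Longrightarrow> X (c *\<^sub>C x) = c *\<^sub>C X x"
    and "\<And>c x. x \<in> supported m1 \<Longrightarrow> Y (c *\<^sub>C x) = c *\<^sub>C Y x"
proof -
  have s_in: "s x \<in> uspace V" and \<pi>_s: "\<pi> (s x) = x"
    and s_scale: "s (c *\<^sub>C x) = c *\<^sub>C s x" if "x \<in> supported m1" for c x
    using that assms by (auto simp: splitting_def)
  have s_add: "s (x + y) = s x + s y" if "x \<in> supported m1" "y \<in> supported m1" for x y
    using that assms by (auto simp: splitting_def)
  have s_act: "act V g (s x) = s (ev_act q m1 a1 g x)" if "x \<in> supported m1" "g \<in> {E1, F1, K, Kinv}" for g x
    using that assms unfolding splitting_def by blast
  define Z where "Z g x = (SOME y. y \<in> supported m2 \<and> act V g (s x) = s (ev_act q m1 a1 g x) + \<iota> y)" for g x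
  have Z: "Z g x \<in> supported m2 \<and> act V g (s x) = s (ev_act q m1 a1 g x) + \<iota> (Z g x)" if x: "x \<in> supported m1" for g x
  proof -
    define v where "v = act V g (s x) - s (ev_act q m1 a1 g x)"
    have "v \<in> uspace V" "\<pi> v = 0"
      using x by (simp_all add: v_def s_in \<pi>_act \<pi>_s)
    then obtain y where "y \<in> supported m2" "v = \<iota> y" using kernel by blast
    then have "y \<in> supported m2 \<and> act V g (s x) = s (ev_act q m1 a1 g x) + \<iota> y"
      by (simp add: v_def algebra_simps)
    then show ?thesis unfolding Z_def by (rule someI[of _ y])
  qed
  have Z_unique: "Z g x = y"
    if "x \<in> supported m1" "y \<in> supported m2" "act V g (s x) = s (ev_act q m1 a1 g x) + \<iota> y" for g x y
    using Z[OF that(1), of g] that \<iota>_eq_iff[of "Z g x" y] by auto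
  have Z_add: "Z g (x + y) = Z g x + Z g y" if "x \<in> supported m1" "y \<in> supported m1" for g x y
    by (rule Z_unique) (use that Z[of x g] Z[of y g] in \<open>auto simp: s_add s_in ev_act_add \<iota>_add add_ac\<close>)
  have Z_scale: "Z g (c *\<^sub>C x) = c *\<^sub>C Z g x" if "x \<in> supported m1" for g c x
    by (rule Z_unique) (use that Z[of x g] in \<open>auto simp: s_scale s_in ev_act_scale \<iota>_scale scaleC_distribs\<close>)
  have Z_0: "Z g x = 0" if "x \<in> supported m1" "g \<in> {E1, F1, K, Kinv}" for g x
    by (rule Z_unique) (use that in \<open>auto simp: s_act\<close>)
  define f where "f p = s (fst p) + \<iota> (snd p)" for p
  define h where "h v = (\<pi> v, SOME y. y \<in> supported m2 \<and> v = s (\<pi> v) + \<iota> y)" for v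
  have h: "snd (h v) \<in> supported m2 \<and> v = s (\<pi> v) + \<iota> (snd (h v))" if v: "v \<in> uspace V" for v
  proof -
    have "v - s (\<pi> v) \<in> uspace V" "\<pi> (v - s (\<pi> v)) = 0" using v by (simp_all add: s_in \<pi>_s)
    then obtain y where "y \<in> supported m2" "v - s (\<pi> v) = \<iota> y" using kernel by blast
    then have "y \<in> supported m2 \<and> v = s (\<pi> v) + \<iota> y" by (simp add: algebra_simps)
    then show ?thesis unfolding h_def snd_conv by (rule someI[of _ y])
  qed
  let ?M = "ext_model q m1 a1 m2 a2 (Z E0) (Z F0)"
  \<comment> \<open>The laws are immediate for the explicit map \<open>f\<close>, whereas
    \<open>h\<close> is defined by choice. Hence the isomorphism is built out of the model and
    inverted afterwards.\<close>
  have "?M \<cong>\<^sub>U V"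
  proof (rule isomorphicI[of _ f _ h])
    show "f p \<in> uspace V" if "p \<in> uspace ?M" for p
      using that by (auto simp: f_def s_in)
    show "h v \<in> uspace ?M" if "v \<in> uspace V" for v
      using that h[OF that] by (simp add: mem_Times_iff) (simp add: h_def)
    show "f (h v) = v" if "v \<in> uspace V" for v
      using h[OF that] by (simp add: f_def) (simp add: h_def)
    show "h (f p) = p" if p: "p \<in> uspace ?M" for p
    proof -
      have fp: "f p \<in> uspace V" and \<pi>fp: "\<pi> (f p) = fst p"
        using p by (auto simp: f_def s_in \<pi>_s)
      have "snd (h (f p)) = snd p"
        using h[OF fp] p unfolding \<pi>fp by (auto simp: f_def \<iota>_eq_iff)
      moreover have "fst (h (f p)) = fst p" using \<pi>fp by (simp add: h_def)
      ultimately show ?thesis by (rule prod_eqI[rotated])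
    qed
    show "f (p + p') = f p + f p'" if "p \<in> uspace ?M" "p' \<in> uspace ?M" for p p'
      using that by (auto simp: f_def s_add \<iota>_add)
    show "f (c *\<^sub>C p) = c *\<^sub>C f p" if "p \<in> uspace ?M" for c p
      using that by (auto simp: f_def scaleC_prod_def s_scale \<iota>_scale scaleC_distribs)
    show "f (act ?M g p) = act V g (f p)" if "p \<in> uspace ?M" for g p
      using that Z[of "fst p" g] Z_0[of "fst p" g]
      by (cases g) (auto simp: f_def ext_act_def s_in \<iota>_add \<iota>_act add_ac simp del: ev_act_simps)
  qed
  then have "V \<cong>\<^sub>U ?M"
    by (rule isomorphic_sym)
      (auto simp: complex_vector.subspace_def zero_prod_def scaleC_prod_def ext_act_def Z simp del: ev_act_simps split: generator.split)
  then show ?thesis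
    by (rule that) (use Z Z_add Z_scale in auto)
qed

end

section \<open>Highest weight strings and the splitting for equal highest weights\<close>

lemma Fop_unit_vec: "i \<le> m \<Longrightarrow> Fop q m (unit_vec i) = (if i = m then 0 else qint q (int i + 1) *\<^sub>C unit_vec (Suc i))"
proof (rule ext)
  fix j show "i \<le> m \<Longrightarrow> Fop q m (unit_vec i) j = (if i = m then 0 else qint q (int i + 1) *\<^sub>C unit_vec (Suc i)) j"
    by (cases j) (auto simp: Fop_def unit_vec_def add.commute)
qed

lemma Eop_unit_vec_0: "Eop q m (unit_vec 0) = 0"
  by (auto simp: Eop_def unit_vec_def fun_eq_iff)

lemma Kop_unit_vec: "i \<le> m \<Longrightarrow> Kop q m (unit_vec i) = q powi (int m - 2 * int i) *\<^sub>C unit_vec i"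
  by (auto simp: Kop_def unit_vec_def fun_eq_iff)

lemma Kinvop_unit_vec: "i \<le> m \<Longrightarrow> Kinvop q m (unit_vec i) = q powi (2 * int i - int m) *\<^sub>C unit_vec i"
  by (auto simp: Kinvop_def unit_vec_def fun_eq_iff)

definition qfact :: "complex \<Rightarrow> nat \<Rightarrow> complex" where
  "qfact q n = (\<Prod>i<n. qint q (int i + 1))"

lemma qfact_simps [simp]: "qfact q 0 = 1" "qfact q (Suc n) = qint q (int n + 1) * qfact q n"
  by (simp_all add: qfact_def mult.commute)

lemma (in generic_q) qfact_nonzero [simp]: "qfact q n \<noteq> 0"
  by (simp add: qfact_def)

lemma Fop_0 [simp]: "Fop q m 0 = 0"
  by (auto simp: Fop_def)

lemma Fop_funpow_unit_vec:
  "(Fop q m ^^ n) (unit_vec 0) = (if n \<le> m then qfact q n *\<^sub>C unit_vec n else 0)"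
proof (induction n)
  case (Suc n)
  have "(Fop q m ^^ Suc n) (unit_vec 0) = Fop q m (if n \<le> m then qfact q n *\<^sub>C unit_vec n else 0)"
    by (simp only: funpow.simps o_apply Suc.IH)
  also have "\<dots> = (if n \<le> m then qfact q n *\<^sub>C Fop q m (unit_vec n) else 0)"
    by (simp only: ops_linear(2) Fop_0 if_distrib[of "Fop q m"])
  also have "\<dots> = (if Suc n \<le> m then qfact q (Suc n) *\<^sub>C unit_vec (Suc n) else 0)"
    by (cases "n \<le> m"; cases "n = m")
      (auto simp: Fop_unit_vec scaleC_scaleC mult.commute[of "qfact q n"] simp del: scaleC_apply)
  finally show ?case .
qed (simp add: scaleC_one)

lemma (in generic_q) no_weight:
  assumes "y \<in> supported m" "Kop q m y = q powi n *\<^sub>C y" "n > int m \<or> n < - int m"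
  shows "y = 0"
proof (rule ext)
  fix j
  show "y j = 0 j"
  proof (cases "j \<le> m")
    case True
    then have "q powi (int m - 2 * int j) * y j = q powi n * y j"
      using fun_cong[OF assms(2), of j] by (simp add: Kop_def)
    moreover have "q powi (int m - 2 * int j) \<noteq> q powi n"
      unfolding powi_inject using True assms(3) by auto
    ultimately show ?thesis by simp
  qed (use assms(1) in \<open>simp add: supported_def\<close>)
qed

text \<open>The factor \<open>[1] = 1\<close> makes both sides homogeneous in \<open>qden\<close>.\<close>

lemma (in generic_q) qint_identity:
  "qint q (int m - int i + 1) * qint q (int i) + qint q 1 * (qden * (q powi (int m - 2 * int i) - q powi (2 * int i - int m)))
    = qint q (int m - int i) * qint q (int i + 1)"
  by (simp add: qint_expand power_mult field_simps del: qint_1)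

context generic_uq_module begin

abbreviation Fpow :: "nat \<Rightarrow> 'v \<Rightarrow> 'v" where
  "Fpow n \<equiv> act V F1 ^^ n"

lemma Fpow_in [simp]: "v \<in> uspace V \<Longrightarrow> Fpow n v \<in> uspace V"
  by (induction n) auto

lemma Fpow_add: "v \<in> uspace V \<Longrightarrow> w \<in> uspace V \<Longrightarrow> Fpow n (v + w) = Fpow n v + Fpow n w"
  by (induction n) auto

lemma Fpow_scale: "v \<in> uspace V \<Longrightarrow> Fpow n (c *\<^sub>C v) = c *\<^sub>C Fpow n v"
  by (induction n) auto

lemma Fpow_diff: "v \<in> uspace V \<Longrightarrow> w \<in> uspace V \<Longrightarrow> Fpow n (v - w) = Fpow n v - Fpow n w"
  by (induction n) auto

lemma K_Fpow: "v \<in> uspace V \<Longrightarrow> act V K (Fpow n v) = q powi (- 2 * int n) *\<^sub>C Fpow n (act V K v)"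
proof (induction n)
  case (Suc n)
  then show ?case
    by (simp add: K_F scaleC_scaleC power_int_diff power_int_minus power2_eq_square field_simps)
qed (simp add: scaleC_one)

lemma Kinv_Fpow: "v \<in> uspace V \<Longrightarrow> act V Kinv (Fpow n v) = q powi (2 * int n) *\<^sub>C Fpow n (act V Kinv v)"
proof (induction n)
  case (Suc n)
  then show ?case
    by (simp add: Kinv_F scaleC_scaleC power_int_add power2_eq_square field_simps)
qed (simp add: scaleC_one)

lemma casimir_Fpow: "v \<in> uspace V \<Longrightarrow> casimir q V (Fpow n v) = Fpow n (casimir q V v)"
  by (induction n) (auto simp: casimir_F)

text \<open>Divided powers of \<open>F1\<close> reproduce the coefficients of the basis of an
  evaluation module. The last formula follows by induction, moving \<open>E1\<close> past
  \<open>F1\<close> and collecting with \<open>qint_identity\<close>. Nothing here says that the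
  string ends at \<open>m\<close>; its end is established separately.\<close>

lemma highest_weight_string:
  assumes v: "v \<in> uspace V" and Ev: "act V E1 v = 0" and Kv: "act V K v = q powi int m *\<^sub>C v"
  defines "u \<equiv> \<lambda>i. inverse (qfact q i) *\<^sub>C Fpow i v"
  shows "u i \<in> uspace V"
    and "act V F1 (u i) = qint q (int i + 1) *\<^sub>C u (Suc i)"
    and "act V K (u i) = q powi (int m - 2 * int i) *\<^sub>C u i"
    and "act V Kinv (u i) = q powi (2 * int i - int m) *\<^sub>C u i"
    and "act V E1 (u (Suc i)) = qint q (int m - int i) *\<^sub>C u i"
proof -
  have qi: "qint q (int i + 1) \<noteq> 0" for i by simp
  show u_in: "u i \<in> uspace V" for i using v by (simp add: u_def)
  show F: "act V F1 (u i) = qint q (int i + 1) *\<^sub>C u (Suc i)" for i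
    using v by (simp add: u_def scaleC_scaleC)
  show Ku: "act V K (u i) = q powi (int m - 2 * int i) *\<^sub>C u i" for i
    using v by (simp add: u_def K_Fpow Kv Fpow_scale scaleC_scaleC power_int_diff power_int_minus field_simps)
  have h: "q powi int m *\<^sub>C act V Kinv v = v"
    using arg_cong[OF Kv, of "act V Kinv"] v by (simp add: Kinv_K)
  have "act V Kinv v = (q powi (- int m) * q powi int m) *\<^sub>C act V Kinv v"
    by (simp add: power_int_minus scaleC_one)
  then have "act V Kinv v = q powi (- int m) *\<^sub>C v"
    by (metis h scaleC_scaleC)
  then show Kinvu: "act V Kinv (u i) = q powi (2 * int i - int m) *\<^sub>C u i" for i
    using v by (simp add: u_def Kinv_Fpow Fpow_scale scaleC_scaleC power_int_diff power_int_minus field_simps)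
  show "act V E1 (u (Suc i)) = qint q (int m - int i) *\<^sub>C u i"
  proof (induction i)
    case 0
    have "act V E1 (u (Suc 0)) = act V E1 (act V F1 (u 0))"
      by (simp add: F scaleC_one)
    also have "\<dots> = (qden * (q powi int m - q powi (- int m))) *\<^sub>C u 0"
      unfolding E_F[OF u_in] Ku Kinvu
      using Ev v by (simp add: u_def scaleC_distribs scaleC_scaleC scaleC_one algebra_simps)
    finally show ?case by (simp add: qint_qden power_int_minus)
  next
    case (Suc i)
    let ?n = "int (Suc i)"
    have id: "qint q (int m - int i) * qint q (int i + 1) + qint q 1 * (qden * (q powi (int m - 2 * ?n) - q powi (2 * ?n - int m)))
      = qint q (int m - ?n) * qint q (?n + 1)"
      using qint_identity[of m "Suc i"] by (simp add: add.commute del: qint_1)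
    have "qint q (?n + 1) *\<^sub>C act V E1 (u (Suc (Suc i))) = act V E1 (act V F1 (u (Suc i)))"
      using u_in by (simp only: F act_scaleC)
    also have "\<dots> = (qint q (int m - int i) * qint q (int i + 1) + qint q 1 * (qden * (q powi (int m - 2 * ?n) - q powi (2 * ?n - int m)))) *\<^sub>C u (Suc i)"
      unfolding E_F[OF u_in] Ku Kinvu Suc.IH using u_in
      by (simp only: F act_scaleC scaleC_distribs scaleC_scaleC qint_1 mult_1 ring_distribs)
    finally have "qint q (?n + 1) *\<^sub>C act V E1 (u (Suc (Suc i))) = qint q (?n + 1) *\<^sub>C qint q (int m - ?n) *\<^sub>C u (Suc i)"
      unfolding id by (simp only: scaleC_scaleC mult.commute)
    then have "inverse (qint q (?n + 1)) *\<^sub>C qint q (?n + 1) *\<^sub>C act V E1 (u (Suc (Suc i)))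
       = inverse (qint q (?n + 1)) *\<^sub>C qint q (?n + 1) *\<^sub>C qint q (int m - ?n) *\<^sub>C u (Suc i)"
      by (rule arg_cong)
    moreover have "inverse (qint q (?n + 1)) * qint q (?n + 1) = 1" using qi[of "Suc i"] by (rule left_inverse)
    ultimately show ?case
      by (simp only: scaleC_scaleC mult.assoc[symmetric] mult_1) (simp add: scaleC_one)
  qed
qed

end

context ext_sequence begin

lemma \<iota>_Fpow: "y \<in> supported m2 \<Longrightarrow> Fpow n (\<iota> y) = \<iota> ((Fop q m2 ^^ n) y) \<and> (Fop q m2 ^^ n) y \<in> supported m2"
proof (induction n)
  case (Suc n)
  then show ?case using \<iota>_act[of "(Fop q m2 ^^ n) y" F1] by simp
qed simp

lemma \<pi>_Fpow: "v \<in> uspace V \<Longrightarrow> \<pi> (Fpow n v) = (Fop q m1 ^^ n) (\<pi> v)"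
  by (induction n) (auto simp: \<pi>_act)

lemma \<pi>_sum: "(\<And>i. i \<in> I \<Longrightarrow> u i \<in> uspace V) \<Longrightarrow> \<pi> (\<Sum>i\<in>I. u i) = (\<Sum>i\<in>I. \<pi> (u i))"
  by (induction I rule: infinite_finite_induct) (auto simp: act_sum)

text \<open>
  A lift \<open>v\<close> of the highest weight vector can be corrected so that \<open>K v = q\<^sup>m v + c w\<close> with \<open>w\<close> the
  highest weight vector of the submodule. Comparing the Casimir operator at \<open>f\<^sub>1\<^sup>m v\<close>, where
  \<open>f\<^sub>1\<close> vanishes, with its value at \<open>v\<close>, where \<open>e\<^sub>1\<close> vanishes, gives \<open>c = 0\<close>.
\<close>

lemma highest_weight_lift:
  assumes "m1 = m2"
  obtains v where "v \<in> uspace V" "\<pi> v = unit_vec 0" "act V E1 v = 0"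
    "act V K v = q powi int m1 *\<^sub>C v" "Fpow (Suc m1) v = 0"
proof -
  define m where "m = m1"
  have m1: "m1 = m" and m2: "m2 = m" using assms by (simp_all add: m_def)
  define w where "w = \<iota> (unit_vec 0)"
  have w: "w \<in> uspace V" by (simp add: w_def)
  have Kw: "act V K w = q powi int m *\<^sub>C w"
    using \<iota>_act[of "unit_vec 0" K] by (simp add: w_def Kop_unit_vec \<iota>_scale m2)
  have Kinvw: "act V Kinv w = q powi (- int m) *\<^sub>C w"
    using \<iota>_act[of "unit_vec 0" Kinv] by (simp add: w_def Kinvop_unit_vec \<iota>_scale m2)
  have Ew: "act V E1 w = 0"
    using \<iota>_act[of "unit_vec 0" E1] by (simp add: w_def Eop_unit_vec_0)
  have Fw: "Fpow n w = (if n \<le> m then qfact q n *\<^sub>C \<iota> (unit_vec n) else 0)" for n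
    using \<iota>_Fpow[of "unit_vec 0" n] by (auto simp: w_def Fop_funpow_unit_vec m2 \<iota>_scale)
  obtain v0 where v0: "v0 \<in> uspace V" "\<pi> v0 = unit_vec 0"
    using \<pi>_surj[of "unit_vec 0"] by auto
  have "\<pi> (act V K v0 - q powi int m *\<^sub>C v0) = 0"
    using v0 by (simp add: \<pi>_act Kop_unit_vec m1)
  then obtain y where y: "y \<in> supported m" "act V K v0 - q powi int m *\<^sub>C v0 = \<iota> y"
    using kernel[of "act V K v0 - q powi int m *\<^sub>C v0"] v0 by (auto simp: m2)
  \<comment> \<open>\<open>z\<close> solves \<open>(K - q^m) z = y\<close> in every weight space of
    the submodule except the highest, where \<open>K - q^m\<close> is zero. The coefficient
    \<open>c = y 0\<close> is what cannot be removed in this way.\<close>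
  define z where "z j = (if j = 0 \<or> j > m then 0 else y j / (q powi (int m - 2 * int j) - q powi int m))" for j
  have z: "z \<in> supported m" by (simp add: z_def supported_def)
  define c where "c = y 0"
  have yz: "y - (Kop q m z - q powi int m *\<^sub>C z) = c *\<^sub>C unit_vec 0"
  proof (rule ext)
    fix j
    show "(y - (Kop q m z - q powi int m *\<^sub>C z)) j = (c *\<^sub>C unit_vec 0) j"
    proof (cases "j = 0 \<or> j > m")
      case False
      then have "q powi (int m - 2 * int j) - q powi int m \<noteq> 0"
        unfolding right_minus_eq powi_inject by auto
      then have "q powi (int m - 2 * int j) * z j - q powi int m * z j = y j"
        using False by (simp add: z_def left_diff_distrib[symmetric] diff_divide_distrib[symmetric] del: powi_inject)
      then show ?thesis using False by (simp add: Kop_def unit_vec_def)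
    qed (use y(1) in \<open>auto simp: z_def c_def Kop_def unit_vec_def supported_def\<close>)
  qed
  define v where "v = v0 - \<iota> z"
  have v: "v \<in> uspace V" "\<pi> v = unit_vec 0"
    using v0 z by (auto simp: v_def m2)
  have Kv: "act V K v = q powi int m *\<^sub>C v + c *\<^sub>C w"
  proof -
    have "act V K v - q powi int m *\<^sub>C v = \<iota> y - (act V K (\<iota> z) - q powi int m *\<^sub>C \<iota> z)"
      using v0 z unfolding v_def y(2)[symmetric] by (simp add: m2 scaleC_distribs)
    also have "\<dots> = \<iota> (y - (Kop q m z - q powi int m *\<^sub>C z))"
      using \<iota>_act[of z K] y(1) z by (simp add: m2 \<iota>_diff \<iota>_scale)
    finally show ?thesis
      unfolding yz by (simp add: \<iota>_scale w_def m2 algebra_simps)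
  qed
  have Kinvv: "act V Kinv v = q powi (- int m) *\<^sub>C v - (c * q powi (- 2 * int m)) *\<^sub>C w"
  proof -
    have "q powi int m *\<^sub>C act V Kinv v = v - (c * q powi (- int m)) *\<^sub>C w"
      using arg_cong[OF Kv, of "act V Kinv"] v w
      by (simp add: Kinv_K Kinvw scaleC_scaleC) (metis add_diff_cancel_right')
    then have "q powi (- int m) *\<^sub>C q powi int m *\<^sub>C act V Kinv v
        = q powi (- int m) *\<^sub>C (v - (c * q powi (- int m)) *\<^sub>C w)"
      by (rule arg_cong)
    then have "(q powi (- int m) * q powi int m) *\<^sub>C act V Kinv v
        = q powi (- int m) *\<^sub>C v - (c * (q powi (- int m) * q powi (- int m))) *\<^sub>C w"
      by (simp only: scaleC_distribs scaleC_scaleC mult.left_commute)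
    moreover have "q powi (- int m) * q powi int m = 1"
      by (simp add: power_int_minus)
    moreover have "q powi (- int m) * q powi (- int m) = q powi (- 2 * int m)"
      by (simp flip: power_int_add)
    ultimately show ?thesis by (simp add: scaleC_one)
  qed
  \<comment> \<open>The vector lies in the submodule. Since \<open>E1\<close> kills
    \<open>w\<close>, it is an eigenvector of \<open>K\<close> with exponent \<open>m + 2\<close>,
    although \<open>v\<close> itself is not yet known to be an eigenvector; no such weight
    occurs.\<close>
  have Ev: "act V E1 v = 0"
  proof -
    have "\<pi> (act V E1 v) = 0" using v by (simp add: \<pi>_act Eop_unit_vec_0)
    then obtain x where x: "x \<in> supported m" "act V E1 v = \<iota> x"
      using kernel[of "act V E1 v"] v by (auto simp: m2)
    have "act V K (act V E1 v) = q powi (int m + 2) *\<^sub>C act V E1 v"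
      using v w by (simp add: K_E Kv Ew scaleC_scaleC power_int_add power2_eq_square mult_ac)
    then have "\<iota> (Kop q m x) = \<iota> (q powi (int m + 2) *\<^sub>C x)"
      using \<iota>_act[of x K] x by (simp add: m2 \<iota>_scale)
    then have "Kop q m x = q powi (int m + 2) *\<^sub>C x"
      using x by (simp add: \<iota>_eq_iff m2)
    then have "x = 0" using no_weight[OF x(1), of "int m + 2"] by simp
    then show ?thesis using x by simp
  qed
  \<comment> \<open>The same argument at the other end: \<open>Fpow (Suc m)\<close> kills
    \<open>w\<close>, and the exponent \<open>- m - 2\<close> lies below all weights.\<close>
  have Fv: "Fpow (Suc m) v = 0"
  proof -
    have "\<pi> (Fpow (Suc m) v) = 0"
      using \<pi>_Fpow[OF v(1), of "Suc m"] unfolding v(2) Fop_funpow_unit_vec m1 by simp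
    then obtain x where x: "x \<in> supported m" "Fpow (Suc m) v = \<iota> x"
      using kernel[of "Fpow (Suc m) v"] v(1) by (auto simp: m2 simp del: funpow.simps)
    have "act V K (Fpow (Suc m) v) = q powi (- 2 * int (Suc m)) *\<^sub>C q powi int m *\<^sub>C Fpow (Suc m) v"
      unfolding K_Fpow[OF v(1)] Kv using v(1) w Fw[of "Suc m"]
      by (simp add: Fpow_add Fpow_scale del: funpow.simps)
    also have "\<dots> = q powi (- int m - 2) *\<^sub>C Fpow (Suc m) v"
      unfolding scaleC_scaleC by (subst power_int_add[symmetric]) auto
    finally have "\<iota> (Kop q m x) = \<iota> (q powi (- int m - 2) *\<^sub>C x)"
      using \<iota>_act[of x K] x by (simp add: m2 \<iota>_scale del: funpow.simps)
    then have "Kop q m x = q powi (- int m - 2) *\<^sub>C x"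
      using x by (simp add: \<iota>_eq_iff m2)
    then have "x = 0" using no_weight[OF x(1), of "- int m - 2"] by simp
    then show ?thesis using x by simp
  qed
  have "c = 0"
  proof -
    define A where "A = Fpow m (act V K v)"
    define B where "B = Fpow m (act V Kinv v)"
    define u where "u = Fpow m v"
    define t where "t = Fpow m w"
    have A: "A = q powi int m *\<^sub>C u + c *\<^sub>C t"
      using v(1) w by (simp add: A_def Kv Fpow_add Fpow_scale u_def t_def)
    have B: "B = q powi (- int m) *\<^sub>C u - (c * q powi (- 2 * int m)) *\<^sub>C t"
      using v(1) w by (simp add: B_def Kinvv Fpow_diff Fpow_scale u_def t_def)
    have "casimir q V u = Fpow m (casimir q V v)"
      unfolding u_def by (rule casimir_Fpow[OF v(1)])
    also have "\<dots> = qden\<^sup>2 *\<^sub>C (q *\<^sub>C A + inverse q *\<^sub>C B)"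
      using v(1) by (simp add: casimir_def Ev qden_def A_def B_def Fpow_add Fpow_scale)
    finally have "casimir q V u = qden\<^sup>2 *\<^sub>C (q *\<^sub>C A + inverse q *\<^sub>C B)" .
    moreover have "casimir q V u = qden\<^sup>2 *\<^sub>C (inverse q *\<^sub>C q powi (- 2 * int m) *\<^sub>C A + q *\<^sub>C q powi (2 * int m) *\<^sub>C B)"
      using v(1) Fv by (simp add: casimir_alt u_def A_def B_def K_Fpow Kinv_Fpow)
    ultimately have "q *\<^sub>C A + inverse q *\<^sub>C B = inverse q *\<^sub>C q powi (- 2 * int m) *\<^sub>C A + q *\<^sub>C q powi (2 * int m) *\<^sub>C B"
      by (simp add: complex_vector.scale_cancel_left)
    \<comment> \<open>The coefficients of \<open>u\<close> agree on both sides. As \<open>c\<close>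
      enters \<open>K\<close> and \<open>Kinv\<close> with opposite signs, those of \<open>t\<close>
      are opposite to each other, and \<open>2 c (q - q^(-2m-1)) t = 0\<close> remains.\<close>
    then have "(q * q powi int m + inverse q * q powi (- int m)) *\<^sub>C u + (c * (q - inverse q * q powi (- 2 * int m))) *\<^sub>C t
       = (inverse q * (q powi (- 2 * int m) * q powi int m) + q * (q powi (2 * int m) * q powi (- int m))) *\<^sub>C u
        + (c * (inverse q * q powi (- 2 * int m) - q * (q powi (2 * int m) * q powi (- 2 * int m)))) *\<^sub>C t"
      unfolding A B by (simp add: scaleC_distribs scaleC_scaleC algebra_simps)
    moreover have "q powi (- 2 * int m) * q powi int m = q powi (- int m)"
      by (subst power_int_add[symmetric]) auto
    moreover have "q powi (2 * int m) * q powi (- int m) = q powi int m"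
      by (subst power_int_add[symmetric]) auto
    moreover have "q powi (2 * int m) * q powi (- 2 * int m) = 1"
      by (subst power_int_add[symmetric]) auto
    ultimately have "(c * (q - inverse q * q powi (- 2 * int m))) *\<^sub>C t - (c * (inverse q * q powi (- 2 * int m) - q)) *\<^sub>C t = 0"
      by (simp add: add.commute)
    then have "(2 * c * (q - inverse q * q powi (- 2 * int m))) *\<^sub>C t = 0"
      by (simp add: scaleC_distribs algebra_simps flip: complex_vector.scale_left_diff_distrib)
    moreover have "t \<noteq> 0"
    proof
      assume "t = 0"
      then have "\<iota> (unit_vec m) = 0" using Fw[of m] by (simp add: t_def)
      then have "unit_vec m = 0" using \<iota>_inj[of "unit_vec m"] by (simp add: m2)
      then have "unit_vec m m = 0" by simp
      then show False by (simp add: unit_vec_def)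
    qed
    moreover have "q - inverse q * q powi (- 2 * int m) \<noteq> 0"
    proof
      assume "q - inverse q * q powi (- 2 * int m) = 0"
      then have "q powi 1 = q powi (-1 + - 2 * int m)"
        by (simp add: power_int_minus power_int_add power_int_diff divide_inverse)
      then show False unfolding powi_inject by simp
    qed
    ultimately show "c = 0" by simp
  qed
  show ?thesis
    by (rule that[of v]) (use v Ev Kv Fv \<open>c = 0\<close> in \<open>simp_all add: m1\<close>)
qed

text \<open>The divided powers of \<open>F1\<close> on the corrected highest weight lift span a copy
  of the quotient, and \<open>\<pi>\<close> sends them to the unit vectors.\<close>

lemma splitting_if_eq:
  assumes "m1 = m2"
  shows "\<exists>s. splitting s"
proof -
  obtain v where v: "v \<in> uspace V" "\<pi> v = unit_vec 0" "act V E1 v = 0"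
    "act V K v = q powi int m1 *\<^sub>C v" "Fpow (Suc m1) v = 0"
    using highest_weight_lift[OF assms] .
  define u where "u i = inverse (qfact q i) *\<^sub>C Fpow i v" for i
  note u = highest_weight_string[OF v(1,3,4), folded u_def]
  \<comment> \<open>Closes the string at its lower end: the index shift in \<open>F\<close> produces
    a term with \<open>u (Suc m1)\<close>, just as the one in \<open>E\<close> needs
    \<open>Eu0\<close> at the upper end.\<close>
  have u_last: "u (Suc m1) = 0" using v(5) by (simp add: u_def)
  have Eu0: "act V E1 (u 0) = 0" using v by (simp add: u_def)
  have \<pi>_u: "\<pi> (u i) = unit_vec i" if "i \<le> m1" for i
    using that v by (simp add: u_def \<pi>_Fpow Fop_funpow_unit_vec scaleC_scaleC scaleC_one)
  define s where "s x = (\<Sum>i\<le>m1. x i *\<^sub>C u i)" for x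
  have s_in: "s x \<in> uspace V" for x
    using act_sum[of "{..m1}" "\<lambda>i. x i *\<^sub>C u i"] u(1) by (simp add: s_def)
  have act_s: "act V g (s x) = (\<Sum>i\<le>m1. x i *\<^sub>C act V g (u i))" for g x
    using act_sum[of "{..m1}" "\<lambda>i. x i *\<^sub>C u i"] u(1) by (simp add: s_def)
  have F: "act V F1 (s x) = s (Fop q m1 x)" for x
  proof -
    let ?g = "\<lambda>i. (qint q (int i) * x (i - 1)) *\<^sub>C u i"
    have "act V F1 (s x) = (\<Sum>i\<le>m1. ?g (Suc i))"
      by (simp add: act_s u(2) scaleC_scaleC mult.commute add.commute)
    also have "\<dots> = (\<Sum>i\<le>Suc m1. ?g i)"
      by (subst sum.atMost_Suc_shift) simp
    also have "\<dots> = s (Fop q m1 x)"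
      by (simp add: s_def Fop_def u_last)
    finally show ?thesis .
  qed
  have E: "act V E1 (s x) = s (Eop q m1 x)" if "x \<in> supported m1" for x
  proof -
    let ?g = "\<lambda>i. x i *\<^sub>C act V E1 (u i)"
    have "act V E1 (s x) = (\<Sum>i\<le>Suc m1. ?g i)"
      using that by (simp add: act_s supported_def)
    also have "\<dots> = (\<Sum>i\<le>m1. ?g (Suc i))"
      by (subst sum.atMost_Suc_shift) (simp add: Eu0)
    also have "\<dots> = s (Eop q m1 x)"
      by (simp add: s_def Eop_def u(5) scaleC_scaleC mult.commute)
    finally show ?thesis .
  qed
  have "splitting s"
    unfolding splitting_def
  proof (intro ballI conjI allI)
    fix x assume x: "x \<in> supported m1"
    show "s x \<in> uspace V" by (rule s_in)
    have "\<pi> (s x) = (\<Sum>i\<le>m1. x i *\<^sub>C unit_vec i)"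
      using u(1) by (simp add: s_def \<pi>_sum \<pi>_u)
    then show "\<pi> (s x) = x" using supported_expand[OF x] by simp
    show "s (c *\<^sub>C x) = c *\<^sub>C s x" for c
      by (simp add: s_def complex_vector.scale_sum_right scaleC_scaleC)
    show "s (x + y) = s x + s y" for y
      by (simp add: s_def scaleC_add_left sum.distrib)
    show "act V g (s x) = s (ev_act q m1 a1 g x)" if "g \<in> {E1, F1, K, Kinv}" for g
      using that F E[OF x]
      by (auto simp: act_s u(3,4) scaleC_scaleC mult.commute) (auto simp: s_def Kop_def Kinvop_def mult.commute)
  qed
  then show ?thesis by blast
qed

lemma ex_splitting: "\<exists>s. splitting s"
  using splitting_if_ne splitting_if_eq by (cases "m1 = m2") auto

end

section \<open>The off-diagonal maps\<close>

text \<open>\<open>N\<close> is only known as a record, so its relations are inherited from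
  \<open>V\<close>. Conjugation by \<open>K\<close> becomes a commutation rule, and a difference
  becomes a sum with scalar -1, because the isomorphism is given as compatible with sums, multiples
  and the action.\<close>

lemma (in generic_uq_module) isomorphic_relations:
  assumes "V \<cong>\<^sub>U N" "p \<in> uspace N"
  shows "act N K (act N E0 p) = inverse (q\<^sup>2) *\<^sub>C act N E0 (act N K p)"
    and "act N K (act N F0 p) = q\<^sup>2 *\<^sub>C act N F0 (act N K p)"
    and "act N E0 (act N F1 p) = act N F1 (act N E0 p)"
    and "act N E1 (act N F0 p) = act N F0 (act N E1 p)"
    and "act N F0 (act N E0 p) = act N E0 (act N F0 p) + qden *\<^sub>C (act N K p + (- 1) *\<^sub>C act N Kinv p)"
proof -
  from assms(1) obtain f where bij: "bij_betw f (uspace V) (uspace N)"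
    and f [simp]: "\<And>v w. v \<in> uspace V \<Longrightarrow> w \<in> uspace V \<Longrightarrow> f (v + w) = f v + f w"
      "\<And>c v. v \<in> uspace V \<Longrightarrow> f (c *\<^sub>C v) = c *\<^sub>C f v"
      "\<And>g v. v \<in> uspace V \<Longrightarrow> f (act V g v) = act N g (f v)"
    unfolding isomorphic_def by blast
  from bij assms(2) obtain v where v: "v \<in> uspace V" and p: "p = f v"
    by (auto simp: bij_betw_def)
  have "act V K (act V E0 v) = inverse (q\<^sup>2) *\<^sub>C act V E0 (act V K v)"
    using K_E0[of "act V K v"] v by (simp add: Kinv_K)
  from arg_cong[OF this, of f] show "act N K (act N E0 p) = inverse (q\<^sup>2) *\<^sub>C act N E0 (act N K p)"
    using v by (simp add: p)
  have "act V K (act V F0 v) = q\<^sup>2 *\<^sub>C act V F0 (act V K v)"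
    using K_F0[of "act V K v"] v by (simp add: Kinv_K)
  from arg_cong[OF this, of f] show "act N K (act N F0 p) = q\<^sup>2 *\<^sub>C act N F0 (act N K p)"
    using v by (simp add: p)
  have "act V E0 (act V F1 v) = act V F1 (act V E0 v)"
    using E0_F1[of v] v by simp
  from arg_cong[OF this, of f] show "act N E0 (act N F1 p) = act N F1 (act N E0 p)"
    using v by (simp add: p)
  have "act V E1 (act V F0 v) = act V F0 (act V E1 v)"
    using E1_F0[of v] v by simp
  from arg_cong[OF this, of f] show "act N E1 (act N F0 p) = act N F0 (act N E1 p)"
    using v by (simp add: p)
  have "act V F0 (act V E0 v) = act V E0 (act V F0 v) + qden *\<^sub>C (act V K v + (- 1) *\<^sub>C act V Kinv v)"
    using E0_F0[of v] v by (simp add: qden_def algebra_simps)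
  from arg_cong[OF this, of f] show "act N F0 (act N E0 p) = act N E0 (act N F0 p) + qden *\<^sub>C (act N K p + (- 1) *\<^sub>C act N Kinv p)"
    using v V_scale[of "act V Kinv v" "-1"] by (simp add: p del: complex_vector.scale_minus_left)
qed

lemma ev_act_0 [simp]: "ev_act q m a g 0 = 0"
  using ev_act_scale[of q m a g 0 0] by simp

text \<open>Applying each relation to \<open>(x, 0)\<close> and taking the second component isolates
  the off-diagonal block. \<open>K\<close> and \<open>Kinv\<close> are block diagonal, so they
  contribute nothing to the last relation.\<close>

lemma (in generic_uq_module) ext_model_relations:
  assumes "V \<cong>\<^sub>U ext_model q m1 a1 m2 a2 X Y" and x: "x \<in> supported m1" and "X 0 = 0" "Y 0 = 0"
  shows "Kop q m2 (X x) = inverse (q\<^sup>2) *\<^sub>C X (Kop q m1 x)"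
    and "Kop q m2 (Y x) = q\<^sup>2 *\<^sub>C Y (Kop q m1 x)"
    and "X (Fop q m1 x) = Fop q m2 (X x)"
    and "Y (Eop q m1 x) = Eop q m2 (Y x)"
    and "q powi (- a2) *\<^sub>C Eop q m2 (X x) + Y (q powi a1 *\<^sub>C Fop q m1 x)
       = q powi a2 *\<^sub>C Fop q m2 (Y x) + X (q powi (- a1) *\<^sub>C Eop q m1 x)"
proof -
  have zero: "Fop q m2 0 = 0" "Eop q m2 0 = 0" "Kop q m2 0 = 0" "Kinvop q m2 0 = 0"
    using ev_act_0[of q m2 0 F1] ev_act_0[of q m2 0 E1] ev_act_0[of q m2 0 K] ev_act_0[of q m2 0 Kinv] by simp_all
  have p: "(x, 0) \<in> uspace (ext_model q m1 a1 m2 a2 X Y)" using x by simp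
  note rel = isomorphic_relations[OF assms(1) p, THEN arg_cong[of _ _ snd]]
  show "Kop q m2 (X x) = inverse (q\<^sup>2) *\<^sub>C X (Kop q m1 x)"
    using rel(1) by (simp add: ext_act_def scaleC_prod_def zero)
  show "Kop q m2 (Y x) = q\<^sup>2 *\<^sub>C Y (Kop q m1 x)"
    using rel(2) by (simp add: ext_act_def scaleC_prod_def zero)
  show "X (Fop q m1 x) = Fop q m2 (X x)"
    using rel(3) by (simp add: ext_act_def scaleC_prod_def zero)
  show "Y (Eop q m1 x) = Eop q m2 (Y x)"
    using rel(4) by (simp add: ext_act_def scaleC_prod_def zero)
  show "q powi (- a2) *\<^sub>C Eop q m2 (X x) + Y (q powi a1 *\<^sub>C Fop q m1 x)
       = q powi a2 *\<^sub>C Fop q m2 (Y x) + X (q powi (- a1) *\<^sub>C Eop q m1 x)"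
    using rel(5) by (simp add: ext_act_def scaleC_prod_def zero)
qed

text \<open>Counted from the lowest weight vector, \<open>Eop\<close> has the coefficients that
  \<open>Fop\<close> has counted from the highest. This symmetry reduces raising maps to lowering
  maps.\<close>

lemma Eop_unit_vec: "i < m \<Longrightarrow> Eop q m (unit_vec (m - i)) = qint q (int i + 1) *\<^sub>C unit_vec (m - Suc i)"
  by (rule ext) (auto simp: Eop_def unit_vec_def of_nat_diff algebra_simps)

context generic_q begin

text \<open>
  \<open>x i j\<close> is the coefficient at \<open>w\<^sub>j\<close> of the image of \<open>v\<^sub>i\<close> under a map of weight \<open>-2\<close> commuting with
  \<open>f\<^sub>1\<close>. Reading both bases backwards, maps of weight \<open>2\<close> commuting with \<open>e\<^sub>1\<close> satisfy the same
  conditions.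
\<close>

lemma shift_matrix_zero:
  fixes x :: "nat \<Rightarrow> nat \<Rightarrow> complex"
  assumes supp: "\<And>i j. i \<le> m1 \<Longrightarrow> j \<le> m2 \<Longrightarrow> x i j \<noteq> 0 \<Longrightarrow> int m2 - 2 * int j = int m1 - 2 * int i - 2"
    and rec: "\<And>i j. i < m1 \<Longrightarrow> j \<le> m2 \<Longrightarrow>
      qint q (int i + 1) * x (Suc i) j = (if j = 0 then 0 else qint q (int j) * x i (j - 1))"
    and top: "\<And>j. j < m2 \<Longrightarrow> x m1 j = 0"
    and "m1 \<noteq> m2 + 2" "m1 \<noteq> m2" "m2 \<noteq> m1 + 2"
    and "i \<le> m1" "j \<le> m2"
  shows "x i j = 0"
proof (rule ccontr)
  assume nz: "x i j \<noteq> 0"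
  \<comment> \<open>Followed back along its diagonal, a nonzero entry leads to one in row 0: the
    recursion gives 0 in column 0, so the column index cannot run out first.\<close>
  have down: "i \<le> j \<and> x 0 (j - i) \<noteq> 0" if "i \<le> m1" "j \<le> m2" "x i j \<noteq> 0" for i j
    using that
  proof (induction i arbitrary: j)
    case (Suc i)
    have "qint q (int i + 1) * x (Suc i) j = (if j = 0 then 0 else qint q (int j) * x i (j - 1))"
      by (rule rec) (use Suc.prems in simp_all)
    moreover have "qint q (int i + 1) * x (Suc i) j \<noteq> 0" using Suc.prems by simp
    ultimately have "j \<noteq> 0" "x i (j - 1) \<noteq> 0" by (auto split: if_splits)
    moreover from this have "i \<le> j - 1 \<and> x 0 (j - 1 - i) \<noteq> 0"
      using Suc.IH[of "j - 1"] Suc.prems by simp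
    ultimately show ?case by (auto simp: Suc_le_eq)
  qed simp
  \<comment> \<open>In the other direction a nonzero entry stays nonzero until column
    \<open>m2\<close>, and by \<open>top\<close> the last row cannot be reached earlier.\<close>
  have up: "m2 - j \<le> m1 - i" if "i \<le> m1" "j \<le> m2" "x i j \<noteq> 0" for i j
    using that
  proof (induction "m2 - j" arbitrary: i j)
    case (Suc n)
    then have j: "j < m2" by simp
    then have "i < m1" using top[of j] Suc.prems by (cases "i = m1") auto
    moreover from this have "x (Suc i) (Suc j) \<noteq> 0"
      using rec[of i "Suc j"] Suc.prems j by auto
    moreover have "n = m2 - Suc j" using Suc.hyps(2) by simp
    ultimately have "i < m1" "m2 - Suc j \<le> m1 - Suc i"
      using Suc.hyps(1)[of "Suc j" "Suc i"] j by simp_all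
    then show ?case using j by linarith
  qed simp
  \<comment> \<open>With \<open>k = j - i\<close>, the weights give
    \<open>m1 = m2 + 2 - 2 k\<close>, and then the bound \<open>m2 - k \<le> m1\<close> becomes
    \<open>k \<le> 2\<close>.\<close>
  from down[of i j] have ij: "i \<le> j" "x 0 (j - i) \<noteq> 0" using nz assms by auto
  have "int m2 - 2 * int (j - i) = int m1 - 2"
    using supp[of 0 "j - i"] ij assms by simp
  moreover have "m2 - (j - i) \<le> m1"
    using up[of 0 "j - i"] ij assms by simp
  moreover have "j - i \<le> m2" using assms by simp
  ultimately have "j - i \<le> 2" "int m1 = int m2 + 2 - 2 * int (j - i)" by linarith+
  then have "int m1 = int m2 + 2 \<or> int m1 = int m2 \<or> int m1 = int m2 - 2"
    by (auto simp: le_Suc_eq numeral_2_eq_2)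
  then show False using assms by linarith
qed

text \<open>The entries allowed by the weights lie on one diagonal, and the recursion carries the
  first of them along it. The factors \<open>1\<close>, \<open>[j]\<close> and
  \<open>[j] [j - 1]\<close> are the matrix entries of \<open>down_e\<close>, \<open>Fop\<close> and
  \<open>up_e\<close>.\<close>

lemma shift_matrix:
  fixes x :: "nat \<Rightarrow> nat \<Rightarrow> complex"
  assumes supp: "\<And>i j. i \<le> m1 \<Longrightarrow> j \<le> m2 \<Longrightarrow> x i j \<noteq> 0 \<Longrightarrow> int m2 - 2 * int j = int m1 - 2 * int i - 2"
    and rec: "\<And>i j. i < m1 \<Longrightarrow> j \<le> m2 \<Longrightarrow>
      qint q (int i + 1) * x (Suc i) j = (if j = 0 then 0 else qint q (int j) * x i (j - 1))"
  shows "m1 = m2 + 2 \<Longrightarrow> \<exists>c. \<forall>i\<le>m1. \<forall>j\<le>m2. x i j = (if j = i then c else 0)"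
    and "m1 = m2 \<Longrightarrow> \<exists>c. \<forall>i\<le>m1. \<forall>j\<le>m2. x i j = (if j = Suc i then c * qint q (int j) else 0)"
    and "m2 = m1 + 2 \<Longrightarrow> \<exists>c. \<forall>i\<le>m1. \<forall>j\<le>m2. x i j = (if j = i + 2 then c * (qint q (int j) * qint q (int j - 1)) else 0)"
proof -
  have nz: "qint q (int i + 1) \<noteq> 0" for i by simp
  show "\<exists>c. \<forall>i\<le>m1. \<forall>j\<le>m2. x i j = (if j = i then c else 0)" if m: "m1 = m2 + 2"
  proof (intro exI allI impI)
    have diag: "i \<le> m2 \<Longrightarrow> x i i = x 0 0" for i
    proof (induction i)
      case (Suc i)
      then show ?case using rec[of i "Suc i"] m nz[of i] by (auto simp: add.commute)
    qed simp
    show "x i j = (if j = i then x 0 0 else 0)" if "i \<le> m1" "j \<le> m2" for i j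
      using supp[of i j] diag[of i] that m by (cases "x i j = 0") auto
  qed
  show "\<exists>c. \<forall>i\<le>m1. \<forall>j\<le>m2. x i j = (if j = Suc i then c * qint q (int j) else 0)" if m: "m1 = m2"
  proof (intro exI allI impI)
    have diag: "Suc i \<le> m2 \<Longrightarrow> x i (Suc i) = x 0 1 * qint q (int (Suc i))" for i
    proof (induction i)
      case (Suc i)
      have "qint q (int i + 1) * x (Suc i) (Suc (Suc i)) = qint q (int i + 1) * (x 0 1 * qint q (int (Suc (Suc i))))"
        using rec[of i "Suc (Suc i)"] Suc m by (simp add: mult_ac add_ac)
      then show ?case using nz[of i] mult_left_cancel by blast
    qed simp
    show "x i j = (if j = Suc i then x 0 1 * qint q (int j) else 0)" if "i \<le> m1" "j \<le> m2" for i j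
    proof (cases "j = Suc i")
      case False
      then have "int m2 - 2 * int j \<noteq> int m1 - 2 * int i - 2" using m by linarith
      then show ?thesis using supp[OF that] False by auto
    qed (use diag[of i] that in auto)
  qed
  show "\<exists>c. \<forall>i\<le>m1. \<forall>j\<le>m2. x i j = (if j = i + 2 then c * (qint q (int j) * qint q (int j - 1)) else 0)" if m: "m2 = m1 + 2"
  proof (intro exI allI impI)
    \<comment> \<open>At \<open>j = 2\<close> the normal form is
      \<open>c * (qint q 2 * qint q 1)\<close>.\<close>
    define c where "c = x 0 2 / qint q 2"
    have diag: "i \<le> m1 \<Longrightarrow> x i (i + 2) = c * (qint q (int i + 2) * qint q (int i + 1))" for i
    proof (induction i)
      case 0
      then show ?case by (simp add: c_def numeral_2_eq_2)
    next
      case (Suc i)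
      have "qint q (int i + 1) * x (Suc i) (Suc i + 2) = qint q (int i + 1) * (c * (qint q (int (Suc i) + 2) * qint q (int (Suc i) + 1)))"
        using rec[of i "Suc i + 2"] Suc m by (simp add: mult_ac add_ac)
      then show ?case using nz[of i] mult_left_cancel by blast
    qed
    show "x i j = (if j = i + 2 then c * (qint q (int j) * qint q (int j - 1)) else 0)" if "i \<le> m1" "j \<le> m2" for i j
    proof (cases "j = i + 2")
      case False
      then have "int m2 - 2 * int j \<noteq> int m1 - 2 * int i - 2" using m by linarith
      then show ?thesis using supp[OF that] False by auto
    qed (use diag[of i] that in \<open>simp add: add.commute\<close>)
  qed
qed

text \<open>
  The relation for \<open>[E0, F0]\<close> in coordinates: \<open>M\<close> is the larger of the two highest weights. For
  \<open>M = 2\<close> the smaller module is trivial, its evaluation parameter is arbitrary and \<open>rel\<close> does not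
  determine it.
\<close>

lemma coefficient_relation:
  fixes c d :: complex and u v :: int
  assumes M: "M \<ge> 2" and nz: "c \<noteq> 0 \<or> d \<noteq> 0" and M2: "M = 2 \<Longrightarrow> v = u - 2"
    and rel: "\<And>j. j \<le> M - 2 \<Longrightarrow> q powi (- u) * qint q (int M - int j) * c + q powi v * qint q (int j) * d
      = q powi (- v) * qint q (int M - 2 - int j) * c + q powi u * qint q (int j + 2) * d"
  shows "v = u - 2 \<and> d = c * q powi (- int M - u - v) \<or> v = u + 2 \<and> d = c * q powi (int M - u - v)"
proof (cases "M = 2")
  case True
  then have "qint q 2 * (q powi (- u) * c) = qint q 2 * (q powi u * d)"
    using rel[of 0] by (simp add: mult_ac)
  then have h: "q powi (- u) * c = q powi u * d" by simp
  have "d = (q powi (- u) * q powi u) * d" by (simp add: power_int_minus)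
  also have "\<dots> = q powi (- u) * (q powi (- u) * c)" by (simp add: h)
  also have "\<dots> = c * q powi (- u + - u)" by (simp only: power_int_add q_nonzero simp_thms mult_ac)
  finally show ?thesis using M2[OF True] True by simp
next
  case False
  \<comment> \<open>\<open>rel\<close> at \<open>j\<close> says \<open>q^j P = q^(-j) Q\<close>. As
    \<open>M \<ge> 3\<close>, both \<open>j = 0\<close> and \<open>j = 1\<close> are allowed, which
    forces \<open>P = Q = 0\<close>. Of the four ways to make both products vanish, the two values
    of \<open>v\<close> at once and the two values of \<open>d\<close> at once are impossible; the
    mixed ones are the conclusion.\<close>
  define P where "P = (q powi v - q powi (u + 2)) * (d - c * q powi (- int M - u - v))"
  define Q where "Q = (q powi v - q powi (u - 2)) * (d - c * q powi (int M - u - v))"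
  have PQ: "q powi (- u) * qint q (int M - int j) * c + q powi v * qint q (int j) * d
      - (q powi (- v) * qint q (int M - 2 - int j) * c + q powi u * qint q (int j + 2) * d)
      = qden * (q powi int j * P - q powi (- int j) * Q)" for j
    unfolding P_def Q_def by (simp add: qint_expand field_simps)
  have "P - Q = 0"
    using PQ[of 0] rel[of 0] M False by simp
  moreover have "q * P - inverse q * Q = 0"
    using PQ[of 1] rel[of 1] M False by (simp add: power_int_minus)
  ultimately have "(q - inverse q) * P = 0"
    by (simp add: algebra_simps)
  then have "P = 0" "Q = 0" using \<open>P - Q = 0\<close> by auto
  then have "v = u + 2 \<or> d = c * q powi (- int M - u - v)" "v = u - 2 \<or> d = c * q powi (int M - u - v)"
    by (auto simp: P_def Q_def)
  moreover have False if "d = c * q powi (- int M - u - v)" "d = c * q powi (int M - u - v)"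
  proof -
    have "c \<noteq> 0" using nz that by auto
    then have "q powi (- int M - u - v) = q powi (int M - u - v)" using that by simp
    then show False unfolding powi_inject using M by simp
  qed
  ultimately show ?thesis by auto
qed

end

lemma linear_expand:
  assumes X_add: "\<And>x y. x \<in> supported m \<Longrightarrow> y \<in> supported m \<Longrightarrow> X (x + y) = X x + X y"
    and X_scale: "\<And>c x. x \<in> supported m \<Longrightarrow> X (c *\<^sub>C x) = c *\<^sub>C X x"
    and x: "x \<in> supported m"
  shows "X x = (\<Sum>i\<le>m. x i *\<^sub>C X (unit_vec i))"
proof -
  have X0: "X 0 = 0" using X_scale[of 0 0] by simp
  have "(\<Sum>i\<in>I. x i *\<^sub>C unit_vec i) \<in> supported m \<and> X (\<Sum>i\<in>I. x i *\<^sub>C unit_vec i) = (\<Sum>i\<in>I. x i *\<^sub>C X (unit_vec i))"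
    if "I \<subseteq> {..m}" for I
    using finite_subset[OF that] that
    by (induction I rule: finite_induct) (auto simp: X_add X_scale X0)
  from this[of "{..m}"] show ?thesis by (simp flip: supported_expand[OF x])
qed

text \<open>For the matrix \<open>t\<close> of \<open>X\<close>, \<open>XK\<close> gives the support
  and \<open>XF\<close> at \<open>v_i\<close> with \<open>i < m1\<close> the recursion. At the last
  basis vector, which \<open>F1\<close> kills, \<open>XF\<close> says that only the last entry of
  the row can be nonzero.\<close>

lemma (in generic_q) lowering_classification:
  assumes X_in: "\<And>x. x \<in> supported m1 \<Longrightarrow> X x \<in> supported m2"
    and X_add: "\<And>x y. x \<in> supported m1 \<Longrightarrow> y \<in> supported m1 \<Longrightarrow> X (x + y) = X x + X y"
    and X_scale: "\<And>c x. x \<in> supported m1 \<Longrightarrow> X (c *\<^sub>C x) = c *\<^sub>C X x"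
    and XK: "\<And>x. x \<in> supported m1 \<Longrightarrow> Kop q m2 (X x) = inverse (q\<^sup>2) *\<^sub>C X (Kop q m1 x)"
    and XF: "\<And>x. x \<in> supported m1 \<Longrightarrow> X (Fop q m1 x) = Fop q m2 (X x)"
  shows "m1 = m2 + 2 \<Longrightarrow> \<exists>c. \<forall>x\<in>supported m1. X x = c *\<^sub>C down_e m2 x"
    and "m1 = m2 \<Longrightarrow> \<exists>c. \<forall>x\<in>supported m1. X x = c *\<^sub>C Fop q m2 x"
    and "m2 = m1 + 2 \<Longrightarrow> \<exists>c. \<forall>x\<in>supported m1. X x = c *\<^sub>C up_e q x"
    and "m1 \<noteq> m2 + 2 \<Longrightarrow> m1 \<noteq> m2 \<Longrightarrow> m2 \<noteq> m1 + 2 \<Longrightarrow> x \<in> supported m1 \<Longrightarrow> X x = 0"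
proof -
  define t where "t i j = X (unit_vec i) j" for i j
  have X0: "X 0 = 0" using X_scale[of 0 0] by simp
  have X_expand: "X x j = (\<Sum>i\<le>m1. x i * t i j)" if "x \<in> supported m1" for x j
    using linear_expand[of m1 X, OF X_add X_scale that] by (simp add: sum_apply t_def)
  have X_out: "X x j = 0" if "x \<in> supported m1" "j > m2" for x j
    using X_in[OF that(1)] that(2) by (simp add: supported_def)
  have supp: "int m2 - 2 * int j = int m1 - 2 * int i - 2" if "i \<le> m1" "j \<le> m2" "t i j \<noteq> 0" for i j
  proof -
    have "q powi (int m2 - 2 * int j) * t i j = inverse (q\<^sup>2) * (q powi (int m1 - 2 * int i) * t i j)"
      using fun_cong[OF XK[of "unit_vec i"], of j] that by (simp add: Kop_unit_vec X_scale) (simp add: Kop_def t_def)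
    then have "q powi (int m2 - 2 * int j) = q powi (int m1 - 2 * int i - 2)"
      using that(3) by (simp add: power_int_diff divide_inverse)
    then show ?thesis by (simp only: powi_inject)
  qed
  have rec: "qint q (int i + 1) * t (Suc i) j = (if j = 0 then 0 else qint q (int j) * t i (j - 1))"
    if "i < m1" "j \<le> m2" for i j
    using fun_cong[OF XF[of "unit_vec i"], of j] that by (auto simp: Fop_unit_vec X_scale) (auto simp: Fop_def t_def)
  have top: "t m1 j = 0" if "j < m2" for j
    using fun_cong[OF XF[of "unit_vec m1"], of "Suc j"] that
    by (auto simp: Fop_unit_vec X0) (auto simp: Fop_def t_def)
  note S = shift_matrix[of m1 m2 t, OF supp rec]
  show "\<exists>c. \<forall>x\<in>supported m1. X x = c *\<^sub>C down_e m2 x" if m: "m1 = m2 + 2"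
  proof -
    obtain c where c: "\<forall>i\<le>m1. \<forall>j\<le>m2. t i j = (if j = i then c else 0)" using S(1) m by blast
    have "X x = c *\<^sub>C down_e m2 x" if x: "x \<in> supported m1" for x
    proof (rule ext)
      fix j
      show "X x j = (c *\<^sub>C down_e m2 x) j"
      proof (cases "j \<le> m2")
        case True
        then have "X x j = (\<Sum>i\<le>m1. if i = j then x i * c else 0)"
          unfolding X_expand[OF x] by (intro sum.cong) (auto simp: c)
        then show ?thesis using True m by (simp add: down_e_def)
      qed (use x X_out in \<open>auto simp: down_e_def\<close>)
    qed
    then show ?thesis by blast
  qed
  show "\<exists>c. \<forall>x\<in>supported m1. X x = c *\<^sub>C Fop q m2 x" if m: "m1 = m2"
  proof -
    obtain c where c: "\<forall>i\<le>m1. \<forall>j\<le>m2. t i j = (if j = Suc i then c * qint q (int j) else 0)"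
      using S(2) m by blast
    have "X x = c *\<^sub>C Fop q m2 x" if x: "x \<in> supported m1" for x
    proof (rule ext)
      fix j
      show "X x j = (c *\<^sub>C Fop q m2 x) j"
      proof (cases "j \<le> m2")
        case True
        then have "X x j = (\<Sum>i\<le>m1. if Suc i = j then x i * (c * qint q (int j)) else 0)"
          unfolding X_expand[OF x] by (intro sum.cong) (auto simp: c)
        also have "\<dots> = c * (qint q (int j) * x (j - 1))"
          using True m by (cases j) auto
        finally show ?thesis using True by (simp add: Fop_def)
      qed (use x X_out in \<open>auto simp: Fop_def\<close>)
    qed
    then show ?thesis by blast
  qed
  show "\<exists>c. \<forall>x\<in>supported m1. X x = c *\<^sub>C up_e q x" if m: "m2 = m1 + 2"
  proof -
    obtain c where c: "\<forall>i\<le>m1. \<forall>j\<le>m2. t i j = (if j = i + 2 then c * (qint q (int j) * qint q (int j - 1)) else 0)"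
      using S(3) m by blast
    have "X x = c *\<^sub>C up_e q x" if x: "x \<in> supported m1" for x
    proof (rule ext)
      fix j
      show "X x j = (c *\<^sub>C up_e q x) j"
      proof (cases "j \<le> m2")
        case True
        then have "X x j = (\<Sum>i\<le>m1. if Suc (Suc i) = j then x i * (c * (qint q (int j) * qint q (int j - 1))) else 0)"
          unfolding X_expand[OF x] by (intro sum.cong) (auto simp: c)
        also have "\<dots> = c * (qint q (int j) * qint q (int j - 1) * x (j - 2))"
        proof (cases "j < 2")
          case False
          then obtain k where "j = Suc (Suc k)" by (metis add_2_eq_Suc le_Suc_ex not_less)
          then show ?thesis using True m by simp
        qed (auto simp: less_2_cases_iff)
        finally show ?thesis by (simp add: up_e_def)
      qed (use x X_out m in \<open>auto simp: up_e_def supported_def\<close>)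
    qed
    then show ?thesis by blast
  qed
  show "X x = 0" if m: "m1 \<noteq> m2 + 2" "m1 \<noteq> m2" "m2 \<noteq> m1 + 2" and x: "x \<in> supported m1"
  proof (rule ext)
    fix j
    have "t i j = 0" if "i \<le> m1" "j \<le> m2" for i
      using shift_matrix_zero[of m1 m2 t, OF supp rec top m that] by blast
    then show "X x j = 0 j"
      using X_expand[OF x, of j] X_out[OF x, of j] by (cases "j \<le> m2") auto
  qed
qed

lemma (in generic_q) raising_classification:
  assumes Y_in: "\<And>x. x \<in> supported m1 \<Longrightarrow> Y x \<in> supported m2"
    and Y_add: "\<And>x y. x \<in> supported m1 \<Longrightarrow> y \<in> supported m1 \<Longrightarrow> Y (x + y) = Y x + Y y"
    and Y_scale: "\<And>c x. x \<in> supported m1 \<Longrightarrow> Y (c *\<^sub>C x) = c *\<^sub>C Y x"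
    and YK: "\<And>x. x \<in> supported m1 \<Longrightarrow> Kop q m2 (Y x) = q\<^sup>2 *\<^sub>C Y (Kop q m1 x)"
    and YE: "\<And>x. x \<in> supported m1 \<Longrightarrow> Y (Eop q m1 x) = Eop q m2 (Y x)"
  shows "m1 = m2 + 2 \<Longrightarrow> \<exists>c. \<forall>x\<in>supported m1. Y x = c *\<^sub>C down_f x"
    and "m1 = m2 \<Longrightarrow> \<exists>c. \<forall>x\<in>supported m1. Y x = c *\<^sub>C Eop q m2 x"
    and "m2 = m1 + 2 \<Longrightarrow> \<exists>c. \<forall>x\<in>supported m1. Y x = c *\<^sub>C up_f q m2 x"
    and "m1 \<noteq> m2 + 2 \<Longrightarrow> m1 \<noteq> m2 \<Longrightarrow> m2 \<noteq> m1 + 2 \<Longrightarrow> x \<in> supported m1 \<Longrightarrow> Y x = 0"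
proof -
  define t where "t i j = Y (unit_vec (m1 - i)) (m2 - j)" for i j
  have Y0: "Y 0 = 0" using Y_scale[of 0 0] by simp
  have Y_expand: "Y x j = (\<Sum>i\<le>m1. x i * t (m1 - i) (m2 - j))" if "x \<in> supported m1" "j \<le> m2" for x j
    using linear_expand[of m1 Y, OF Y_add Y_scale that(1)] that(2) by (simp add: sum_apply t_def)
  have Y_out: "Y x j = 0" if "x \<in> supported m1" "j > m2" for x j
    using Y_in[OF that(1)] that(2) by (simp add: supported_def)
  have supp: "int m2 - 2 * int j = int m1 - 2 * int i - 2" if "i \<le> m1" "j \<le> m2" "t i j \<noteq> 0" for i j
  proof -
    have "q powi (int m2 - 2 * int (m2 - j)) * t i j = q\<^sup>2 * (q powi (int m1 - 2 * int (m1 - i)) * t i j)"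
      using fun_cong[OF YK[of "unit_vec (m1 - i)"], of "m2 - j"] that
      by (simp add: Kop_unit_vec Y_scale) (simp add: Kop_def t_def)
    then have "q powi (int m2 - 2 * int (m2 - j)) = q powi (2 + (int m1 - 2 * int (m1 - i)))"
      using that(3) by (simp add: power_int_add)
    then show ?thesis unfolding powi_inject using that by (simp add: of_nat_diff)
  qed
  have rec: "qint q (int i + 1) * t (Suc i) j = (if j = 0 then 0 else qint q (int j) * t i (j - 1))"
    if "i < m1" "j \<le> m2" for i j
  proof -
    have *: "qint q (int i + 1) * Y (unit_vec (m1 - Suc i)) (m2 - j) = Eop q m2 (Y (unit_vec (m1 - i))) (m2 - j)"
      using fun_cong[OF YE[of "unit_vec (m1 - i)"], of "m2 - j"] that by (simp add: Eop_unit_vec Y_scale)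
    show ?thesis
    proof (cases j)
      case (Suc k)
      have "Suc (m2 - Suc k) = m2 - k" "int m2 - int (m2 - Suc k) = int (Suc k)"
        using that Suc by simp_all
      then show ?thesis using * by (simp add: t_def Eop_def Suc del: of_nat_Suc of_nat_diff)
    qed (use * in \<open>simp add: t_def Eop_def\<close>)
  qed
  have top: "t m1 j = 0" if "j < m2" for j
  proof -
    have "Eop q m2 (Y (unit_vec 0)) (m2 - Suc j) = 0"
      using fun_cong[OF YE[of "unit_vec 0"], of "m2 - Suc j"] by (simp add: Eop_unit_vec_0 Y0)
    moreover have "Suc (m2 - Suc j) = m2 - j" using that by simp
    ultimately show ?thesis using that by (simp add: t_def Eop_def of_nat_diff)
  qed
  note S = shift_matrix[of m1 m2 t, OF supp rec]
  show "\<exists>c. \<forall>x\<in>supported m1. Y x = c *\<^sub>C down_f x" if m: "m1 = m2 + 2"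
  proof -
    obtain c where c: "\<forall>i\<le>m1. \<forall>j\<le>m2. t i j = (if j = i then c else 0)" using S(1) m by blast
    have "Y x = c *\<^sub>C down_f x" if x: "x \<in> supported m1" for x
    proof (rule ext)
      fix j
      show "Y x j = (c *\<^sub>C down_f x) j"
      proof (cases "j \<le> m2")
        case True
        then have "Y x j = (\<Sum>i\<le>m1. if i = j + 2 then x i * c else 0)"
          unfolding Y_expand[OF x True] by (intro sum.cong) (use m in \<open>auto simp: c\<close>)
        then show ?thesis using True m by (simp add: down_f_def)
      qed (use x Y_out m in \<open>auto simp: down_f_def supported_def\<close>)
    qed
    then show ?thesis by blast
  qed
  show "\<exists>c. \<forall>x\<in>supported m1. Y x = c *\<^sub>C Eop q m2 x" if m: "m1 = m2"
  proof -
    obtain c where c: "\<forall>i\<le>m1. \<forall>j\<le>m2. t i j = (if j = Suc i then c * qint q (int j) else 0)"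
      using S(2) m by blast
    have "Y x = c *\<^sub>C Eop q m2 x" if x: "x \<in> supported m1" for x
    proof (rule ext)
      fix j
      show "Y x j = (c *\<^sub>C Eop q m2 x) j"
      proof (cases "j \<le> m2")
        case True
        then have "Y x j = (\<Sum>i\<le>m1. if i = Suc j then x i * (c * qint q (int m2 - int j)) else 0)"
          unfolding Y_expand[OF x True] by (intro sum.cong) (use m in \<open>auto simp: c of_nat_diff\<close>)
        also have "\<dots> = c * (qint q (int m2 - int j) * x (j + 1))"
          using True m x by (cases "j = m2") auto
        finally show ?thesis using True by (simp add: Eop_def)
      qed (use x Y_out in \<open>auto simp: Eop_def\<close>)
    qed
    then show ?thesis by blast
  qed
  show "\<exists>c. \<forall>x\<in>supported m1. Y x = c *\<^sub>C up_f q m2 x" if m: "m2 = m1 + 2"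
  proof -
    obtain c where c: "\<forall>i\<le>m1. \<forall>j\<le>m2. t i j = (if j = i + 2 then c * (qint q (int j) * qint q (int j - 1)) else 0)"
      using S(3) m by blast
    have "Y x = c *\<^sub>C up_f q m2 x" if x: "x \<in> supported m1" for x
    proof (rule ext)
      fix j
      show "Y x j = (c *\<^sub>C up_f q m2 x) j"
      proof (cases "j \<le> m2")
        case True
        have "x i * t (m1 - i) (m2 - j)
            = (if i = j then x i * (c * (qint q (int m2 - int j) * qint q (int m2 - int j - 1))) else 0)"
          if "i \<le> m1" for i
        proof -
          have "m2 - j = m1 - i + 2 \<longleftrightarrow> i = j" "int (m2 - j) = int m2 - int j"
            using that m True by auto
          then show ?thesis using c[rule_format, of "m1 - i" "m2 - j"] by (simp del: of_nat_diff)
        qed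
        then have "Y x j = (\<Sum>i\<le>m1. if i = j then x i * (c * (qint q (int m2 - int j) * qint q (int m2 - int j - 1))) else 0)"
          unfolding Y_expand[OF x True] by (intro sum.cong) auto
        then have "Y x j = (if j \<le> m1 then x j * (c * (qint q (int m2 - int j) * qint q (int m2 - int j - 1))) else 0)"
          by simp
        then show ?thesis using x by (auto simp: up_f_def supported_def)
      qed (use x Y_out m in \<open>auto simp: up_f_def supported_def\<close>)
    qed
    then show ?thesis by blast
  qed
  show "Y x = 0" if m: "m1 \<noteq> m2 + 2" "m1 \<noteq> m2" "m2 \<noteq> m1 + 2" and x: "x \<in> supported m1"
  proof (rule ext)
    fix j
    have "t (m1 - i) (m2 - j) = 0" if "i \<le> m1" for i
      using shift_matrix_zero[of m1 m2 t, OF supp rec top m] by simp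
    then show "Y x j = 0 j"
      using Y_expand[OF x, of j] Y_out[OF x, of j] by (cases "j \<le> m2") auto
  qed
qed

section \<open>Normal forms\<close>

lemma ext_model_cong:
  assumes "\<And>x. x \<in> supported m1 \<Longrightarrow> X x = X' x" "\<And>x. x \<in> supported m1 \<Longrightarrow> Y x = Y' x"
    and "\<And>x. x \<in> supported m1 \<Longrightarrow> X' x \<in> supported m2" "\<And>x. x \<in> supported m1 \<Longrightarrow> Y' x \<in> supported m2"
  shows "ext_model q m1 a1 m2 a2 X Y \<cong>\<^sub>U ext_model q m1 a1 m2 a2 X' Y'"
  by (rule isomorphicI[of _ id _ id])
    (use assms in \<open>auto simp: ext_act_def simp del: ev_act_simps split: generator.split\<close>)

text \<open>Scaling the submodule by \<open>c' / c\<close> multiplies both off-diagonal maps by it,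
  so only the ratio of the two scalars matters.\<close>

lemma ext_model_rescale:
  assumes "c \<noteq> 0" "c' \<noteq> 0" "c * d' = c' * d"
  shows "ext_model q m1 a1 m2 a2 (\<lambda>x. c *\<^sub>C X x) (\<lambda>x. d *\<^sub>C Y x)
    \<cong>\<^sub>U ext_model q m1 a1 m2 a2 (\<lambda>x. c' *\<^sub>C X x) (\<lambda>x. d' *\<^sub>C Y x)"
proof -
  define t where "t = c' / c"
  have t: "t \<noteq> 0" "t * c = c'" "t * d = d'" using assms by (auto simp: t_def field_simps)
  show ?thesis
    by (rule isomorphicI[of _ "\<lambda>(x, y). (x, t *\<^sub>C y)" _ "\<lambda>(x, y). (x, inverse t *\<^sub>C y)"])
      (use t in \<open>auto simp: ext_act_def scaleC_prod_def scaleC_scaleC scaleC_one scaleC_distribs ev_act_scale mult.commute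
        simp del: ev_act_simps split: generator.split\<close>)
qed

lemma ext_model_direct_sum:
  "ext_model q m1 a1 m2 a2 (\<lambda>_. 0) (\<lambda>_. 0) \<cong>\<^sub>U ev q m1 a1 \<oplus>\<^sub>U ev q m2 a2"
  by (rule isomorphicI[of _ id _ id])
    (auto simp: ext_act_def direct_sum_def simp del: ev_act_simps split: generator.split)

text \<open>The four reducible tensor products in the coordinates of their U_q(sl_2)-decomposition.
  \<open>right\<close> and \<open>left\<close> tell the side of the two-dimensional factor,
  \<open>plus\<close> and \<open>minus\<close> whether its parameter is \<open>b + n + 2\<close> or
  \<open>b - n - 2\<close>, where \<open>b\<close> belongs to the factor of dimension
  \<open>n + 2\<close>. The coefficients are those of \<open>E0\<close> and \<open>F0\<close> on
  \<open>right_map\<close> and \<open>left_map\<close>.\<close>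

definition nf_right_plus :: "complex \<Rightarrow> nat \<Rightarrow> int \<Rightarrow> ((nat \<Rightarrow> complex) \<times> (nat \<Rightarrow> complex)) umodule" where
  "nf_right_plus q n b = ext_model q (n + 2) (b + 1) n (b - 1)
     (\<lambda>x. (q powi (b - 1) - q powi (b + 1)) *\<^sub>C down_e n x)
     (\<lambda>x. (q powi (- b - int n - 3) - q powi (- b - int n - 1)) *\<^sub>C down_f x)"

definition nf_right_minus :: "complex \<Rightarrow> nat \<Rightarrow> int \<Rightarrow> ((nat \<Rightarrow> complex) \<times> (nat \<Rightarrow> complex)) umodule" where
  "nf_right_minus q n b = ext_model q n (b + 1) (n + 2) (b - 1)
     (\<lambda>x. (q powi (b - 1) - q powi (b + 1)) *\<^sub>C up_e q x)
     (\<lambda>x. (q powi (int n + 1 - b) - q powi (int n + 3 - b)) *\<^sub>C up_f q (n + 2) x)"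

definition nf_left_plus :: "complex \<Rightarrow> nat \<Rightarrow> int \<Rightarrow> ((nat \<Rightarrow> complex) \<times> (nat \<Rightarrow> complex)) umodule" where
  "nf_left_plus q n b = ext_model q n (b - 1) (n + 2) (b + 1)
     (\<lambda>x. (q powi (b + int n + 3) - q powi (b + int n + 1)) *\<^sub>C up_e q x)
     (\<lambda>x. (q powi (1 - b) - q powi (- b - 1)) *\<^sub>C up_f q (n + 2) x)"

definition nf_left_minus :: "complex \<Rightarrow> nat \<Rightarrow> int \<Rightarrow> ((nat \<Rightarrow> complex) \<times> (nat \<Rightarrow> complex)) umodule" where
  "nf_left_minus q n b = ext_model q (n + 2) (b - 1) n (b + 1)
     (\<lambda>x. (q powi (b - int n - 1) - q powi (b - int n - 3)) *\<^sub>C down_e n x)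
     (\<lambda>x. (q powi (1 - b) - q powi (- b - 1)) *\<^sub>C down_f x)"

text \<open>The change of splitting \<open>y \<mapsto> y + t x\<close> changes \<open>X\<close> by \<open>t (q\<^bsup>a2\<^esup> - q\<^bsup>a1\<^esup>) f\<^sub>1\<close>.\<close>

lemma ext_model_split:
  assumes "q powi a1 \<noteq> q powi a2" and "q \<noteq> 0" and "d = - c * q powi (- a1 - a2)"
  shows "ext_model q m a1 m a2 (\<lambda>x. c *\<^sub>C Fop q m x) (\<lambda>x. d *\<^sub>C Eop q m x) \<cong>\<^sub>U ev q m a1 \<oplus>\<^sub>U ev q m a2"
proof -
  define t where "t = c / (q powi a2 - q powi a1)"
  have t: "t * q powi a2 = c + t * q powi a1"
    using assms(1) by (simp add: t_def field_simps)
  \<comment> \<open>The hypothesis on \<open>d\<close> says that the \<open>t\<close> found for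
    \<open>E0\<close> also works for \<open>F0\<close>.\<close>
  have t': "t * q powi (- a2) = d + t * q powi (- a1)"
  proof -
    have "q powi (- a1 - a2) * (t * q powi a2 - t * q powi a1) = q powi (- a1 - a2) * c"
      using t by simp
    then show ?thesis
      using assms(2,3) by (simp add: algebra_simps power_int_diff power_int_minus divide_inverse)
  qed
  let ?M = "ext_model q m a1 m a2 (\<lambda>x. c *\<^sub>C Fop q m x) (\<lambda>x. d *\<^sub>C Eop q m x)"
  show ?thesis
  proof (rule isomorphicI[of ?M "\<lambda>(x, y). (x, y + t *\<^sub>C x)" _ "\<lambda>(x, y). (x, y - t *\<^sub>C x)"])
    fix g v assume "v \<in> uspace ?M"
    then obtain x y where v: "v = (x, y)" "x \<in> supported m" "y \<in> supported m" by auto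
    have E0: "(q powi a2 * t) *\<^sub>C z = c *\<^sub>C z + (t * q powi a1) *\<^sub>C z" for z :: "nat \<Rightarrow> complex"
      unfolding mult.commute[of "q powi a2"] t scaleC_add_left ..
    have F0: "(q powi (- a2) * t) *\<^sub>C z = d *\<^sub>C z + (t * q powi (- a1)) *\<^sub>C z" for z :: "nat \<Rightarrow> complex"
      unfolding mult.commute[of "q powi (- a2)"] t' scaleC_add_left ..
    show "(\<lambda>(x, y). (x, y + t *\<^sub>C x)) (act ?M g v) = act (ev q m a1 \<oplus>\<^sub>U ev q m a2) g ((\<lambda>(x, y). (x, y + t *\<^sub>C x)) v)"
      by (cases g) (simp_all add: v ext_act_def direct_sum_def ops_linear scaleC_add_right scaleC_scaleC E0 F0 add.assoc
          del: scaleC_apply)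
  qed (auto simp: direct_sum_def scaleC_prod_def scaleC_distribs scaleC_scaleC mult.commute)
qed

text \<open>\<open>self_extension\<close> has the submodule as first summand,
  \<open>ext_model\<close> as second; hence the exchange of components. The factor \<open>s\<close>
  is chosen so that \<open>s * c = q powi a\<close>.\<close>

lemma ext_model_self_extension:
  assumes "c \<noteq> 0" and "q \<noteq> 0" and "d = - c * q powi (- a - a)"
  shows "ext_model q m a m a (\<lambda>x. c *\<^sub>C Fop q m x) (\<lambda>x. d *\<^sub>C Eop q m x)
    \<cong>\<^sub>U self_extension q (a - int m + 1) (a + int m - 1)"
proof -
  define s where "s = q powi a / c"
  have "q powi (- a - a) = inverse (q powi a) * inverse (q powi a)"
    using assms(2) by (subst power_int_diff) (simp_all add: power_int_minus divide_inverse)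
  then have s: "s \<noteq> 0" "s * c = q powi a" "s * d = - (q powi (- a))"
    using assms by (simp_all add: s_def power_int_minus divide_inverse, simp add: field_simps)
  have SE: "self_extension q (a - int m + 1) (a + int m - 1) = \<lparr>uspace = supported m \<times> supported m,
     act = (\<lambda>g (x, y). case g of
             E0 \<Rightarrow> (q powi a *\<^sub>C (Fop q m x + Fop q m y), q powi a *\<^sub>C Fop q m y)
           | F0 \<Rightarrow> (q powi (- a) *\<^sub>C (Eop q m x - Eop q m y), q powi (- a) *\<^sub>C Eop q m y)
           | _ \<Rightarrow> (ev_act q m a g x, ev_act q m a g y))\<rparr>"
  proof -
    have mid: "(a - int m + 1 + (a + int m - 1)) div 2 = a" by simp
    show ?thesis
      unfolding self_extension_def Let_def eval_module_eq_ev[OF refl refl] mid ev_simps ev_act_simps ..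
  qed
  let ?M = "ext_model q m a m a (\<lambda>x. c *\<^sub>C Fop q m x) (\<lambda>x. d *\<^sub>C Eop q m x)"
  show ?thesis
    unfolding SE
  proof (rule isomorphicI[of ?M "\<lambda>(x, y). (s *\<^sub>C y, x)" _ "\<lambda>(x, y). (y, inverse s *\<^sub>C x)"], goal_cases)
    case (7 g v)
    obtain x y where v: "v = (x, y)" by (cases v)
    have "c * s = q powi a" "d * s = - (q powi (- a))"
      using s by (simp_all add: mult.commute)
    then show ?case
      by (cases g) (simp_all add: v ops_linear ext_act_def scaleC_distribs scaleC_scaleC mult.commute add.commute del: scaleC_apply)
  qed (use s in \<open>auto simp: scaleC_prod_def scaleC_distribs scaleC_scaleC scaleC_one mult.commute\<close>)
qed

context generic_q begin

lemma right_map_linear: "right_map q n (x + x') (y + y') = right_map q n x y + right_map q n x' y'"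
  "right_map q n (c *\<^sub>C x) (c *\<^sub>C y) = c *\<^sub>C right_map q n x y"
  by (auto simp: right_map_def fun_eq_iff algebra_simps)

lemma left_map_linear: "left_map q n (x + x') (y + y') = left_map q n x y + left_map q n x' y'"
  "left_map q n (c *\<^sub>C x) (c *\<^sub>C y) = c *\<^sub>C left_map q n x y"
  by (auto simp: left_map_def fun_eq_iff algebra_simps)

lemma right_inv_in: "right_inv q n h \<in> supported (n + 2) \<times> supported n"
  by (auto simp: right_inv_def supported_def)

lemma left_inv_in: "left_inv q n h \<in> supported (n + 2) \<times> supported n"
  by (auto simp: left_inv_def supported_def)

text \<open>An isomorphism would make \<open>K\<close> fix \<open>v_0\<close>, on which it acts by
  \<open>q^m \<noteq> 1\<close>.\<close>

lemma eval_module_nontrivial: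
  assumes "m > 0"
  shows "\<not> ev q m a \<cong>\<^sub>U trivial_module"
proof
  assume "ev q m a \<cong>\<^sub>U trivial_module"
  then obtain f where f: "inj_on f (supported m)" "\<And>c x. x \<in> supported m \<Longrightarrow> f (c *\<^sub>C x) = c * f x"
    "\<And>g x. x \<in> supported m \<Longrightarrow> f (ev_act q m a g x) = act trivial_module g (f x)"
    unfolding isomorphic_def by (auto simp: bij_betw_def)
  have "f (q powi int m *\<^sub>C unit_vec 0) = f (unit_vec 0)"
    using f(3)[of "unit_vec 0" K] by (simp add: Kop_unit_vec trivial_module_def)
  then have "q powi int m * f (unit_vec 0) = f (unit_vec 0)"
    using f(2)[of "unit_vec 0" "q powi int m"] by simp
  moreover have "q powi int m \<noteq> 1"
    unfolding powi_eq_1_iff using assms by simp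
  ultimately have "f (unit_vec 0) = f 0"
    using f(2)[of 0 0] by simp
  then have "unit_vec 0 = 0"
    using f(1) by (auto dest: inj_onD)
  then have "unit_vec 0 0 = 0" by simp
  then show False by (simp add: unit_vec_def)
qed

end

section \<open>The classification\<close>

locale ext_model_iso = generic_uq_module q V for q and V :: "'v::complex_vector umodule" +
  fixes m1 :: nat and a1 :: int and m2 :: nat and a2 :: int
    and X Y :: "(nat \<Rightarrow> complex) \<Rightarrow> nat \<Rightarrow> complex"
  assumes iso: "V \<cong>\<^sub>U ext_model q m1 a1 m2 a2 X Y"
    and X_in: "\<And>x. x \<in> supported m1 \<Longrightarrow> X x \<in> supported m2" and Y_in: "\<And>x. x \<in> supported m1 \<Longrightarrow> Y x \<in> supported m2"
    and X_add: "\<And>x y. x \<in> supported m1 \<Longrightarrow> y \<in> supported m1 \<Longrightarrow> X (x + y) = X x + X y"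
    and Y_add: "\<And>x y. x \<in> supported m1 \<Longrightarrow> y \<in> supported m1 \<Longrightarrow> Y (x + y) = Y x + Y y"
    and X_scale: "\<And>c x. x \<in> supported m1 \<Longrightarrow> X (c *\<^sub>C x) = c *\<^sub>C X x"
    and Y_scale: "\<And>c x. x \<in> supported m1 \<Longrightarrow> Y (c *\<^sub>C x) = c *\<^sub>C Y x"
    and nonsplit: "\<not> V \<cong>\<^sub>U ev q m1 a1 \<oplus>\<^sub>U ev q m2 a2"
begin

lemma X_0: "X 0 = 0" and Y_0: "Y 0 = 0"
  using X_scale[of 0 0] Y_scale[of 0 0] by simp_all

lemmas relations = ext_model_relations[OF iso _ X_0 Y_0]

lemma X_shape:
  "m1 = m2 + 2 \<Longrightarrow> \<exists>c. \<forall>x\<in>supported m1. X x = c *\<^sub>C down_e m2 x"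
  "m1 = m2 \<Longrightarrow> \<exists>c. \<forall>x\<in>supported m1. X x = c *\<^sub>C Fop q m2 x"
  "m2 = m1 + 2 \<Longrightarrow> \<exists>c. \<forall>x\<in>supported m1. X x = c *\<^sub>C up_e q x"
  "m1 \<noteq> m2 + 2 \<Longrightarrow> m1 \<noteq> m2 \<Longrightarrow> m2 \<noteq> m1 + 2 \<Longrightarrow> x \<in> supported m1 \<Longrightarrow> X x = 0"
  by (rule lowering_classification[of m1 X m2, OF X_in X_add X_scale relations(1,3)]; assumption)+

lemma Y_shape:
  "m1 = m2 + 2 \<Longrightarrow> \<exists>c. \<forall>x\<in>supported m1. Y x = c *\<^sub>C down_f x"
  "m1 = m2 \<Longrightarrow> \<exists>c. \<forall>x\<in>supported m1. Y x = c *\<^sub>C Eop q m2 x"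
  "m2 = m1 + 2 \<Longrightarrow> \<exists>c. \<forall>x\<in>supported m1. Y x = c *\<^sub>C up_f q m2 x"
  "m1 \<noteq> m2 + 2 \<Longrightarrow> m1 \<noteq> m2 \<Longrightarrow> m2 \<noteq> m1 + 2 \<Longrightarrow> x \<in> supported m1 \<Longrightarrow> Y x = 0"
  by (rule raising_classification[of m1 Y m2, OF Y_in Y_add Y_scale relations(2,4)]; assumption)+

lemma not_both_zero: "\<not> ((\<forall>x\<in>supported m1. X x = 0) \<and> (\<forall>x\<in>supported m1. Y x = 0))"
proof
  assume "(\<forall>x\<in>supported m1. X x = 0) \<and> (\<forall>x\<in>supported m1. Y x = 0)"
  then have "ext_model q m1 a1 m2 a2 X Y \<cong>\<^sub>U ext_model q m1 a1 m2 a2 (\<lambda>_. 0) (\<lambda>_. 0)"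
    by (intro ext_model_cong) auto
  then have "V \<cong>\<^sub>U ev q m1 a1 \<oplus>\<^sub>U ev q m2 a2"
    by (rule isomorphic_trans[OF isomorphic_trans[OF iso] ext_model_direct_sum])
  with nonsplit show False ..
qed

lemma shapes: "m1 = m2 + 2 \<or> m1 = m2 \<or> m2 = m1 + 2"
  using not_both_zero X_shape(4) Y_shape(4) by blast

lemma iso_cong:
  assumes "\<And>x. x \<in> supported m1 \<Longrightarrow> X x = X' x" "\<And>x. x \<in> supported m1 \<Longrightarrow> Y x = Y' x"
  shows "V \<cong>\<^sub>U ext_model q m1 a1 m2 a2 X' Y'"
proof -
  have "ext_model q m1 a1 m2 a2 X Y \<cong>\<^sub>U ext_model q m1 a1 m2 a2 X' Y'"
    by (rule ext_model_cong[OF assms]) (use assms X_in Y_in in auto)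
  with iso show ?thesis by (rule isomorphic_trans)
qed

lemma iso_rescale:
  assumes "\<And>x. x \<in> supported m1 \<Longrightarrow> X x = c *\<^sub>C X' x" "\<And>x. x \<in> supported m1 \<Longrightarrow> Y x = d *\<^sub>C Y' x"
    and "c \<noteq> 0" "c' \<noteq> 0" "c * d' = c' * d"
  shows "V \<cong>\<^sub>U ext_model q m1 a1 m2 a2 (\<lambda>x. c' *\<^sub>C X' x) (\<lambda>x. d' *\<^sub>C Y' x)"
  using iso_cong[of "\<lambda>x. c *\<^sub>C X' x" "\<lambda>x. d *\<^sub>C Y' x", OF assms(1,2)]
    ext_model_rescale[OF assms(3-5)] by (rule isomorphic_trans)

text \<open>For a trivial submodule the relations cannot see \<open>a2\<close>; \<open>triv\<close>
  sets it to the value of the first alternative.\<close>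

lemma classification_down:
  assumes m: "m1 = m2 + 2" and triv: "m2 = 0 \<Longrightarrow> a2 = a1 - 2"
  shows "(a2 = a1 - 2 \<and> V \<cong>\<^sub>U nf_right_plus q m2 (a1 - 1)) \<or> (a2 = a1 + 2 \<and> V \<cong>\<^sub>U nf_left_minus q m2 (a1 + 1))"
proof -
  obtain c where X: "X x = c *\<^sub>C down_e m2 x" if "x \<in> supported m1" for x
    using X_shape(1)[OF m] by blast
  obtain d where Y: "Y x = d *\<^sub>C down_f x" if "x \<in> supported m1" for x
    using Y_shape(1)[OF m] by blast
  have nz: "c \<noteq> 0 \<or> d \<noteq> 0"
  proof (rule ccontr)
    assume "\<not> (c \<noteq> 0 \<or> d \<noteq> 0)"
    then have "(\<forall>x\<in>supported m1. X x = 0) \<and> (\<forall>x\<in>supported m1. Y x = 0)"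
      by (simp add: X Y)
    with not_both_zero show False ..
  qed
  \<comment> \<open>Both sides of the last relation have weight 0, so they send
    \<open>v_(j+1)\<close> to a multiple of \<open>w_j\<close>; these multiples are
    compared.\<close>
  have rel: "q powi (- a1) * qint q (int m1 - int j) * c + q powi a2 * qint q (int j) * d
      = q powi (- a2) * qint q (int m1 - 2 - int j) * c + q powi a1 * qint q (int j + 2) * d" if "j \<le> m1 - 2" for j
  proof -
    have j: "j \<le> m2" using that m by simp
    have x: "unit_vec (j + 1) \<in> supported m1" using j m by simp
    show ?thesis
      using fun_cong[OF relations(5)[OF x, unfolded X[OF x] Y[OF x]
          X[OF supported_scale[OF ops_in_supported(2)]]
          Y[OF supported_scale[OF ops_in_supported(1)]]], of j] j m
      by (cases j; cases "j = m2")
        (simp_all add: down_e_def down_f_def op_defs unit_vec_def algebra_simps)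
  qed
  have "a2 = a1 - 2 \<and> d = c * q powi (- int m1 - a1 - a2) \<or> a2 = a1 + 2 \<and> d = c * q powi (int m1 - a1 - a2)"
    by (rule coefficient_relation[OF _ nz _ rel]) (use m triv in auto)
  then show ?thesis
  proof
    assume h: "a2 = a1 - 2 \<and> d = c * q powi (- int m1 - a1 - a2)"
    then have nz': "c \<noteq> 0" using nz by auto
    \<comment> \<open>The midpoint of \<open>a1\<close> and \<open>a2\<close>, on which
      \<open>nf_right_plus\<close> is built. After rescaling, only the ratio of the two coefficients
      has to match.\<close>
    define b where "b = a1 - 1"
    have "V \<cong>\<^sub>U ext_model q m1 a1 m2 a2 (\<lambda>x. (q powi (b - 1) - q powi (b + 1)) *\<^sub>C down_e m2 x)
        (\<lambda>x. (q powi (- b - int m2 - 3) - q powi (- b - int m2 - 1)) *\<^sub>C down_f x)"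
    proof (rule iso_rescale[OF X Y nz'])
      show "q powi (b - 1) - q powi (b + 1) \<noteq> 0" by simp
      have exponent: "- int m1 - a1 - a2 = - int m2 - 2 - b - b" using h m by (simp add: b_def)
      have d: "d = c * q powi (- int m2 - 2 - b - b)"
        using h[THEN conjunct2] unfolding exponent .
      show "c * (q powi (- b - int m2 - 3) - q powi (- b - int m2 - 1)) = (q powi (b - 1) - q powi (b + 1)) * d"
        unfolding d
        by (simp add: power_int_add power_int_diff power_int_minus power_int_mult
            power2_eq_square power3_eq_cube field_simps)
    qed
    then show ?thesis using h m by (simp add: nf_right_plus_def b_def add_ac)
  next
    assume h: "a2 = a1 + 2 \<and> d = c * q powi (int m1 - a1 - a2)"
    then have nz': "c \<noteq> 0" using nz by auto
    define b where "b = a1 + 1"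
    have "V \<cong>\<^sub>U ext_model q m1 a1 m2 a2 (\<lambda>x. (q powi (b - int m2 - 1) - q powi (b - int m2 - 3)) *\<^sub>C down_e m2 x)
        (\<lambda>x. (q powi (1 - b) - q powi (- b - 1)) *\<^sub>C down_f x)"
    proof (rule iso_rescale[OF X Y nz'])
      show "q powi (b - int m2 - 1) - q powi (b - int m2 - 3) \<noteq> 0" by simp
      have exponent: "int m1 - a1 - a2 = int m2 + 2 - b - b" using h m by (simp add: b_def)
      have d: "d = c * q powi (int m2 + 2 - b - b)"
        using h[THEN conjunct2] unfolding exponent .
      show "c * (q powi (1 - b) - q powi (- b - 1)) = (q powi (b - int m2 - 1) - q powi (b - int m2 - 3)) * d"
        unfolding d
        by (simp add: power_int_add power_int_diff power_int_minus power_int_mult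
            power2_eq_square power3_eq_cube field_simps)
    qed
    then show ?thesis using h m by (simp add: nf_left_minus_def b_def add_ac)
  qed
qed

lemma classification_up:
  assumes m: "m2 = m1 + 2" and triv: "m1 = 0 \<Longrightarrow> a1 = a2 + 2"
  shows "(a1 = a2 + 2 \<and> V \<cong>\<^sub>U nf_right_minus q m1 (a2 + 1)) \<or> (a1 = a2 - 2 \<and> V \<cong>\<^sub>U nf_left_plus q m1 (a2 - 1))"
proof -
  obtain c where X: "X x = c *\<^sub>C up_e q x" if "x \<in> supported m1" for x
    using X_shape(3)[OF m] by blast
  obtain d where Y: "Y x = d *\<^sub>C up_f q m2 x" if "x \<in> supported m1" for x
    using Y_shape(3)[OF m] by blast
  have nz: "d \<noteq> 0 \<or> c \<noteq> 0"
  proof (rule ccontr)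
    assume "\<not> (d \<noteq> 0 \<or> c \<noteq> 0)"
    then have "(\<forall>x\<in>supported m1. X x = 0) \<and> (\<forall>x\<in>supported m1. Y x = 0)"
      by (simp add: X Y)
    with not_both_zero show False ..
  qed
  \<comment> \<open>Now \<open>v_i\<close> goes to a multiple of \<open>w_(i+1)\<close>, and both
    sides share the nonzero factor \<open>[i + 1] [m2 - i - 1]\<close>. What remains fits
    \<open>coefficient_relation\<close> with \<open>c\<close> and \<open>d\<close> exchanged,
    \<open>u = - a2\<close> and \<open>v = - a1\<close>.\<close>
  have rel: "q powi (- (- a2)) * qint q (int m2 - int i) * d + q powi (- a1) * qint q (int i) * c
      = q powi (- (- a1)) * qint q (int m2 - 2 - int i) * d + q powi (- a2) * qint q (int i + 2) * c" if "i \<le> m2 - 2" for i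
  proof -
    have i: "i \<le> m1" using that m by simp
    have x: "unit_vec i \<in> supported m1" using i by simp
    have "qint q (int i + 1) * qint q (int m2 - int i - 1) *
        (q powi a2 * qint q (int m2 - int i) * d + q powi (- a1) * qint q (int i) * c)
      = qint q (int i + 1) * qint q (int m2 - int i - 1) *
        (q powi a1 * qint q (int m2 - 2 - int i) * d + q powi (- a2) * qint q (int i + 2) * c)"
      using fun_cong[OF relations(5)[OF x, unfolded X[OF x] Y[OF x]
          X[OF supported_scale[OF ops_in_supported(2)]]
          Y[OF supported_scale[OF ops_in_supported(1)]]], of "i + 1"] i m
      by (cases i; cases "i = m1")
        (simp_all add: up_e_def up_f_def op_defs unit_vec_def algebra_simps)
    moreover have "qint q (int i + 1) * qint q (int m2 - int i - 1) \<noteq> 0"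
      using i m by simp
    ultimately show ?thesis by simp
  qed
  have "- a1 = - a2 - 2 \<and> c = d * q powi (- int m2 - - a2 - - a1) \<or> - a1 = - a2 + 2 \<and> c = d * q powi (int m2 - - a2 - - a1)"
    by (rule coefficient_relation[OF _ nz _ rel]) (use m triv in auto)
  then show ?thesis
  proof
    assume h: "- a1 = - a2 - 2 \<and> c = d * q powi (- int m2 - - a2 - - a1)"
    then have nz': "c \<noteq> 0" using nz by auto
    define b where "b = a2 + 1"
    have "V \<cong>\<^sub>U ext_model q m1 a1 m2 a2 (\<lambda>x. (q powi (b - 1) - q powi (b + 1)) *\<^sub>C up_e q x)
      (\<lambda>x. (q powi (int m1 + 1 - b) - q powi (int m1 + 3 - b)) *\<^sub>C up_f q m2 x)"
    proof (rule iso_rescale[OF X Y nz'])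
      show "q powi (b - 1) - q powi (b + 1) \<noteq> 0" by simp
      have exponent: "- int m2 - - a2 - - a1 = b + b - int m1 - 2" using h m by (simp add: b_def)
      have c: "c = d * q powi (b + b - int m1 - 2)"
        using h[THEN conjunct2] unfolding exponent .
      show "c * (q powi (int m1 + 1 - b) - q powi (int m1 + 3 - b)) = (q powi (b - 1) - q powi (b + 1)) * d"
        unfolding c
        by (simp add: power_int_add power_int_diff power_int_minus power_int_mult
            power2_eq_square power3_eq_cube field_simps)
    qed
    moreover have "a1 = a2 + 2" using h by simp
    ultimately show ?thesis using m by (simp add: nf_right_minus_def b_def add_ac)
  next
    assume h: "- a1 = - a2 + 2 \<and> c = d * q powi (int m2 - - a2 - - a1)"
    then have nz': "c \<noteq> 0" using nz by auto
    define b where "b = a2 - 1"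
    have "V \<cong>\<^sub>U ext_model q m1 a1 m2 a2 (\<lambda>x. (q powi (b + int m1 + 3) - q powi (b + int m1 + 1)) *\<^sub>C up_e q x)
      (\<lambda>x. (q powi (1 - b) - q powi (- b - 1)) *\<^sub>C up_f q m2 x)"
    proof (rule iso_rescale[OF X Y nz'])
      show "q powi (b + int m1 + 3) - q powi (b + int m1 + 1) \<noteq> 0" by simp
      have exponent: "int m2 - - a2 - - a1 = b + b + int m1 + 2" using h m by (simp add: b_def)
      have c: "c = d * q powi (b + b + int m1 + 2)"
        using h[THEN conjunct2] unfolding exponent .
      show "c * (q powi (1 - b) - q powi (- b - 1)) = (q powi (b + int m1 + 3) - q powi (b + int m1 + 1)) * d"
        unfolding c
        by (simp add: power_int_add power_int_diff power_int_minus power_int_mult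
            power2_eq_square power3_eq_cube field_simps)
    qed
    moreover have "a1 = a2 - 2" using h by simp
    ultimately show ?thesis using m by (simp add: nf_left_plus_def b_def add_ac)
  qed
qed

text \<open>The coefficient at \<open>v_0\<close> already gives \<open>d = - c q^(-a1-a2)\<close>.
  For \<open>a1 \<noteq> a2\<close> this is exactly the block created by a change of section, so
  \<open>V\<close> would be the direct sum; for \<open>m1 = 0\<close> both maps are zero.\<close>

lemma classification_equal:
  assumes m: "m1 = m2"
  shows "a1 = a2 \<and> m1 > 0 \<and> V \<cong>\<^sub>U self_extension q (a1 - int m1 + 1) (a1 + int m1 - 1)"
proof -
  obtain c where X: "X x = c *\<^sub>C Fop q m2 x" if "x \<in> supported m1" for x
    using X_shape(2)[OF m] by blast
  obtain d where Y: "Y x = d *\<^sub>C Eop q m2 x" if "x \<in> supported m1" for x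
    using Y_shape(2)[OF m] by blast
  have m0: "m1 > 0"
  proof (rule ccontr)
    assume "\<not> m1 > 0"
    then have "Fop q m2 x = 0" "Eop q m2 x = 0" for x using m by (auto simp: op_defs fun_eq_iff)
    then show False using not_both_zero X Y by simp
  qed
  have x: "unit_vec 0 \<in> supported m1" by simp
  have "qint q (int m1) * (q powi (- a2) * c) + qint q (int m1) * (q powi a1 * d) = 0"
    using fun_cong[OF relations(5)[OF x, unfolded X[OF x] Y[OF x]
          X[OF supported_scale[OF ops_in_supported(2)]]
          Y[OF supported_scale[OF ops_in_supported(1)]]], of 0] m m0
    by (simp add: op_defs unit_vec_def algebra_simps)
  then have "q powi (- a2) * c + q powi a1 * d = 0"
    using m0 by (simp flip: distrib_left)
  then have eq: "q powi a1 * d = - (q powi (- a2) * c)"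
    by (simp add: eq_neg_iff_add_eq_0 add.commute)
  have "d = q powi (- a1) * (q powi a1 * d)"
    by (simp add: power_int_minus)
  then have d: "d = - c * q powi (- a1 - a2)"
    unfolding eq by (simp add: power_int_minus power_int_diff divide_inverse mult_ac)
  have c: "c \<noteq> 0" using not_both_zero X Y d by auto
  have V: "V \<cong>\<^sub>U ext_model q m1 a1 m1 a2 (\<lambda>x. c *\<^sub>C Fop q m1 x) (\<lambda>x. d *\<^sub>C Eop q m1 x)"
    using iso_cong[OF X Y] m by simp
  have a: "a1 = a2"
  proof (rule ccontr)
    assume "a1 \<noteq> a2"
    then have "q powi a1 \<noteq> q powi a2" by simp
    from isomorphic_trans[OF V ext_model_split[OF this q_nonzero d]] show False
      using nonsplit m by simp
  qed
  have "V \<cong>\<^sub>U self_extension q (a1 - int m1 + 1) (a1 + int m1 - 1)"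
    using isomorphic_trans[OF V[folded a] ext_model_self_extension[OF c q_nonzero]] d a by simp
  with a m0 show ?thesis by simp
qed

end

theorem theorem9p8:
  fixes q :: complex and \<alpha>1 \<beta>1 \<alpha>2 \<beta>2 :: int and V :: "'v::complex_vector umodule"
  assumes "q \<noteq> 0" and "\<forall>n::nat. n > 0 \<longrightarrow> q ^ n \<noteq> 1"
    and "is_string \<alpha>1 \<beta>1" and "is_string \<alpha>2 \<beta>2"
    and "uq_module q V"
    and "nontrivial_extension V (eval_module q \<alpha>1 \<beta>1) (eval_module q \<alpha>2 \<beta>2)"
  shows "\<exists>a1 b1 a2 b2. same_string \<alpha>1 \<beta>1 a1 b1 \<and> same_string \<alpha>2 \<beta>2 a2 b2 \<and>
    ((a2 = a1 \<and> b2 = b1 - 4 \<and>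
        V \<cong>\<^sub>U eval_module q a1 (b1 - 2) \<otimes>\<^sub>U eval_module q b1 b1)
   \<or> (a2 = a1 \<and> b2 = b1 + 4 \<and>
        V \<cong>\<^sub>U eval_module q (b1 + 4) (b1 + 4) \<otimes>\<^sub>U eval_module q a1 (b1 + 2))
   \<or> (a2 = a1 + 4 \<and> b2 = b1 \<and>
        V \<cong>\<^sub>U eval_module q a1 a1 \<otimes>\<^sub>U eval_module q (a1 + 2) b1)
   \<or> (a2 = a1 - 4 \<and> b2 = b1 \<and>
        V \<cong>\<^sub>U eval_module q (a1 - 2) b1 \<otimes>\<^sub>U eval_module q (a1 - 4) (a1 - 4))
   \<or> (a1 = a2 \<and> b1 = b2 \<and> \<not> eval_module q a1 b1 \<cong>\<^sub>U trivial_module \<and>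
        V \<cong>\<^sub>U self_extension q a1 b1))"
proof -
  interpret uq_module q V by fact
  interpret generic_uq_module q V
    by standard (use assms in auto)

  \<comment> \<open>The generators on the decomposed tensor products\<close>
  have right_map_ev:
    "act (ev q (n + 1) b \<otimes>\<^sub>U ev q 1 g) K (right_map q n x y)
      = right_map q n (Kop q (n + 2) x)
          (Kop q n y)"
    "act (ev q (n + 1) b \<otimes>\<^sub>U ev q 1 g) Kinv (right_map q n x y)
      = right_map q n (Kinvop q (n + 2) x)
          (Kinvop q n y)"
    "act (ev q (n + 1) b \<otimes>\<^sub>U ev q 1 g) F1 (right_map q n x y)
      = right_map q n (Fop q (n + 2) x)
          (Fop q n y)"
    "act (ev q (n + 1) b \<otimes>\<^sub>U ev q 1 g) E1 (right_map q n x y)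
      = right_map q n (Eop q (n + 2) x)
          (Eop q n y)"
    for n :: nat and b g :: int and x y :: "nat \<Rightarrow> complex"
    \<comment> \<open>The ends \<open>i = 0\<close> and \<open>i = n + 1\<close> are separated
      because indices are truncated or cut off there. The disabled rules would simplify
      \<open>[1]\<close> and special powers of \<open>q\<close> before all terms are homogeneous in
      \<open>qden\<close> and their exponents are collected.\<close>
    by (rule right_map_eqI[OF act_tensor_in[OF right_map_in]]; rename_tac i; case_tac i; case_tac "i = n + 1";
        simp add: coordinate_defs
          del: qint_1 power_int_of_nat power_int_1_right power_int_minus1_right power_int_numeral;
        (simp add: qint_powi powi_mult algebra_simps
          del: qint_1 power_int_of_nat power_int_1_right power_int_minus1_right power_int_numeral)?;
        (simp add: power_int_add power_int_diff power_int_minus field_simps)?)+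
  \<comment> \<open>For the parameter \<open>b + n + 2\<close> the block from \<open>y\<close> to
    \<open>x\<close> vanishes, so \<open>V_n\<close> is the submodule; for \<open>b - n - 2\<close>
    the other block vanishes and \<open>V_(n+2)\<close> is the submodule. With the tensor factors
    exchanged, the two signs exchange roles.\<close>
  have right_map_E0_F0_plus:
    "act (ev q (n + 1) b \<otimes>\<^sub>U ev q 1 (b + int n + 2)) E0 (right_map q n x y)
      = right_map q n (q powi (b + 1) *\<^sub>C Fop q (n + 2) x)
          (q powi (b - 1) *\<^sub>C Fop q n y + (q powi (b - 1) - q powi (b + 1)) *\<^sub>C down_e n x)"
    "act (ev q (n + 1) b \<otimes>\<^sub>U ev q 1 (b + int n + 2)) F0 (right_map q n x y)
      = right_map q n (q powi (- (b + 1)) *\<^sub>C Eop q (n + 2) x)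
          (q powi (- (b - 1)) *\<^sub>C Eop q n y + (q powi (- b - int n - 3) - q powi (- b - int n - 1)) *\<^sub>C down_f x)"
    for n :: nat and b :: int and x y :: "nat \<Rightarrow> complex"
    by (rule right_map_eqI[OF act_tensor_in[OF right_map_in]]; rename_tac i; case_tac i; case_tac "i = n + 1";
        simp add: coordinate_defs
          del: qint_1 power_int_of_nat power_int_1_right power_int_minus1_right power_int_numeral;
        (simp add: qint_powi powi_mult algebra_simps
          del: qint_1 power_int_of_nat power_int_1_right power_int_minus1_right power_int_numeral)?;
        (simp add: power_int_add power_int_diff power_int_minus field_simps)?)+
  have right_map_E0_F0_minus:
    "act (ev q (n + 1) b \<otimes>\<^sub>U ev q 1 (b - int n - 2)) E0 (right_map q n x y)
      = right_map q n (q powi (b - 1) *\<^sub>C Fop q (n + 2) x + (q powi (b - 1) - q powi (b + 1)) *\<^sub>C up_e q y)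
          (q powi (b + 1) *\<^sub>C Fop q n y)"
    "act (ev q (n + 1) b \<otimes>\<^sub>U ev q 1 (b - int n - 2)) F0 (right_map q n x y)
      = right_map q n (q powi (- (b - 1)) *\<^sub>C Eop q (n + 2) x + (q powi (int n + 1 - b) - q powi (int n + 3 - b)) *\<^sub>C up_f q (n + 2) y)
          (q powi (- (b + 1)) *\<^sub>C Eop q n y)"
    for n :: nat and b :: int and x y :: "nat \<Rightarrow> complex"
    by (rule right_map_eqI[OF act_tensor_in[OF right_map_in]]; rename_tac i; case_tac i; case_tac "i = n + 1";
        simp add: coordinate_defs
          del: qint_1 power_int_of_nat power_int_1_right power_int_minus1_right power_int_numeral;
        (simp add: qint_powi powi_mult algebra_simps
          del: qint_1 power_int_of_nat power_int_1_right power_int_minus1_right power_int_numeral)?;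
        (simp add: power_int_add power_int_diff power_int_minus field_simps)?)+
  have left_map_ev:
    "act (ev q 1 g \<otimes>\<^sub>U ev q (n + 1) b) K (left_map q n x y)
      = left_map q n (Kop q (n + 2) x)
          (Kop q n y)"
    "act (ev q 1 g \<otimes>\<^sub>U ev q (n + 1) b) Kinv (left_map q n x y)
      = left_map q n (Kinvop q (n + 2) x)
          (Kinvop q n y)"
    "act (ev q 1 g \<otimes>\<^sub>U ev q (n + 1) b) F1 (left_map q n x y)
      = left_map q n (Fop q (n + 2) x)
          (Fop q n y)"
    "act (ev q 1 g \<otimes>\<^sub>U ev q (n + 1) b) E1 (left_map q n x y)
      = left_map q n (Eop q (n + 2) x)
          (Eop q n y)"
    for n :: nat and b g :: int and x y :: "nat \<Rightarrow> complex"
    by (rule left_map_eqI[OF act_tensor_in[OF left_map_in]]; rename_tac i; case_tac i; case_tac "i = n + 1";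
        simp add: coordinate_defs
          del: qint_1 power_int_of_nat power_int_1_right power_int_minus1_right power_int_numeral;
        (simp add: qint_powi powi_mult algebra_simps
          del: qint_1 power_int_of_nat power_int_1_right power_int_minus1_right power_int_numeral)?;
        (simp add: power_int_add power_int_diff power_int_minus field_simps)?)+
  have left_map_E0_F0_plus:
    "act (ev q 1 (b + int n + 2) \<otimes>\<^sub>U ev q (n + 1) b) E0 (left_map q n x y)
      = left_map q n (q powi (b + 1) *\<^sub>C Fop q (n + 2) x + (q powi (b + int n + 3) - q powi (b + int n + 1)) *\<^sub>C up_e q y)
          (q powi (b - 1) *\<^sub>C Fop q n y)"
    "act (ev q 1 (b + int n + 2) \<otimes>\<^sub>U ev q (n + 1) b) F0 (left_map q n x y)
      = left_map q n (q powi (- (b + 1)) *\<^sub>C Eop q (n + 2) x + (q powi (1 - b) - q powi (- b - 1)) *\<^sub>C up_f q (n + 2) y)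
          (q powi (- (b - 1)) *\<^sub>C Eop q n y)"
    for n :: nat and b :: int and x y :: "nat \<Rightarrow> complex"
    by (rule left_map_eqI[OF act_tensor_in[OF left_map_in]]; rename_tac i; case_tac i; case_tac "i = n + 1";
        simp add: coordinate_defs
          del: qint_1 power_int_of_nat power_int_1_right power_int_minus1_right power_int_numeral;
        (simp add: qint_powi powi_mult algebra_simps
          del: qint_1 power_int_of_nat power_int_1_right power_int_minus1_right power_int_numeral)?;
        (simp add: power_int_add power_int_diff power_int_minus field_simps)?)+
  have left_map_E0_F0_minus:
    "act (ev q 1 (b - int n - 2) \<otimes>\<^sub>U ev q (n + 1) b) E0 (left_map q n x y)
      = left_map q n (q powi (b - 1) *\<^sub>C Fop q (n + 2) x)
          (q powi (b + 1) *\<^sub>C Fop q n y + (q powi (b - int n - 1) - q powi (b - int n - 3)) *\<^sub>C down_e n x)"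
    "act (ev q 1 (b - int n - 2) \<otimes>\<^sub>U ev q (n + 1) b) F0 (left_map q n x y)
      = left_map q n (q powi (- (b - 1)) *\<^sub>C Eop q (n + 2) x)
          (q powi (- (b + 1)) *\<^sub>C Eop q n y + (q powi (1 - b) - q powi (- b - 1)) *\<^sub>C down_f x)"
    for n :: nat and b :: int and x y :: "nat \<Rightarrow> complex"
    by (rule left_map_eqI[OF act_tensor_in[OF left_map_in]]; rename_tac i; case_tac i; case_tac "i = n + 1";
        simp add: coordinate_defs
          del: qint_1 power_int_of_nat power_int_1_right power_int_minus1_right power_int_numeral;
        (simp add: qint_powi powi_mult algebra_simps
          del: qint_1 power_int_of_nat power_int_1_right power_int_minus1_right power_int_numeral)?;
        (simp add: power_int_add power_int_diff power_int_minus field_simps)?)+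
  have tensor_right_plus:
    "nf_right_plus q n b
      \<cong>\<^sub>U ev q (n + 1) b \<otimes>\<^sub>U ev q 1 (b + int n + 2)" (is "?M \<cong>\<^sub>U ?T") for n :: nat and b :: int
  proof (rule isomorphicI[of ?M "\<lambda>p. right_map q n (fst p) (snd p)" ?T "right_inv q n"])
    show "right_map q n (fst (act ?M g p)) (snd (act ?M g p)) = act ?T g (right_map q n (fst p) (snd p))" for g p
      by (cases g) (simp_all only: nf_right_plus_def ext_model_simps ext_act_def fst_conv snd_conv generator.case add_0_right
          ev_act_simps right_map_ev right_map_E0_F0_plus)
  qed (use right_inv_in in \<open>auto simp: nf_right_plus_def uspace_tensor right_map_in right_inv_right_map right_map_right_inv mem_Times_iff
    right_map_linear scaleC_prod_def simp del: One_nat_def add_2_eq_Suc'\<close>)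
  have tensor_right_minus:
    "nf_right_minus q n b
      \<cong>\<^sub>U ev q (n + 1) b \<otimes>\<^sub>U ev q 1 (b - int n - 2)" (is "?M \<cong>\<^sub>U ?T") for n :: nat and b :: int
  \<comment> \<open>\<open>ext_model\<close> lists the quotient first, here \<open>V_n\<close>,
    while \<open>right_map\<close> takes the component from \<open>V_(n+2)\<close> first; hence the
    swap.\<close>
  proof (rule isomorphicI[of ?M "\<lambda>p. right_map q n (snd p) (fst p)" ?T "prod.swap \<circ> right_inv q n"])
    show "right_map q n (snd (act ?M g p)) (fst (act ?M g p)) = act ?T g (right_map q n (snd p) (fst p))" for g p
      by (cases g) (simp_all only: nf_right_minus_def ext_model_simps ext_act_def fst_conv snd_conv generator.case add_0_right
          ev_act_simps right_map_ev right_map_E0_F0_minus)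
  qed (use right_inv_in in \<open>auto simp: nf_right_minus_def uspace_tensor right_map_in right_inv_right_map right_map_right_inv mem_Times_iff
    right_map_linear scaleC_prod_def simp del: One_nat_def add_2_eq_Suc'\<close>)
  have tensor_left_plus:
    "nf_left_plus q n b
      \<cong>\<^sub>U ev q 1 (b + int n + 2) \<otimes>\<^sub>U ev q (n + 1) b" (is "?M \<cong>\<^sub>U ?T") for n :: nat and b :: int
  proof (rule isomorphicI[of ?M "\<lambda>p. left_map q n (snd p) (fst p)" ?T "prod.swap \<circ> left_inv q n"])
    show "left_map q n (snd (act ?M g p)) (fst (act ?M g p)) = act ?T g (left_map q n (snd p) (fst p))" for g p
      by (cases g) (simp_all only: nf_left_plus_def ext_model_simps ext_act_def fst_conv snd_conv generator.case add_0_right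
          ev_act_simps left_map_ev left_map_E0_F0_plus)
  qed (use left_inv_in in \<open>auto simp: nf_left_plus_def uspace_tensor left_map_in left_inv_left_map left_map_left_inv mem_Times_iff
    left_map_linear scaleC_prod_def simp del: One_nat_def add_2_eq_Suc'\<close>)
  have tensor_left_minus:
    "nf_left_minus q n b
      \<cong>\<^sub>U ev q 1 (b - int n - 2) \<otimes>\<^sub>U ev q (n + 1) b" (is "?M \<cong>\<^sub>U ?T") for n :: nat and b :: int
  proof (rule isomorphicI[of ?M "\<lambda>p. left_map q n (fst p) (snd p)" ?T "left_inv q n"])
    show "left_map q n (fst (act ?M g p)) (snd (act ?M g p)) = act ?T g (left_map q n (fst p) (snd p))" for g p
      by (cases g) (simp_all only: nf_left_minus_def ext_model_simps ext_act_def fst_conv snd_conv generator.case add_0_right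
          ev_act_simps left_map_ev left_map_E0_F0_minus)
  qed (use left_inv_in in \<open>auto simp: nf_left_minus_def uspace_tensor left_map_in left_inv_left_map left_map_left_inv mem_Times_iff
    left_map_linear scaleC_prod_def simp del: One_nat_def add_2_eq_Suc'\<close>)

  \<comment> \<open>Choice of strings and identification of the cases\<close>
  obtain m1 a1 where s1: "\<alpha>1 = a1 - int m1 + 1" "\<beta>1 = a1 + int m1 - 1"
    using is_string_params[OF assms(3)] .
  obtain m2 a2 where s2: "\<alpha>2 = a2 - int m2 + 1" "\<beta>2 = a2 + int m2 - 1"
    using is_string_params[OF assms(4)] .
  \<comment> \<open>A trivial module gets the string that the neighbouring extension of type (1) or (4) asks for.\<close>
  define a1' where "a1' = (if m1 = 0 \<and> m2 = 2 then a2 + 2 else a1)"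
  define a2' where "a2' = (if m2 = 0 \<and> m1 = 2 then a1 - 2 else a2)"
  have ev1: "ev q m1 a1' = ev q m1 a1" and ev2: "ev q m2 a2' = ev q m2 a2"
    using ev_0 by (auto simp: a1'_def a2'_def)
  define A1 B1 A2 B2 where AB: "A1 = a1' - int m1 + 1" "B1 = a1' + int m1 - 1"
    "A2 = a2' - int m2 + 1" "B2 = a2' + int m2 - 1"
  \<comment> \<open>For a highest weight 0 or 2 the parameter is odd. So a replaced parameter keeps
    its parity, and the ends of the new string are even.\<close>
  have "even a1 \<longleftrightarrow> odd m1" "even a2 \<longleftrightarrow> odd m2"
    using assms(3,4) by (auto simp: is_string_def s1 s2)
  then have strings: "same_string \<alpha>1 \<beta>1 A1 B1" "same_string \<alpha>2 \<beta>2 A2 B2"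
    by (auto simp: same_string_def is_string_def s1 s2 a1'_def a2'_def AB)
  have ext: "nontrivial_extension V (ev q m1 a1') (ev q m2 a2')"
    using assms(6) unfolding eval_module_eq_ev[OF s1] eval_module_eq_ev[OF s2] ev1 ev2 .
  then obtain \<iota> \<pi> where "ext_sequence q V \<iota> \<pi> m1 a1' m2 a2'"
    using extension_sequence[of q V m1 a1' m2 a2'] generic_uq_module_axioms
    unfolding nontrivial_extension_def by blast
  then interpret ext_sequence q V \<iota> \<pi> m1 a1' m2 a2' .
  obtain s where "splitting s" using ex_splitting by blast
  then obtain X Y where XY: "ext_model_iso q V m1 a1' m2 a2' X Y"
  proof (rule ext_model_of_splitting, goal_cases)
    case (1 X Y)
    show ?case
      by (rule 1(1)[of X Y], unfold_locales) (use 1(2-) ext in \<open>auto simp: nontrivial_extension_def\<close>)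
  qed
  interpret ext_model_iso q V m1 a1' m2 a2' X Y by (fact XY)
  consider "m1 = m2 + 2" | "m1 = m2" | "m2 = m1 + 2" using shapes by blast
  then show ?thesis
  proof cases
    case 1
    have "m2 = 0 \<Longrightarrow> a2' = a1' - 2" using 1 by (simp add: a1'_def a2'_def)
    from classification_down[OF 1 this] show ?thesis
    proof
      assume h: "a2' = a1' - 2 \<and> V \<cong>\<^sub>U nf_right_plus q m2 (a1' - 1)"
      note iso_tensor = isomorphic_trans[OF conjunct2[OF h] tensor_right_plus]
      have "ev q (m2 + 1) (a1' - 1) = eval_module q A1 (B1 - 2)" "ev q 1 (a1' - 1 + int m2 + 2) = eval_module q B1 B1"
        by (rule eval_module_eq_ev[symmetric]; use 1 in \<open>simp add: AB\<close>)+
      then have "A2 = A1 \<and> B2 = B1 - 4 \<and> V \<cong>\<^sub>U eval_module q A1 (B1 - 2) \<otimes>\<^sub>U eval_module q B1 B1"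
        using h 1 iso_tensor by (simp add: AB)
      with strings show ?thesis by blast
    next
      assume h: "a2' = a1' + 2 \<and> V \<cong>\<^sub>U nf_left_minus q m2 (a1' + 1)"
      note iso_tensor = isomorphic_trans[OF conjunct2[OF h] tensor_left_minus]
      have "ev q 1 (a1' + 1 - int m2 - 2) = eval_module q A1 A1" "ev q (m2 + 1) (a1' + 1) = eval_module q (A1 + 2) B1"
        by (rule eval_module_eq_ev[symmetric]; use 1 in \<open>simp add: AB\<close>)+
      then have "A2 = A1 + 4 \<and> B2 = B1 \<and> V \<cong>\<^sub>U eval_module q A1 A1 \<otimes>\<^sub>U eval_module q (A1 + 2) B1"
        using h 1 iso_tensor by (simp add: AB)
      with strings show ?thesis by blast
    qed
  next
    case 2
    from classification_equal[OF 2] have h: "a1' = a2'" "m1 > 0" "V \<cong>\<^sub>U self_extension q A1 B1"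
      by (auto simp: AB)
    have "\<not> eval_module q A1 B1 \<cong>\<^sub>U trivial_module"
      unfolding eval_module_eq_ev[OF AB(1,2)] using h(2) by (rule eval_module_nontrivial)
    then have "A1 = A2 \<and> B1 = B2 \<and> \<not> eval_module q A1 B1 \<cong>\<^sub>U trivial_module \<and> V \<cong>\<^sub>U self_extension q A1 B1"
      using h 2 by (simp add: AB)
    with strings show ?thesis by blast
  next
    case 3
    have "m1 = 0 \<Longrightarrow> a1' = a2' + 2" using 3 by (simp add: a1'_def a2'_def)
    from classification_up[OF 3 this] show ?thesis
    proof
      assume h: "a1' = a2' + 2 \<and> V \<cong>\<^sub>U nf_right_minus q m1 (a2' + 1)"
      note iso_tensor = isomorphic_trans[OF conjunct2[OF h] tensor_right_minus]
      from h have "ev q (m1 + 1) (a2' + 1) = eval_module q (A1 - 2) B1"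
        "ev q 1 (a2' + 1 - int m1 - 2) = eval_module q (A1 - 4) (A1 - 4)"
        by (intro eval_module_eq_ev[symmetric]; simp add: AB)+
      then have "A2 = A1 - 4 \<and> B2 = B1 \<and>
          V \<cong>\<^sub>U eval_module q (A1 - 2) B1 \<otimes>\<^sub>U eval_module q (A1 - 4) (A1 - 4)"
        using h 3 iso_tensor by (simp add: AB)
      with strings show ?thesis by blast
    next
      assume h: "a1' = a2' - 2 \<and> V \<cong>\<^sub>U nf_left_plus q m1 (a2' - 1)"
      note iso_tensor = isomorphic_trans[OF conjunct2[OF h] tensor_left_plus]
      from h have "ev q 1 (a2' - 1 + int m1 + 2) = eval_module q (B1 + 4) (B1 + 4)"
        "ev q (m1 + 1) (a2' - 1) = eval_module q A1 (B1 + 2)"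
        by (intro eval_module_eq_ev[symmetric]; simp add: AB)+
      then have "A2 = A1 \<and> B2 = B1 + 4 \<and>
          V \<cong>\<^sub>U eval_module q (B1 + 4) (B1 + 4) \<otimes>\<^sub>U eval_module q A1 (B1 + 2)"
        using h 3 iso_tensor by (simp add: AB)
      with strings show ?thesis by blast
    qed
  qed
qed

end
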